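(* Let $\Omega\subset\mathbb{R}^n$ be bounded and open, $m\le n$. Assume the vector fields $X_1,\dots,X_m$ are of class $C^2$ and either are of Carnot type or satisfy $$\sigma^T(x)\sigma(x)+Q(x,x)\ge\eta I\quad\forall\,x\in\overline\Omega,\ \text{for some }\eta>0.$$ Let $u\in USC(\overline\Omega)$ be bounded and $\mathcal X$-convex, $v\in LSC(\overline\Omega)$ be bounded, and suppose $$-\det(D^2_{\mathcal X}u)+f(x)\le0,\qquad-\det(D^2_{\mathcal X}v)+f(x)\ge0\quad\text{in }\Omega$$ in the viscosity sense, for some $f\in C(\overline\Omega)$, $f\ge0$. Then $\sup_\Omega(u-v)\le\max_{\partial\Omega}(u-v)$.
   Context: $\sigma(x)$ is the $n\times m$ matrix whose columns $\sigma^j(x)$ are the coefficients of $X_j$, and $Q(x,p)$ is the $m\times m$ matrix with $Q_{ij}(x,p)=\tfrac12\big(D\sigma^j(x)\sigma^i(x)+D\sigma^i(x)\sigma^j(x)\big)\cdot p$. For smooth $u$: $(D^2_{\mathcal X}u)_{ij}=\tfrac12(X_iX_ju+X_jX_iu)$. The vector fields are of Carnot type if $\sigma(x)=\begin{pmatrix}I\\\tau(x)\end{pmatrix}$ with $I$ the $m\times m$ identity and $\tau$ a $C^{1,1}$ $(n-m)\times m$ matrix-valued function. Matrix inequalities are in the usual order of symmetric matrices. $u\in USC(\overline\Omega)$ is $\mathcal X$-convex if $D^2_{\mathcal X}\varphi(x)\ge0$ for all $\varphi\in C^2(\Omega)$ and all maximum points $x\in\Omega$ of $u-\varphi$. $-\det(D^2_{\mathcal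 X}u)+f(x)\le0$ in the viscosity sense: for every $\varphi\in C^2(\overline\Omega)$ and every maximum point $x_0\in\Omega$ of $u-\varphi$, $-\det D^2_{\mathcal X}\varphi(x_0)+f(x_0)\le0$. $-\det(D^2_{\mathcal X}v)+f(x)\ge0$ in the viscosity sense (restricted test functions): for every $\varphi\in C^2(\overline\Omega)$ and every minimum point $x_0\in\Omega$ of $v-\varphi$ with $D^2_{\mathcal X}\varphi(x_0)$ positive definite, $-\det D^2_{\mathcal X}\varphi(x_0)+f(x_0)\ge0$. *)

theory Defs
  imports "HOL-Analysis.Analysis"
begin

section \<open>Regularity classes\<close>

text \<open>
  Below \<open>\<Omega>\<close> is an open set and \<open>S\<close> is either \<open>\<Omega>\<close> or \<open>closure \<Omega>\<close>. A function belongs to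
  \<open>C\<^sup>k(S)\<close> if it is \<open>k\<close> times differentiable in \<open>\<Omega>\<close> and it and its derivatives up to order \<open>k\<close>
  are continuous on \<open>S\<close>; for \<open>S = closure \<Omega>\<close> this means that the derivatives, which live in
  \<open>\<Omega>\<close>, have continuous extensions to the closure.
\<close>

definition C1_on :: "'a::real_normed_vector set \<Rightarrow> 'a set \<Rightarrow> ('a \<Rightarrow> 'b::real_normed_vector) \<Rightarrow> bool" where
  "C1_on \<Omega> S g \<longleftrightarrow> continuous_on S g \<and>
     (\<exists>g' :: 'a \<Rightarrow> 'a \<Rightarrow>\<^sub>L 'b. continuous_on S g' \<and>
        (\<forall>x\<in>\<Omega>. (g has_derivative blinfun_apply (g' x)) (at x)))"

definition C2_on :: "'a::real_normed_vector set \<Rightarrow> 'a set \<Rightarrow> ('a \<Rightarrow> 'b::real_normed_vector) \<Rightarrow> bool" where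
  "C2_on \<Omega> S g \<longleftrightarrow> continuous_on S g \<and>
     (\<exists>g' :: 'a \<Rightarrow> 'a \<Rightarrow>\<^sub>L 'b. C1_on \<Omega> S g' \<and>
        (\<forall>x\<in>\<Omega>. (g has_derivative blinfun_apply (g' x)) (at x)))"

definition C11_on :: "'a::real_normed_vector set \<Rightarrow> 'a set \<Rightarrow> ('a \<Rightarrow> 'b::real_normed_vector) \<Rightarrow> bool" where
  "C11_on \<Omega> S g \<longleftrightarrow> continuous_on S g \<and>
     (\<exists>(g' :: 'a \<Rightarrow> 'a \<Rightarrow>\<^sub>L 'b) L. L-lipschitz_on S g' \<and>
        (\<forall>x\<in>\<Omega>. (g has_derivative blinfun_apply (g' x)) (at x)))"

definition usc_on :: "'a::topological_space set \<Rightarrow> ('a \<Rightarrow> real) \<Rightarrow> bool" where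
  "usc_on S u \<longleftrightarrow> (\<forall>x\<in>S. \<forall>c>u x. \<forall>\<^sub>F y in at x within S. u y < c)"

definition lsc_on :: "'a::topological_space set \<Rightarrow> ('a \<Rightarrow> real) \<Rightarrow> bool" where
  "lsc_on S v \<longleftrightarrow> (\<forall>x\<in>S. \<forall>c<v x. \<forall>\<^sub>F y in at x within S. c < v y)"


section \<open>Symmetric matrices\<close>

definition sym_mat :: "real^'m^'m \<Rightarrow> bool" where
  "sym_mat A \<longleftrightarrow> transpose A = A"

definition sym_le :: "real^'m^'m \<Rightarrow> real^'m^'m \<Rightarrow> bool" where
  "sym_le A B \<longleftrightarrow> sym_mat A \<and> sym_mat B \<and> (\<forall>\<xi>. \<xi> \<bullet> (A *v \<xi>) \<le> \<xi> \<bullet> (B *v \<xi>))"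

definition pos_def :: "real^'m^'m \<Rightarrow> bool" where
  "pos_def A \<longleftrightarrow> sym_mat A \<and> (\<forall>\<xi>. \<xi> \<noteq> 0 \<longrightarrow> 0 < \<xi> \<bullet> (A *v \<xi>))"


section \<open>Vector fields\<close>

text \<open>
  The family \<open>X\<^sub>1, \<dots>, X\<^sub>m\<close> is given by its coefficient matrix \<open>\<sigma>\<close>: the type \<open>real^'m^'n\<close>
  is that of matrices with rows indexed by \<open>'n\<close> and columns by \<open>'m\<close>.
\<close>

definition vfield :: "(real^'n \<Rightarrow> real^'m^'n) \<Rightarrow> 'm \<Rightarrow> real^'n \<Rightarrow> real^'n" where
  "vfield \<sigma> j x = column j (\<sigma> x)"

definition X_deriv :: "(real^'n \<Rightarrow> real^'m^'n) \<Rightarrow> 'm \<Rightarrow> (real^'n \<Rightarrow> real) \<Rightarrow> real^'n \<Rightarrow> real" where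
  "X_deriv \<sigma> j \<phi> x = frechet_derivative \<phi> (at x) (vfield \<sigma> j x)"

definition D2X :: "(real^'n \<Rightarrow> real^'m^'n) \<Rightarrow> (real^'n \<Rightarrow> real) \<Rightarrow> real^'n \<Rightarrow> real^'m^'m" where
  "D2X \<sigma> \<phi> x = (\<chi> i j. (X_deriv \<sigma> i (X_deriv \<sigma> j \<phi>) x + X_deriv \<sigma> j (X_deriv \<sigma> i \<phi>) x) / 2)"

text \<open>
  The Jacobian matrix at points of \<open>closure \<Omega>\<close>: on the boundary it is the limit of the Jacobians
  inside, i.e. the value of their continuous extension, for functions in \<open>C\<^sup>1(closure \<Omega>)\<close>.
\<close>

definition jacobian_cl :: "(real^'n) set \<Rightarrow> (real^'n \<Rightarrow> real^'k) \<Rightarrow> real^'n \<Rightarrow> real^'n^'k" where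
  "jacobian_cl \<Omega> g x =
     (if x \<in> \<Omega> then jacobian g (at x) else Lim (at x within \<Omega>) (\<lambda>y. jacobian g (at y)))"

definition Q_mat :: "(real^'n) set \<Rightarrow> (real^'n \<Rightarrow> real^'m^'n) \<Rightarrow> real^'n \<Rightarrow> real^'n \<Rightarrow> real^'m^'m" where
  "Q_mat \<Omega> \<sigma> x p =
     (\<chi> i j. (1/2) * ((jacobian_cl \<Omega> (vfield \<sigma> j) x *v vfield \<sigma> i x
                      + jacobian_cl \<Omega> (vfield \<sigma> i) x *v vfield \<sigma> j x) \<bullet> p))"

text \<open>
  The index type \<open>'n\<close> carries no order, so ``the first \<open>m\<close> rows'' of \<open>\<sigma>\<close> are the ones selected by
  an injective numbering \<open>\<iota> :: 'm \<Rightarrow> 'n\<close>; the remaining rows form \<open>\<tau>\<close>.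
\<close>

definition carnot_type :: "(real^'n) set \<Rightarrow> (real^'n \<Rightarrow> real^'m^'n) \<Rightarrow> bool" where
  "carnot_type \<Omega> \<sigma> \<longleftrightarrow> (\<exists>\<iota> :: 'm \<Rightarrow> 'n. inj \<iota> \<and>
     (\<forall>x\<in>closure \<Omega>. \<forall>i j. \<sigma> x $ \<iota> i $ j = (mat 1 :: real^'m^'m) $ i $ j) \<and>
     (\<forall>k. k \<notin> range \<iota> \<longrightarrow> (\<forall>j. C11_on \<Omega> (closure \<Omega>) (\<lambda>x. \<sigma> x $ k $ j))))"


section \<open>Viscosity notions\<close>

definition X_convex :: "(real^'n) set \<Rightarrow> (real^'n \<Rightarrow> real^'m^'n) \<Rightarrow> (real^'n \<Rightarrow> real) \<Rightarrow> bool" where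
  "X_convex \<Omega> \<sigma> u \<longleftrightarrow>
     (\<forall>\<phi> x. C2_on \<Omega> \<Omega> \<phi> \<and> x \<in> \<Omega> \<and> (\<forall>y\<in>\<Omega>. u y - \<phi> y \<le> u x - \<phi> x)
        \<longrightarrow> sym_le 0 (D2X \<sigma> \<phi> x))"

definition MA_subsolution ::
  "(real^'n) set \<Rightarrow> (real^'n \<Rightarrow> real^'m^'n) \<Rightarrow> (real^'n \<Rightarrow> real) \<Rightarrow> (real^'n \<Rightarrow> real) \<Rightarrow> bool" where
  "MA_subsolution \<Omega> \<sigma> f u \<longleftrightarrow>
     (\<forall>\<phi> x. C2_on \<Omega> (closure \<Omega>) \<phi> \<and> x \<in> \<Omega> \<and> (\<forall>y\<in>closure \<Omega>. u y - \<phi> y \<le> u x - \<phi> x)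
        \<longrightarrow> - det (D2X \<sigma> \<phi> x) + f x \<le> 0)"

definition MA_supersolution ::
  "(real^'n) set \<Rightarrow> (real^'n \<Rightarrow> real^'m^'n) \<Rightarrow> (real^'n \<Rightarrow> real) \<Rightarrow> (real^'n \<Rightarrow> real) \<Rightarrow> bool" where
  "MA_supersolution \<Omega> \<sigma> f v \<longleftrightarrow>
     (\<forall>\<phi> x. C2_on \<Omega> (closure \<Omega>) \<phi> \<and> x \<in> \<Omega> \<and> (\<forall>y\<in>closure \<Omega>. v x - \<phi> x \<le> v y - \<phi> y)
          \<and> pos_def (D2X \<sigma> \<phi> x)
        \<longrightarrow> - det (D2X \<sigma> \<phi> x) + f x \<ge> 0)"

end

theory Submission
  imports Defs
begin

text \<open>
  Perturb \<open>u\<close> to \<open>u\<^sub>1 = u + \<theta> w\<close> with a quadratic \<open>w\<close> such that \<open>D2X \<sigma> w \<ge> \<eta> I\<close>: half the squared norm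
  of \<open>x\<close>, or of its first \<open>m\<close> coordinates for fields of Carnot type. Since
  \<open>det (B + c I) \<ge> det B + c^m\<close> for \<open>B \<ge> 0\<close>, this makes \<open>u\<^sub>1\<close> a strict subsolution that is
  uniformly \<open>X\<close>-convex. If \<open>u\<^sub>1 - v\<close> had an interior maximum, doubling the variables would give
  points \<open>y\<close>, \<open>z\<close> near it at which \<open>u\<^sub>1\<close> and \<open>v\<close> have second order jets whose \<open>X\<close>-Hessians satisfy
  \<open>B + c I \<le> V + o(1) I\<close>. So \<open>V\<close> is positive definite, the supersolution property applies,
  and monotonicity of the determinant contradicts the strictness.

  For the jets, maximize \<open>u\<^sub>1 y - v z - k/2 |x - y|\<^sup>2 - k/2 |x - z|\<^sup>2 - p \<bullet> x\<close> over \<open>x\<close>, \<open>y\<close>, \<open>z\<close> for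
  small slopes \<open>p\<close>. The sup-convolution of \<open>u\<^sub>1\<close> and the inf-convolution of \<open>v\<close> are only
  semiconvex and semiconcave, but their double (Lasry-Lions) envelopes are of class \<open>C\<^sup>1\<^sup>,\<^sup>1\<close>, stay
  ordered, and agree with them at every maximum. The difference of the gradients of the envelopes is Lipschitz
  and maps the set of maxima onto a ball of slopes \<open>p\<close>, so this set is not negligible, and by
  Rademacher's theorem it contains a point where both gradients are differentiable. Neither
  Aleksandrov's theorem nor the area formula is needed for this.
\<close>

section \<open>Rademacher's theorem\<close>

text \<open>The supersolution may only be tested where the X-Hessian is positive definite, and
  \<open>f\<close> may vanish, so X-convexity of \<open>u\<close> alone would allow a degenerate
  \<open>V\<close>. The shift by \<open>c I\<close> yields positivity of \<open>V\<close> and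
  strictness at the same time. The auxiliary point \<open>x\<close> turns the penalised maximum into
  a maximum of a sum of two functions of one variable: slopes \<open>p\<close> range over a single
  copy of the space, and the second order condition is just \<open>A1 + A2 \<le> 0\<close> as forms.
  A minimisation over an auxiliary vector \<open>w\<close> leads back to the points
  \<open>y\<close>, \<open>z\<close> and to the usual bound by \<open>k |v1 - v2|^2\<close>. A
  semiconvex function has no Lipschitz gradient, so a null set of maxima could still produce a large
  set of slopes. The envelopes exclude this. The X-Hessian contains the gradient through the
  derivatives of the fields, and the gradients, of size \<open>k |x - y|\<close>, need not stay
  bounded as \<open>k\<close> grows. They only meet differences of coefficients of order
  \<open>|y - z|\<close>, and \<open>k |x - y| |y - z|\<close> tends to zero; the Lipschitz first
  derivatives of the fields enter here.\<close>

text \<open>The slope bounds make \<open>F\<close> a bi-Lipschitz bijection of the line, so Lebesgue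
  measure can be transported by \<open>H = inv F\<close> and stays absolutely continuous. The
  derivative is one-sided because the differentiation theorem for integrals that is applied averages
  over cubes having \<open>x\<close> as lower corner.\<close>

lemma strong_mono_lipschitz_right_derivative:
  fixes F :: "real \<Rightarrow> real"
  assumes lower: "\<And>x y. x \<le> y \<Longrightarrow> y - x \<le> F y - F x"
    and upper: "\<And>x y. x \<le> y \<Longrightarrow> F y - F x \<le> C * (y - x)"
  obtains N g where "negligible N"
    and "\<And>x. x \<notin> N \<Longrightarrow> ((\<lambda>h. (F (x + h) - F x) / h) \<longlongrightarrow> g x) (at_right 0)"
proof -
  have lip: "\<bar>F y - F x\<bar> \<le> C * \<bar>y - x\<bar>" for x y
    using lower[of x y] lower[of y x] upper[of x y] upper[of y x]
    by (cases "x \<le> y") (auto simp: abs_if)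
  have smono: "strict_mono F"
    by (intro strict_monoI) (use lower in \<open>smt (verit)\<close>)
  have "C-lipschitz_on UNIV F"
    using lip lower[of 0 1] upper[of 0 1]
    by (intro lipschitz_onI) (auto simp: dist_real_def)
  then have cont: "continuous_on UNIV F"
    by (rule lipschitz_on_continuous_on)
  have surj: "\<exists>x. F x = y" for y
  proof -
    define K where "K = \<bar>y - F 0\<bar>"
    have "F (-K) \<le> y" "y \<le> F K"
      using lower[of "-K" 0] lower[of 0 K] by (auto simp: K_def)
    with IVT'[of F "-K" y K] cont show ?thesis
      by (metis K_def abs_ge_zero continuous_on_subset neg_le_iff_le order_trans subset_UNIV minus_zero)
  qed
  define H where "H = inv F"
  have inj: "inj F"
    using smono strict_mono_imp_inj_on by blast
  have HF [simp]: "H (F x) = x" for x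
    using inj by (simp add: H_def)
  have FH [simp]: "F (H y) = y" for y
    using surj[of y] by (auto simp: H_def f_inv_into_f)
  have Hmono: "mono H"
    by (intro monoI) (metis FH smono strict_mono_less_eq)
  then have Hmeas [measurable]: "H \<in> borel_measurable borel"
    by (rule borel_measurable_mono)
  have vim: "H -` A = F ` A" for A
  proof (intro equalityI subsetI)
    fix x assume "x \<in> H -` A"
    then show "x \<in> F ` A"
      using FH[of x] by (intro image_eqI[of _ _ "H x"]) auto
  qed auto
  \<comment> \<open>the measure of an interval is the increment of \<open>F\<close>, so its Lebesgue density is the derivative of \<open>F\<close>\<close>
  define M where "M = distr lborel borel H"
  have em: "emeasure M A = emeasure lborel (F ` A)" if "A \<in> sets borel" for A
    using that by (simp add: M_def emeasure_distr vim)
  have ac: "absolutely_continuous lborel M"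
    unfolding absolutely_continuous_def
  proof
    fix A :: "real set" assume A: "A \<in> null_sets lborel"
    then have "negligible A"
      by (simp add: negligible_iff_null_sets null_sets_completionI)
    then have "negligible (F ` A)"
      using lip
      by (intro negligible_locally_Lipschitz_image)
         (auto intro!: exI[of _ UNIV] exI[of _ C])
    moreover have "F ` A \<in> sets borel"
      using A measurable_sets[OF Hmeas, of A] by (simp add: vim null_sets_def)
    ultimately have "emeasure lborel (F ` A) = 0"
      by (simp add: negligible_iff_null_sets null_sets_completion_iff null_setsD1)
    then show "A \<in> null_sets M"
      using A em[of A] by (auto simp: null_sets_def M_def)
  qed
  then obtain g0 where g0 [measurable]: "g0 \<in> borel_measurable lborel" and dens: "density lborel g0 = M"
    using sigma_finite_measure.Radon_Nikodym[OF sigma_finite_lborel ac] by (auto simp: M_def)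
  have le: "F a \<le> F b \<longleftrightarrow> a \<le> b" for a b
    using smono by (rule strict_mono_less_eq)
  have Fimg: "F ` {a..b} = {F a..F b}" for a b
  proof (intro equalityI subsetI)
    fix y assume "y \<in> {F a..F b}"
    then have "y = F (H y)" "H y \<in> {a..b}"
      using le[of a "H y"] le[of "H y" b] by simp_all
    then show "y \<in> F ` {a..b}" by blast
  qed (auto simp: le)
  have I0: "(\<integral>\<^sup>+x. g0 x * indicator {a..b} x \<partial>lborel) = ennreal (F b - F a)" if "a \<le> b" for a b
  proof -
    have "(\<integral>\<^sup>+x. g0 x * indicator {a..b} x \<partial>lborel) = emeasure M {a..b}"
      by (simp add: dens[symmetric] emeasure_density)
    also have "\<dots> = ennreal (F b - F a)"
      using that by (subst em) (auto simp: Fimg le)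
    finally show ?thesis .
  qed
  have fin: "AE x in lborel. g0 x \<noteq> \<infinity>"
  proof -
    have "AE x in lborel. \<forall>n::nat. g0 x * indicator {-real n..real n} x \<noteq> \<infinity>"
      unfolding AE_all_countable
      by (intro allI nn_integral_noteq_infinite) (auto simp: I0)
    then show ?thesis
    proof (eventually_elim)
      case (elim x)
      obtain n :: nat where "\<bar>x\<bar> \<le> real n"
        using real_arch_simple by blast
      then have "x \<in> {-real n..real n}" by auto
      with elim[rule_format, of n] show ?case by simp
    qed
  qed
  define g where "g x = enn2real (g0 x)" for x
  have gmeas [measurable]: "g \<in> borel_measurable borel"
    using g0 unfolding g_def by simp
  have I: "(g has_integral (F b - F a)) {a..b}" if "a \<le> b" for a b
  proof -
    have "(\<integral>\<^sup>+x. ennreal (if x \<in> {a..b} then g x else 0) \<partial>lborel) = (\<integral>\<^sup>+x. g0 x * indicator {a..b} x \<partial>lborel)"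
      by (rule nn_integral_cong_AE, use fin in eventually_elim)
         (auto simp: g_def indicator_def less_top)
    then have "((\<lambda>x. if x \<in> {a..b} then g x else 0) has_integral (F b - F a)) UNIV"
      using that
      by (intro nn_integral_has_integral) (auto simp: I0 g_def le)
    then show ?thesis
      by (simp only: has_integral_restrict_UNIV)
  qed
  have "g integrable_on cbox a b" for a b
    using I[of a b] by (cases "a \<le> b") (auto simp: integrable_on_def)
  from integrable_ccontinuous_explicit[OF this]
  obtain N where N: "negligible N" and
    lim: "\<And>x e. \<lbrakk>x \<notin> N; 0 < e\<rbrakk> \<Longrightarrow> \<exists>d>0. \<forall>h. 0 < h \<and> h < d \<longrightarrow>
       norm (integral (cbox x (x + h *\<^sub>R One)) g /\<^sub>R h ^ DIM(real) - g x) < e"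
    by blast
  show thesis
  proof (rule that[OF N])
    fix x assume x: "x \<notin> N"
    have I': "integral {x..x+h} g = F (x + h) - F x" if "0 < h" for h
      using I[of x "x + h"] that by (simp add: integral_unique)
    show "((\<lambda>h. (F (x + h) - F x) / h) \<longlongrightarrow> g x) (at_right 0)"
    proof (rule tendstoI)
      fix e :: real assume "0 < e"
      with lim[OF x this] obtain d where "d > 0"
        and d: "\<And>h. 0 < h \<Longrightarrow> h < d \<Longrightarrow> norm (integral (cbox x (x + h *\<^sub>R One)) g /\<^sub>R h ^ DIM(real) - g x) < e"
        by blast
      have "dist ((F (x + h) - F x) / h) (g x) < e" if "0 < h" "h < d" for h
        using d[OF that] I'[OF that(1)] by (simp add: dist_real_def divide_inverse_commute)
      with \<open>d > 0\<close> show "\<forall>\<^sub>F h in at_right 0. dist ((F (x + h) - F x) / h) (g x) < e"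
        by (auto simp: eventually_at_right_field)
    qed
  qed
qed

text \<open>Adding the linear function of slope \<open>L + 1\<close> moves all slopes into the
  interval from \<open>1\<close> to \<open>2 * L + 1\<close>; its slope is subtracted again from the
  limit.\<close>

lemma lipschitz_right_derivative_real:
  fixes f :: "real \<Rightarrow> real"
  assumes "L-lipschitz_on UNIV f"
  obtains N where "negligible N"
    and "\<And>x. x \<notin> N \<Longrightarrow> \<exists>l. ((\<lambda>h. (f (x + h) - f x) / h) \<longlongrightarrow> l) (at_right 0)"
proof -
  have lip: "\<bar>f y - f x\<bar> \<le> L * \<bar>y - x\<bar>" for x y
    using lipschitz_onD[OF assms, of y x] by (simp add: dist_real_def)
  obtain N g where N: "negligible N"
    and g: "\<And>x. x \<notin> N \<Longrightarrow> ((\<lambda>h. ((f (x + h) + (L + 1) * (x + h)) - (f x + (L + 1) * x)) / h) \<longlongrightarrow> g x) (at_right 0)"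
  proof (rule strong_mono_lipschitz_right_derivative[of "\<lambda>x. f x + (L + 1) * x" "2 * L + 1"])
    show "y - x \<le> f y + (L + 1) * y - (f x + (L + 1) * x)"
         "f y + (L + 1) * y - (f x + (L + 1) * x) \<le> (2 * L + 1) * (y - x)" if "x \<le> y" for x y
      using lip[of y x] that by (auto simp: abs_if algebra_simps split: if_splits)
  qed blast
  show thesis
  proof (rule that[OF N])
    fix x assume "x \<notin> N"
    from tendsto_diff[OF g[OF this] tendsto_const[of "L + 1"]]
    have "((\<lambda>h. (f (x + h) - f x) / h) \<longlongrightarrow> g x - (L + 1)) (at_right 0)"
    proof (rule Lim_transform_eventually)
      show "\<forall>\<^sub>F h in at_right 0. (f (x + h) + (L + 1) * (x + h) - (f x + (L + 1) * x)) / h - (L + 1)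
          = (f (x + h) - f x) / h"
        by (auto simp: eventually_at_right_field field_simps intro!: exI[of _ 1])
    qed
    then show "\<exists>l. ((\<lambda>h. (f (x + h) - f x) / h) \<longlongrightarrow> l) (at_right 0)" by blast
  qed
qed

section \<open>Directional derivatives along rays and their linearity almost everywhere\<close>

definition has_ray_derivative :: "('a::real_normed_vector \<Rightarrow> real) \<Rightarrow> 'a \<Rightarrow> 'a \<Rightarrow> real \<Rightarrow> bool" where
  "has_ray_derivative f v x l \<longleftrightarrow> ((\<lambda>t. (f (x + t *\<^sub>R v) - f x) / t) \<longlongrightarrow> l) (at_right 0)"

lemma has_ray_derivative_unique:
  "has_ray_derivative f v x l \<Longrightarrow> has_ray_derivative f v x l' \<Longrightarrow> l = l'"
  unfolding has_ray_derivative_def by (rule tendsto_unique[rotated]) auto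

lemma has_ray_derivative_zero: "has_ray_derivative f 0 x 0"
  by (simp add: has_ray_derivative_def)

lemma has_ray_derivative_scale:
  assumes "has_ray_derivative f v x l" "c > 0"
  shows "has_ray_derivative f (c *\<^sub>R v) x (c * l)"
proof -
  have "filterlim (\<lambda>t. t * c) (at_right 0) (at_right (0::real))"
    unfolding filterlim_at
  proof (intro conjI)
    show "((\<lambda>t. t * c) \<longlongrightarrow> 0) (at_right 0)"
      by (rule tendsto_eq_intros refl | simp)+
    show "\<forall>\<^sub>F t in at_right 0. t * c \<in> {0<..} \<and> t * c \<noteq> 0"
      using assms(2) by (auto simp: eventually_at_right_field intro!: exI[of _ 1])
  qed
  from filterlim_compose[OF assms(1)[unfolded has_ray_derivative_def] this]
  have "((\<lambda>t. c * ((f (x + (t * c) *\<^sub>R v) - f x) / (t * c))) \<longlongrightarrow> c * l) (at_right 0)"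
    by (intro tendsto_mult_left)
  then show ?thesis
    using assms(2) by (simp add: has_ray_derivative_def)
qed

text \<open>Cauchy's criterion with rational increments only: continuity fills in the real ones. The
  right-hand side involves countably many conditions, which makes the set of points with a ray
  derivative measurable.\<close>

lemma right_limit_iff_rational_Cauchy:
  fixes g :: "real \<Rightarrow> real"
  assumes cont: "continuous_on {0<..} g"
  shows "(\<exists>l. (g \<longlongrightarrow> l) (at_right 0)) \<longleftrightarrow>
    (\<forall>n::nat. \<exists>k::nat. \<forall>s t::rat. 0 < real_of_rat s \<and> real_of_rat s < 1 / (real k + 1) \<and>
       0 < real_of_rat t \<and> real_of_rat t < 1 / (real k + 1) \<longrightarrow>
       \<bar>g (of_rat s) - g (of_rat t)\<bar> \<le> 1 / (real n + 1))" (is "?L \<longleftrightarrow> (\<forall>n. \<exists>k. ?C n k)")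
proof
  assume ?L
  then obtain l where l: "(g \<longlongrightarrow> l) (at_right 0)" by blast
  show "\<forall>n. \<exists>k. ?C n k"
  proof
    fix n :: nat
    have "0 < 1 / (2 * (real n + 1))" by simp
    with l have "\<forall>\<^sub>F t in at_right 0. dist (g t) l < 1 / (2 * (real n + 1))"
      by (rule tendstoD)
    then obtain d where d: "d > 0" "\<And>t. 0 < t \<Longrightarrow> t < d \<Longrightarrow> dist (g t) l < 1 / (2 * (real n + 1))"
      by (auto simp: eventually_at_right_field)
    obtain k :: nat where "inverse (real (Suc k)) < d"
      using reals_Archimedean[OF d(1)] by blast
    then have k: "1 / (real k + 1) < d"
      by (simp add: inverse_eq_divide add.commute)
    have "\<bar>g s - g t\<bar> \<le> 1 / (real n + 1)"
      if "0 < s" "s < 1 / (real k + 1)" "0 < t" "t < 1 / (real k + 1)" for s t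
    proof -
      have "dist (g s) (g t) < 1 / (2 * (real n + 1)) + 1 / (2 * (real n + 1))"
        using d(2)[of s] d(2)[of t] that k by (intro dist_triangle_less_add[of _ l]) auto
      then show ?thesis by (simp add: dist_real_def field_simps)
    qed
    then show "\<exists>k. ?C n k" by blast
  qed
next
  assume R: "\<forall>n. \<exists>k. ?C n k"
  have near: "\<exists>r::rat. 0 < real_of_rat r \<and> real_of_rat r < b \<and> \<bar>g (of_rat r) - g s\<bar> < e"
    if s: "0 < s" "s < b" and e: "0 < e" for s b e
  proof -
    have "isCont g s"
      using cont s(1) by (simp add: continuous_on_eq_continuous_at)
    then obtain d where d: "d > 0" "\<And>t. dist t s < d \<Longrightarrow> dist (g t) (g s) < e"
      using e by (auto simp: continuous_at_eps_delta)
    obtain r where "s < real_of_rat r" "real_of_rat r < min b (s + d)"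
      using of_rat_dense[of s "min b (s + d)"] s d(1) by auto
    moreover from this s(1) have "0 < real_of_rat r" by linarith
    ultimately show ?thesis
      using d(2)[of "of_rat r"] by (intro exI[of _ r] conjI) (auto simp: dist_real_def)
  qed
  have R': "\<exists>b>0. \<forall>s t. 0 < s \<and> s < b \<and> 0 < t \<and> t < b \<longrightarrow> \<bar>g s - g t\<bar> \<le> 1 / (real n + 1)" for n :: nat
  proof -
    obtain k where k: "?C n k" using R by blast
    let ?b = "1 / (real k + 1)"
    have "\<bar>g s - g t\<bar> \<le> 1 / (real n + 1)" if st: "0 < s" "s < ?b" "0 < t" "t < ?b" for s t
    proof (rule field_le_epsilon)
      fix e :: real assume "0 < e"
      then have e: "0 < e / 2" by simp
      obtain p q :: rat where "0 < real_of_rat p" "real_of_rat p < ?b" "\<bar>g (of_rat p) - g s\<bar> < e / 2"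
        and "0 < real_of_rat q" "real_of_rat q < ?b" "\<bar>g (of_rat q) - g t\<bar> < e / 2"
        using near[OF st(1,2) e] near[OF st(3,4) e] by blast
      with k show "\<bar>g s - g t\<bar> \<le> 1 / (real n + 1) + e"
        by (smt (verit) field_sum_of_halves)
    qed
    then show ?thesis by (intro exI[of _ ?b]) auto
  qed
  have "cauchy_filter (filtermap g (at_right 0))"
    unfolding cauchy_filter_metric_filtermap
  proof (intro allI impI)
    fix e :: real assume "0 < e"
    then obtain n :: nat where n: "inverse (real (Suc n)) < e"
      using reals_Archimedean by blast
    obtain b where b: "b > 0" "\<And>s t. 0 < s \<and> s < b \<and> 0 < t \<and> t < b \<Longrightarrow> \<bar>g s - g t\<bar> \<le> 1 / (real n + 1)"
      using R' by blast
    have "dist (g s) (g t) < e" if "0 < s \<and> s < b" "0 < t \<and> t < b" for s t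
      using b(2)[of s t] that n by (simp add: dist_real_def inverse_eq_divide add.commute)
    moreover have "\<forall>\<^sub>F t in at_right 0. 0 < t \<and> t < b"
      using b(1) by (auto simp: eventually_at_right_field)
    ultimately show "\<exists>P. eventually P (at_right 0) \<and> (\<forall>s t. P s \<and> P t \<longrightarrow> dist (g s) (g t) < e)"
      by (intro exI[of _ "\<lambda>t. 0 < t \<and> t < b"]) blast
  qed
  moreover have "complete (UNIV :: real set)"
    by (meson Cauchy_convergent UNIV_I complete_def convergent_def)
  ultimately obtain l where "filtermap g (at_right 0) \<le> nhds l"
    using cauchy_filter_complete_converges[of "filtermap g (at_right 0)" UNIV] by (auto simp: filtermap_bot_iff)
  then show ?L by (auto simp: filterlim_def)
qed

text \<open>
  Averaging over the translates of the exceptional set along \<open>v\<close> allows to use Fubini's theorem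
  in the direction \<open>v\<close> without a change of coordinates.
\<close>

lemma AE_has_ray_derivative:
  fixes f :: "'a::euclidean_space \<Rightarrow> real"
  assumes lip: "L-lipschitz_on UNIV f"
  shows "AE x in lborel. \<exists>l. has_ray_derivative f v x l"
proof -
  have cf: "continuous_on UNIV f"
    using lip by (rule lipschitz_on_continuous_on)
  have [measurable]: "f \<in> borel_measurable borel"
    using cf by (rule borel_measurable_continuous_onI)
  have cg: "continuous_on {0<..} (\<lambda>t. (f (x + t *\<^sub>R v) - f x) / t)" for x
    by (intro continuous_intros continuous_on_compose2[OF cf]) auto
  define E where "E x \<longleftrightarrow> (\<exists>l. has_ray_derivative f v x l)" for x
  have E_eq: "E x \<longleftrightarrow> (\<forall>n::nat. \<exists>k::nat. \<forall>s t::rat. 0 < real_of_rat s \<and> real_of_rat s < 1 / (real k + 1) \<and>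
       0 < real_of_rat t \<and> real_of_rat t < 1 / (real k + 1) \<longrightarrow>
       \<bar>(f (x + real_of_rat s *\<^sub>R v) - f x) / real_of_rat s - (f (x + real_of_rat t *\<^sub>R v) - f x) / real_of_rat t\<bar>
        \<le> 1 / (real n + 1))" for x
    unfolding E_def has_ray_derivative_def by (rule right_limit_iff_rational_Cauchy[OF cg])
  have [measurable]: "Measurable.pred borel E"
    unfolding E_eq[abs_def] by measurable
  define N where "N = {x. \<not> E x}"
  have [measurable]: "N \<in> sets borel"
    unfolding N_def by measurable
  have line: "(\<integral>\<^sup>+t. indicator {0..1} t * indicator N (x + t *\<^sub>R v) \<partial>lborel) = 0" for x
  proof -
    have lips: "(L * norm v)-lipschitz_on UNIV (\<lambda>t. f (x + t *\<^sub>R v))"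
    proof (rule lipschitz_onI)
      show "dist (f (x + s *\<^sub>R v)) (f (x + t *\<^sub>R v)) \<le> L * norm v * dist s t" for s t
        using lipschitz_onD[OF lip, of "x + s *\<^sub>R v" "x + t *\<^sub>R v"]
        by (simp add: dist_norm scaleR_left_diff_distrib[symmetric] mult.assoc mult.left_commute mult.commute)
    qed (use lip in \<open>auto simp: lipschitz_on_def\<close>)
    obtain T where T: "negligible T"
      and d: "\<And>t. t \<notin> T \<Longrightarrow> \<exists>l. ((\<lambda>h. (f (x + (t + h) *\<^sub>R v) - f (x + t *\<^sub>R v)) / h) \<longlongrightarrow> l) (at_right 0)"
      using lipschitz_right_derivative_real[OF lips] by blast
    have "E (x + t *\<^sub>R v)" if "t \<notin> T" for t
      using d[OF that] by (simp add: E_def has_ray_derivative_def scaleR_add_left add.assoc)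
    then have sub: "{t. x + t *\<^sub>R v \<in> N} \<subseteq> T"
      by (auto simp: N_def)
    have "AE t in lborel. x + t *\<^sub>R v \<notin> N"
    proof (rule AE_I')
      show "{t \<in> space lborel. \<not> x + t *\<^sub>R v \<notin> N} \<subseteq> {t. x + t *\<^sub>R v \<in> N}" by auto
      have "negligible {t. x + t *\<^sub>R v \<in> N}"
        using T sub by (rule negligible_subset)
      moreover have "{t. x + t *\<^sub>R v \<in> N} \<in> sets borel"
        by measurable
      ultimately show "{t. x + t *\<^sub>R v \<in> N} \<in> null_sets lborel"
        by (simp add: negligible_iff_null_sets null_sets_completion_iff)
    qed
    then have "(\<integral>\<^sup>+t. indicator {0..1} t * indicator N (x + t *\<^sub>R v) \<partial>lborel) = (\<integral>\<^sup>+t. 0 \<partial>(lborel :: real measure))"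
      by (intro nn_integral_cong_AE) (auto simp: indicator_def)
    then show ?thesis by simp
  qed
  have slice: "(\<integral>\<^sup>+x. indicator {0..1} t * indicator N (x + t *\<^sub>R v) \<partial>lborel) = indicator {0..1} t * emeasure lborel N" for t :: real
  proof -
    have "(\<integral>\<^sup>+x. indicator N (x + t *\<^sub>R v) \<partial>lborel) = (\<integral>\<^sup>+x. indicator N x \<partial>distr lborel borel ((+) (t *\<^sub>R v)))"
      by (subst nn_integral_distr) (auto simp: add.commute)
    also have "\<dots> = emeasure lborel N"
      by (simp add: lborel_distr_plus)
    finally show ?thesis
      by (subst nn_integral_cmult) auto
  qed
  \<comment> \<open>The interval \<open>{0..1}\<close> has length one, so it does not change the
    measure of \<open>N\<close>. Translation invariance gives every slice in \<open>x\<close> this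
    measure, while by the one-dimensional result every line in direction \<open>v\<close> meets
    \<open>N\<close> in a null set.\<close>
  have "emeasure lborel N = (\<integral>\<^sup>+t. indicator {0..1} t * emeasure lborel N \<partial>(lborel :: real measure))"
    by (subst nn_integral_multc) auto
  also have "\<dots> = (\<integral>\<^sup>+t. (\<integral>\<^sup>+x. indicator {0..1} t * indicator N (x + t *\<^sub>R v) \<partial>lborel) \<partial>lborel)"
    by (simp add: slice)
  also have "\<dots> = (\<integral>\<^sup>+x. (\<integral>\<^sup>+t. indicator {0..1} t * indicator N (x + t *\<^sub>R v) \<partial>lborel) \<partial>lborel)"
    by (rule lborel_pair.Fubini') measurable
  also have "\<dots> = 0"
    by (simp add: line)
  finally have "N \<in> null_sets lborel"
    by (auto simp: null_sets_def)
  then show ?thesis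
    by (rule AE_I') (auto simp: N_def E_def)
qed

lemma has_ray_derivative_LIMSEQ:
  assumes "has_ray_derivative f v x l"
  shows "(\<lambda>k. (real k + 1) * (f (x + (1 / (real k + 1)) *\<^sub>R v) - f x)) \<longlonglongrightarrow> l"
proof -
  have "filterlim (\<lambda>k. 1 / (real k + 1)) (at_right 0) sequentially"
    unfolding filterlim_at
    using LIMSEQ_inverse_real_of_nat by (auto simp: inverse_eq_divide add.commute)
  from filterlim_compose[OF assms[unfolded has_ray_derivative_def] this] show ?thesis
    by (simp add: field_simps)
qed

text \<open>The quotient of \<open>f\<close> along \<open>v + w\<close> is the quotient along
  \<open>v\<close> at \<open>x\<close> plus the quotient along \<open>w\<close> at the shifted point
  \<open>x + s k\<close>. Integrated over a box, the shift disappears in the limit by dominated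
  convergence, so the defect \<open>G\<close> of additivity has integral zero over every box and
  vanishes almost everywhere.\<close>

lemma AE_has_ray_derivative_add:
  fixes f :: "'a::euclidean_space \<Rightarrow> real"
  assumes lip: "L-lipschitz_on UNIV f"
  shows "AE x in lborel. \<forall>a b. has_ray_derivative f v x a \<longrightarrow> has_ray_derivative f w x b \<longrightarrow>
    has_ray_derivative f (v + w) x (a + b)"
proof -
  have cf: "continuous_on UNIV f"
    using lip by (rule lipschitz_on_continuous_on)
  have [measurable]: "f \<in> borel_measurable borel"
    using cf by (rule borel_measurable_continuous_onI)
  have L0: "0 \<le> L"
    using lip by (rule lipschitz_on_nonneg)
  define F where "F v k x = (real k + 1) * (f (x + (1 / (real k + 1)) *\<^sub>R v) - f x)" for v x and k :: nat
  have Fm [measurable]: "F v k \<in> borel_measurable borel" for v k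
    unfolding F_def by measurable
  have Fb: "\<bar>F v k x\<bar> \<le> L * norm v" for v k x
  proof -
    have "\<bar>f (x + (1 / (real k + 1)) *\<^sub>R v) - f x\<bar> \<le> L * (norm v / (real k + 1))"
      using lipschitz_onD[OF lip, of "x + (1 / (real k + 1)) *\<^sub>R v" x] by (simp add: dist_norm)
    then have "(real k + 1) * \<bar>f (x + (1 / (real k + 1)) *\<^sub>R v) - f x\<bar> \<le> (real k + 1) * (L * (norm v / (real k + 1)))"
      by (intro mult_left_mono) auto
    then show ?thesis by (simp add: F_def abs_mult)
  qed
  \<comment> \<open>A limit along the sequence of increments \<open>1 / (k + 1)\<close> is
    measurable in \<open>x\<close>, and it equals the ray derivative wherever the latter
    exists.\<close>
  define D where "D v x = lim (\<lambda>k. F v k x)" for v x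
  have Dm [measurable]: "D v \<in> borel_measurable borel" for v
    unfolding D_def by measurable
  have FD: "AE x in lborel. (\<lambda>k. F v k x) \<longlonglongrightarrow> D v x" for v
    using AE_has_ray_derivative[OF lip, of v]
  proof eventually_elim
    case (elim x)
    then obtain l where "(\<lambda>k. F v k x) \<longlonglongrightarrow> l"
      using has_ray_derivative_LIMSEQ unfolding F_def by blast
    then show ?case
      unfolding D_def using limI by blast
  qed
  define G where "G x = D (v + w) x - D v x - D w x" for x
  have int_box: "integrable lborel (\<lambda>x. indicator (cbox a b) x * c :: real)" for a b :: 'a and c
    by (intro integrable_mult_left integrable_real_indicator) (auto simp: emeasure_lborel_cbox_eq)
  have main: "integrable lborel (\<lambda>x. indicator (cbox a b) x * G x) \<and>
      (\<integral>x. indicator (cbox a b) x * G x \<partial>lborel) = 0" for a b :: 'a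
  proof -
    have conv: "(\<lambda>k. \<integral>x. indicator (cbox a b) x * F u k x \<partial>lborel) \<longlonglongrightarrow> (\<integral>x. indicator (cbox a b) x * D u x \<partial>lborel)"
      and intD: "integrable lborel (\<lambda>x. indicator (cbox a b) x * D u x)" for u
    proof -
      have *: "AE x in lborel. (\<lambda>k. indicator (cbox a b) x * F u k x) \<longlonglongrightarrow> indicator (cbox a b) x * D u x"
        using FD[of u] by eventually_elim (rule tendsto_mult_left)
      have **: "AE x in lborel. norm (indicator (cbox a b) x * F u k x) \<le> indicator (cbox a b) x * (L * norm u)" for k
        using Fb[of u k] by (auto simp: indicator_def)
      show "(\<lambda>k. \<integral>x. indicator (cbox a b) x * F u k x \<partial>lborel) \<longlonglongrightarrow> (\<integral>x. indicator (cbox a b) x * D u x \<partial>lborel)"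
        by (rule integral_dominated_convergence[OF _ _ int_box * **]) measurable
      show "integrable lborel (\<lambda>x. indicator (cbox a b) x * D u x)"
        by (rule integrable_dominated_convergence[OF _ _ int_box * **]) measurable
    qed
    have intF: "integrable lborel (\<lambda>x. indicator (cbox a b) x * F u k x)" for u k
      by (rule Bochner_Integration.integrable_bound[OF int_box[of a b "L * norm u"]])
         (use Fb[of u k] L0 in \<open>auto simp: indicator_def abs_mult\<close>)
    define s where "s k = (1 / (real k + 1)) *\<^sub>R v" for k :: nat
    have s0: "s \<longlonglongrightarrow> 0"
    proof -
      have "(\<lambda>k. 1 / (real k + 1)) \<longlonglongrightarrow> 0"
        using LIMSEQ_inverse_real_of_nat by (simp add: inverse_eq_divide add.commute)
      from tendsto_scaleR[OF this tendsto_const[of v]] show ?thesis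
        unfolding s_def by simp
    qed
    have Fadd: "F (v + w) k x = F v k x + F w k (x + s k)" for k x
      by (simp add: F_def s_def algebra_simps)
    obtain R where R: "R > 0" "cbox a b \<subseteq> ball 0 R"
      using bounded_subset_ballD[OF bounded_cbox[of a b], of 0] by blast
    \<comment> \<open>All translates of the box by \<open>s k\<close> lie in this ball, since
      \<open>norm (s k)\<close> is at most \<open>norm v\<close>; its indicator gives the common
      dominating function.\<close>
    define B :: "'a set" where "B = cball 0 (R + norm v)"
    have s_le: "norm (s k) \<le> norm v" for k
    proof -
      have "norm (s k) = 1 / (real k + 1) * norm v"
        by (simp add: s_def)
      also have "\<dots> \<le> 1 * norm v"
        by (intro mult_right_mono) auto
      finally show ?thesis by simp
    qed
    have shift_in: "y \<in> B" if "y - s k \<in> cbox a b" for y k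
    proof -
      have "norm (y - s k) < R" using that R by auto
      then have "norm y < R + norm v"
        using s_le[of k] norm_triangle_sub[of y "s k"] by linarith
      then show ?thesis by (simp add: B_def)
    qed
    \<comment> \<open>The quotient at a moving point need not converge pointwise. Translation puts
      the shift on the indicator of the box, which converges off the boundary of the box.\<close>
    have shift: "(\<integral>x. indicator (cbox a b) x * F w k (x + s k) \<partial>lborel) = (\<integral>y. indicator (cbox a b) (y - s k) * F w k y \<partial>lborel)" for k
    proof -
      have "(\<integral>y. indicator (cbox a b) (y - s k) * F w k y \<partial>lborel)
          = (\<integral>y. indicator (cbox a b) (y - s k) * F w k y \<partial>distr lborel borel ((+) (s k)))"
        by (simp add: lborel_distr_plus)
      also have "\<dots> = (\<integral>x. indicator (cbox a b) x * F w k (x + s k) \<partial>lborel)"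
        by (subst integral_distr) (auto simp: add.commute)
      finally show ?thesis by simp
    qed
    have lim_shift: "(\<lambda>k. \<integral>x. indicator (cbox a b) x * F w k (x + s k) \<partial>lborel) \<longlonglongrightarrow> (\<integral>x. indicator (cbox a b) x * D w x \<partial>lborel)"
      unfolding shift
    proof (rule integral_dominated_convergence)
      show "integrable lborel (\<lambda>y. indicator B y * (L * norm w))"
        by (intro integrable_mult_left integrable_real_indicator) (use emeasure_bounded_finite[OF bounded_cball, of 0 "R + norm v"] in \<open>auto simp: B_def\<close>)
      show "AE y in lborel. norm (indicator (cbox a b) (y - s k) * F w k y) \<le> indicator B y * (L * norm w)" for k
        using Fb[of w k] shift_in by (intro AE_I2) (auto simp: indicator_def intro: order_trans[OF abs_ge_zero])
      have fr: "AE y in lborel. y \<notin> cbox a b - box a b"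
      proof (rule AE_I')
        have "negligible (cbox a b - box a b)" by (rule negligible_frontier_interval)
        then show "cbox a b - box a b \<in> null_sets lborel"
          by (simp add: negligible_iff_null_sets null_sets_completion_iff)
      qed auto
      show "AE y in lborel. (\<lambda>k. indicator (cbox a b) (y - s k) * F w k y) \<longlonglongrightarrow> indicator (cbox a b) y * D w y"
        using FD[of w] fr
      proof eventually_elim
        case (elim y)
        have ys: "(\<lambda>k. y - s k) \<longlonglongrightarrow> y"
          using tendsto_diff[OF tendsto_const s0, of y] by simp
        have "\<forall>\<^sub>F k in sequentially. indicator (cbox a b) (y - s k) = (indicator (cbox a b) y :: real)"
        proof (cases "y \<in> cbox a b")
          case True
          with elim have "y \<in> box a b" by blast
          then have "\<forall>\<^sub>F k in sequentially. y - s k \<in> box a b"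
            using topological_tendstoD[OF ys open_box] by blast
          then show ?thesis
            by eventually_elim (use True box_subset_cbox[of a b] in \<open>auto simp: indicator_def\<close>)
        next
          case False
          then have "\<forall>\<^sub>F k in sequentially. y - s k \<in> - cbox a b"
            using topological_tendstoD[OF ys, of "- cbox a b"] by (auto simp: open_Compl closed_cbox)
          then show ?thesis
            by eventually_elim (use False in \<open>auto simp: indicator_def\<close>)
        qed
        then have "(\<lambda>k. indicator (cbox a b) (y - s k) :: real) \<longlonglongrightarrow> indicator (cbox a b) y"
          by (rule tendsto_eventually)
        then show ?case
          using elim(1) by (rule tendsto_mult)
      qed
    qed measurable
    have intS: "integrable lborel (\<lambda>x. indicator (cbox a b) x * F w k (x + s k))" for k
      by (rule Bochner_Integration.integrable_bound[OF int_box[of a b "L * norm w"]])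
         (use Fb[of w k] L0 in \<open>auto simp: indicator_def abs_mult\<close>)
    have "(\<integral>x. indicator (cbox a b) x * F (v + w) k x \<partial>lborel) =
       (\<integral>x. indicator (cbox a b) x * F v k x \<partial>lborel) + (\<integral>x. indicator (cbox a b) x * F w k (x + s k) \<partial>lborel)" for k
      unfolding Fadd distrib_left by (rule Bochner_Integration.integral_add[OF intF intS])
    then have "(\<lambda>k. \<integral>x. indicator (cbox a b) x * F (v + w) k x \<partial>lborel) \<longlonglongrightarrow>
       (\<integral>x. indicator (cbox a b) x * D v x \<partial>lborel) + (\<integral>x. indicator (cbox a b) x * D w x \<partial>lborel)"
      using tendsto_add[OF conv[of v] lim_shift] by simp
    with conv[of "v + w"] have "(\<integral>x. indicator (cbox a b) x * D (v + w) x \<partial>lborel) =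
       (\<integral>x. indicator (cbox a b) x * D v x \<partial>lborel) + (\<integral>x. indicator (cbox a b) x * D w x \<partial>lborel)"
      by (rule LIMSEQ_unique)
    then show ?thesis
      using intD[of "v + w"] intD[of v] intD[of w] by (simp add: G_def right_diff_distrib)
  qed
  have hi: "(G has_integral 0) (cbox a b)" for a b
  proof -
    have "((\<lambda>x. indicator (cbox a b) x * G x) has_integral 0) UNIV"
      using has_integral_integral_lborel main[of a b] by metis
    moreover have "(\<lambda>x. indicator (cbox a b) x * G x) = (\<lambda>x. if x \<in> cbox a b then G x else 0)"
      by (auto simp: indicator_def)
    ultimately show ?thesis
      by (simp only: has_integral_restrict_UNIV)
  qed
  then have "\<And>a b. G integrable_on cbox a b"
    by blast
  from integrable_ccontinuous_explicit[OF this]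
  obtain N where N: "negligible N" and
    lim: "\<And>x e. \<lbrakk>x \<notin> N; 0 < e\<rbrakk> \<Longrightarrow> \<exists>d>0. \<forall>h. 0 < h \<and> h < d \<longrightarrow>
       norm (integral (cbox x (x + h *\<^sub>R One)) G /\<^sub>R h ^ DIM('a) - G x) < e"
    by blast
  have G0: "G x = 0" if "x \<notin> N" for x
  proof (rule ccontr)
    assume "G x \<noteq> 0"
    then have "0 < \<bar>G x\<bar>" by simp
    from lim[OF that this] obtain d where "d > 0" and
      d: "\<And>h. 0 < h \<Longrightarrow> h < d \<Longrightarrow> norm (integral (cbox x (x + h *\<^sub>R One)) G /\<^sub>R h ^ DIM('a) - G x) < \<bar>G x\<bar>"
      by blast
    from d[of "d / 2"] \<open>d > 0\<close> show False
      by (simp add: integral_unique[OF hi])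
  qed
  have "AE x in lebesgue. x \<notin> N"
    using N by (simp add: AE_not_in negligible_iff_null_sets)
  then have "AE x in lborel. x \<notin> N"
    by (simp add: AE_completion_iff)
  then show ?thesis
    using AE_has_ray_derivative[OF lip, of "v + w"]
  proof eventually_elim
    case (elim x)
    then obtain c where c: "has_ray_derivative f (v + w) x c" by blast
    have Dl: "D u x = l" if "has_ray_derivative f u x l" for u l
      using has_ray_derivative_LIMSEQ[OF that] unfolding D_def F_def by (rule limI)
    have "c = D v x + D w x"
      using G0[OF elim(1)] Dl[OF c] by (simp add: G_def)
    with c Dl show ?case by blast
  qed
qed

section \<open>From directional derivatives to differentiability\<close>

text \<open>The difference quotients are Lipschitz in the direction, uniformly in the increment. By
  compactness of the unit sphere finitely many directions from \<open>V\<close> control all of them,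
  which makes the convergence uniform.\<close>

lemma has_derivative_dense_ray_derivatives:
  fixes f :: "'a::euclidean_space \<Rightarrow> real"
  assumes lip: "L-lipschitz_on UNIV f"
    and dense: "closure V = UNIV"
    and ray: "\<And>v. v \<in> V \<Longrightarrow> has_ray_derivative f v x (D v)"
    and lin: "bounded_linear D"
  shows "(f has_derivative D) (at x)"
proof -
  have L0: "0 \<le> L"
    using lip by (rule lipschitz_on_nonneg)
  obtain C where C: "C > 0" "\<And>h. norm (D h) \<le> norm h * C"
    using bounded_linear.pos_bounded[OF lin] by blast
  interpret D: bounded_linear D by fact
  show ?thesis
    unfolding has_derivative_at_alt
  proof (intro conjI lin allI impI)
    fix e :: real assume "0 < e"
    \<comment> \<open>Three errors of size \<open>t * r\<close> are to be added: replacing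
      \<open>u\<close> by \<open>v\<close> in \<open>f\<close> costs the factor \<open>L\<close>,
      the quotient along \<open>v\<close> costs \<open>1\<close>, and replacing \<open>v\<close> by
      \<open>u\<close> in \<open>D\<close> costs \<open>C\<close>.\<close>
    define r where "r = e / (L + C + 1)"
    have r: "r > 0" using \<open>0 < e\<close> L0 C by (simp add: r_def)
    have "sphere 0 1 \<subseteq> (\<Union>v\<in>V. ball v r)"
    proof
      fix u :: 'a
      have "u \<in> closure V" using dense by simp
      then obtain v where "v \<in> V" "dist v u < r"
        using closure_approachable r by blast
      then show "u \<in> (\<Union>v\<in>V. ball v r)" by auto
    qed
    moreover have "compact (sphere 0 1 :: 'a set)" by simp
    ultimately obtain W where W: "W \<subseteq> V" "finite W" "sphere 0 1 \<subseteq> (\<Union>v\<in>W. ball v r)"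
      using compactE_image[of "sphere 0 1 :: 'a set" V "\<lambda>v. ball v r"] by auto
    have "\<forall>\<^sub>F t in at_right 0. \<forall>v\<in>W. dist ((f (x + t *\<^sub>R v) - f x) / t) (D v) < r"
    proof (rule eventually_ball_finite[OF W(2)], intro ballI)
      fix v assume "v \<in> W"
      with W(1) ray have "has_ray_derivative f v x (D v)" by blast
      then show "\<forall>\<^sub>F t in at_right 0. dist ((f (x + t *\<^sub>R v) - f x) / t) (D v) < r"
        unfolding has_ray_derivative_def using r by (rule tendstoD)
    qed
    then obtain d where d: "d > 0"
      "\<And>t v. 0 < t \<Longrightarrow> t < d \<Longrightarrow> v \<in> W \<Longrightarrow> dist ((f (x + t *\<^sub>R v) - f x) / t) (D v) < r"
      by (auto simp: eventually_at_right_field)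
    have "norm (f y - f x - D (y - x)) \<le> e * norm (y - x)" if y: "norm (y - x) < d" for y
    proof (cases "y = x")
      case True then show ?thesis by (simp add: D.zero)
    next
      case False
      define t where "t = norm (y - x)"
      define u where "u = (1 / t) *\<^sub>R (y - x)"
      have t: "0 < t" "t < d" using False y by (auto simp: t_def)
      have u: "norm u = 1" "y = x + t *\<^sub>R u" using t(1) by (auto simp: u_def t_def)
      obtain v where v: "v \<in> W" "dist v u < r" using W(3) u(1) by force
      have e1: "\<bar>f (x + t *\<^sub>R u) - f (x + t *\<^sub>R v)\<bar> \<le> L * (t * r)"
      proof -
        have "\<bar>f (x + t *\<^sub>R u) - f (x + t *\<^sub>R v)\<bar> \<le> L * (t * dist v u)"
          using lipschitz_onD[OF lip, of "x + t *\<^sub>R u" "x + t *\<^sub>R v"] t(1)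
          by (simp add: dist_norm scaleR_diff_right[symmetric] norm_minus_commute)
        also have "\<dots> \<le> L * (t * r)"
          using v(2) t(1) L0 by (intro mult_left_mono) auto
        finally show ?thesis .
      qed
      have e2: "\<bar>f (x + t *\<^sub>R v) - f x - t * D v\<bar> \<le> t * r"
      proof -
        have "\<bar>(f (x + t *\<^sub>R v) - f x) / t - D v\<bar> < r"
          using d(2)[OF t v(1)] by (simp add: dist_real_def)
        then have "t * \<bar>(f (x + t *\<^sub>R v) - f x) / t - D v\<bar> \<le> t * r"
          using t(1) by (intro mult_left_mono) auto
        moreover have "t * \<bar>(f (x + t *\<^sub>R v) - f x) / t - D v\<bar> = \<bar>t * ((f (x + t *\<^sub>R v) - f x) / t - D v)\<bar>"
          using t(1) by (simp add: abs_mult)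
        moreover have "t * ((f (x + t *\<^sub>R v) - f x) / t - D v) = f (x + t *\<^sub>R v) - f x - t * D v"
          using t(1) by (simp add: field_simps)
        ultimately show ?thesis by simp
      qed
      have e3: "\<bar>t * D v - t * D u\<bar> \<le> t * (r * C)"
      proof -
        have "\<bar>D v - D u\<bar> \<le> dist v u * C"
          using C(2)[of "v - u"] by (simp add: D.diff dist_norm)
        also have "\<dots> \<le> r * C"
          using v(2) C(1) by (intro mult_right_mono) auto
        finally have "t * \<bar>D v - D u\<bar> \<le> t * (r * C)"
          using t(1) by (intro mult_left_mono) auto
        then show ?thesis
          using t(1) by (simp add: abs_mult right_diff_distrib[symmetric])
      qed
      have "\<bar>f y - f x - D (y - x)\<bar> \<le> L * (t * r) + t * r + t * (r * C)"
        using e1 e2 e3 u(2) by (simp add: D.scaleR)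
      also have "\<dots> = (L + C + 1) * r * t" by (simp add: algebra_simps)
      also have "\<dots> = e * t" using L0 C(1) by (simp add: r_def)
      finally show ?thesis by (simp add: t_def)
    qed
    with d(1) show "\<exists>d>0. \<forall>y. norm (y - x) < d \<longrightarrow> norm (f y - f x - D (y - x)) \<le> e * norm (y - x)"
      by blast
  qed
qed

text \<open>Rays are one-sided, so negative factors are not covered by rescaling. There the
  derivatives along \<open>c *\<^sub>R v\<close> and its negative add up to the derivative along
  \<open>0\<close>, by additivity.\<close>

lemma AE_has_ray_derivative_scale:
  fixes f :: "'a::euclidean_space \<Rightarrow> real"
  assumes lip: "L-lipschitz_on UNIV f"
  shows "AE x in lborel. \<forall>a. has_ray_derivative f v x a \<longrightarrow> has_ray_derivative f (c *\<^sub>R v) x (c * a)"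
proof (cases "c \<ge> 0")
  case True
  then show ?thesis
    by (cases "c = 0") (auto simp: has_ray_derivative_zero intro!: AE_I2 has_ray_derivative_scale)
next
  case False
  from AE_has_ray_derivative[OF lip, of "c *\<^sub>R v"]
    AE_has_ray_derivative_add[OF lip, of "c *\<^sub>R v" "(-c) *\<^sub>R v"] show ?thesis
  proof eventually_elim
    case (elim x)
    then obtain l where l: "has_ray_derivative f (c *\<^sub>R v) x l" by blast
    show ?case
    proof (intro allI impI)
      fix a assume "has_ray_derivative f v x a"
      then have "has_ray_derivative f ((-c) *\<^sub>R v) x (-c * a)"
        using False by (intro has_ray_derivative_scale) auto
      with l elim(2) have "has_ray_derivative f (c *\<^sub>R v + (-c) *\<^sub>R v) x (l + - c * a)"
        by blast
      then have "has_ray_derivative f 0 x (l + - c * a)"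
        by simp
      then have "l + - c * a = 0"
        by (rule has_ray_derivative_unique[OF _ has_ray_derivative_zero])
      with l show "has_ray_derivative f (c *\<^sub>R v) x (c * a)"
        by simp
    qed
  qed
qed

text \<open>For each fixed \<open>v\<close>, additivity and scaling express the ray derivative
  through those along the basis vectors, off a null set depending on \<open>v\<close>. Restricting
  \<open>v\<close> to a countable dense set leaves one null set.\<close>

theorem Rademacher_real:
  fixes f :: "'a::euclidean_space \<Rightarrow> real"
  assumes lip: "L-lipschitz_on UNIV f"
  shows "AE x in lborel. f differentiable at x"
proof -
  define D where "D v x = (SOME l. has_ray_derivative f v x l)" for v x
  have D: "AE x in lborel. has_ray_derivative f v x (D v x)" for v
    using AE_has_ray_derivative[OF lip, of v] by eventually_elim (auto simp: D_def intro: someI_ex)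
  have lin: "AE x in lborel. has_ray_derivative f (\<Sum>i\<in>I. (v \<bullet> i) *\<^sub>R i) x (\<Sum>i\<in>I. (v \<bullet> i) * D i x)"
    if "finite I" for v and I :: "'a set"
    using that
  proof (induction I)
    case empty
    then show ?case by (simp add: has_ray_derivative_zero)
  next
    case (insert i I)
    from insert.IH D[of i] AE_has_ray_derivative_scale[OF lip, of i "v \<bullet> i"]
      AE_has_ray_derivative_add[OF lip, of "(v \<bullet> i) *\<^sub>R i" "\<Sum>i\<in>I. (v \<bullet> i) *\<^sub>R i"]
    show ?case
      by eventually_elim (use insert.hyps in simp)
  qed
  obtain V :: "'a set" where V: "countable V" "closure V = UNIV"
  proof -
    obtain V :: "'a set" where V: "countable V" "\<And>X. open X \<Longrightarrow> X \<noteq> {} \<Longrightarrow> \<exists>d\<in>V. d \<in> X"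
      using countable_dense_exists by blast
    have "closure V = UNIV"
    proof (intro equalityI subsetI)
      fix x :: 'a
      show "x \<in> closure V"
        unfolding closure_approachable
      proof (intro allI impI)
        fix e :: real assume "0 < e"
        then have "open (ball x e)" "ball x e \<noteq> {}" by auto
        from V(2)[OF this] show "\<exists>y\<in>V. dist y x < e"
          by (auto simp: dist_commute)
      qed
    qed auto
    with V(1) that show thesis by blast
  qed
  have "AE x in lborel. \<forall>v\<in>V. has_ray_derivative f v x (\<Sum>i\<in>Basis. (v \<bullet> i) * D i x)"
    using lin[OF finite_Basis] V(1) by (simp add: AE_ball_countable euclidean_representation)
  then show ?thesis
  proof eventually_elim
    case (elim x)
    have "bounded_linear (\<lambda>v. \<Sum>i\<in>Basis. (v \<bullet> i) * D i x)"
      by (intro bounded_linear_intros)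
    with elim have "(f has_derivative (\<lambda>v. \<Sum>i\<in>Basis. (v \<bullet> i) * D i x)) (at x)"
      by (intro has_derivative_dense_ray_derivatives[OF lip V(2)]) auto
    then show ?case
      unfolding differentiable_def by blast
  qed
qed

theorem Rademacher:
  fixes f :: "'a::euclidean_space \<Rightarrow> 'b::euclidean_space"
  assumes lip: "L-lipschitz_on UNIV f"
  shows "AE x in lborel. f differentiable at x"
proof -
  have "AE x in lborel. (\<lambda>x. f x \<bullet> i) differentiable at x" if "i \<in> Basis" for i
  proof (rule Rademacher_real)
    show "L-lipschitz_on UNIV (\<lambda>x. f x \<bullet> i)"
    proof (rule lipschitz_onI)
      show "dist (f x \<bullet> i) (f y \<bullet> i) \<le> L * dist x y" for x y
        using Basis_le_norm[OF that, of "f x - f y"] lipschitz_onD[OF lip, of x y]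
        by (simp add: dist_norm inner_diff_left)
    qed (use lip in \<open>rule lipschitz_on_nonneg\<close>)
  qed
  then have "AE x in lborel. \<forall>i\<in>Basis. (\<lambda>x. f x \<bullet> i) differentiable at x"
    by (simp add: AE_ball_countable countable_finite)
  then show ?thesis
    by eventually_elim (subst differentiable_componentwise_within, simp)
qed

section \<open>Semicontinuous functions and their regular envelopes\<close>

lemma usc_on_iff_open:
  "usc_on S u \<longleftrightarrow> (\<forall>x\<in>S. \<forall>c>u x. \<exists>T. open T \<and> x \<in> T \<and> (\<forall>y\<in>S \<inter> T. u y < c))"
proof -
  have "(\<forall>\<^sub>F y in at x within S. u y < c) \<longleftrightarrow> (\<exists>T. open T \<and> x \<in> T \<and> (\<forall>y\<in>S \<inter> T. u y < c))"
    if "u x < c" for x c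
  proof -
    have "(\<forall>y\<in>T. y \<noteq> x \<longrightarrow> y \<in> S \<longrightarrow> u y < c) \<longleftrightarrow> (\<forall>y\<in>S \<inter> T. u y < c)" for T
      using that by auto
    then show ?thesis
      unfolding eventually_at_topological by simp
  qed
  then show ?thesis
    unfolding usc_on_def by simp
qed

text \<open>Without a maximum every \<open>x\<close> has a better point \<open>f x\<close>, and
  \<open>u\<close> stays below \<open>u (f x)\<close> near \<open>x\<close>. The best of the
  finitely many values \<open>u (f j)\<close> of a subcover is then exceeded by another one of
  them.\<close>

lemma usc_on_attains_max:
  assumes "compact S" "S \<noteq> {}" "usc_on S u"
  obtains x where "x \<in> S" "\<And>y. y \<in> S \<Longrightarrow> u y \<le> u x"
proof (rule ccontr)
  assume "\<not> thesis"
  with that have "\<forall>x\<in>S. \<exists>y\<in>S. u x < u y"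
    by (meson not_le)
  then obtain f where f: "\<And>x. x \<in> S \<Longrightarrow> f x \<in> S \<and> u x < u (f x)"
    by metis
  then have "\<forall>x\<in>S. \<exists>T. open T \<and> x \<in> T \<and> (\<forall>y\<in>S \<inter> T. u y < u (f x))"
    using assms(3) unfolding usc_on_iff_open by blast
  then obtain T where T: "\<And>x. x \<in> S \<Longrightarrow> open (T x) \<and> x \<in> T x \<and> (\<forall>y\<in>S \<inter> T x. u y < u (f x))"
    by metis
  then have "S \<subseteq> (\<Union>x\<in>S. T x)" by blast
  then obtain F where F: "F \<subseteq> S" "finite F" "S \<subseteq> (\<Union>x\<in>F. T x)"
    using compactE_image[OF assms(1), of S T] T by blast
  have "F \<noteq> {}" using F assms(2) by auto
  then have "Max ((\<lambda>j. u (f j)) ` F) \<in> (\<lambda>j. u (f j)) ` F"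
    using F(2) by (intro Max_in) auto
  then obtain i where i0: "i \<in> F" "Max ((\<lambda>j. u (f j)) ` F) = u (f i)" by blast
  have i: "i \<in> F" "u (f j) \<le> u (f i)" if "j \<in> F" for j
    using i0 that F(2) Max_ge[of "(\<lambda>j. u (f j)) ` F" "u (f j)"] by auto
  have "f i \<in> S" using f i0 F by blast
  then obtain j where "j \<in> F" "f i \<in> T j" using F by blast
  then have "u (f i) < u (f j)" using T F \<open>f i \<in> S\<close> by blast
  with i(2)[OF \<open>j \<in> F\<close>] show False by simp
qed

lemma usc_on_add:
  assumes "usc_on S u" "usc_on S v"
  shows "usc_on S (\<lambda>x. u x + v x)"
  unfolding usc_on_iff_open
proof (intro ballI allI impI)
  fix x c assume x: "x \<in> S" "u x + v x < c"
  define d where "d = (c - u x - v x) / 2"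
  have "u x < u x + d" "v x < v x + d" using x(2) by (auto simp: d_def)
  then obtain T T' where T: "open T" "x \<in> T" "\<And>y. y \<in> S \<inter> T \<Longrightarrow> u y < u x + d"
     and T': "open T'" "x \<in> T'" "\<And>y. y \<in> S \<inter> T' \<Longrightarrow> v y < v x + d"
    using assms x(1) unfolding usc_on_iff_open by meson
  have "u y + v y < c" if "y \<in> S \<inter> (T \<inter> T')" for y
  proof -
    have "u y < u x + d" "v y < v x + d" using T(3) T'(3) that by blast+
    moreover have "u x + d + (v x + d) = c" by (simp add: d_def field_simps)
    ultimately show ?thesis by linarith
  qed
  then show "\<exists>T. open T \<and> x \<in> T \<and> (\<forall>y\<in>S \<inter> T. u y + v y < c)"
    using T(1,2) T'(1,2) by (intro exI[of _ "T \<inter> T'"]) auto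
qed

lemma usc_on_continuous:
  assumes "continuous_on S f"
  shows "usc_on S f"
  unfolding usc_on_def
proof (intro ballI allI impI)
  fix x c assume x: "x \<in> S" "f x < c"
  from assms x(1) have "(f \<longlongrightarrow> f x) (at x within S)"
    by (simp only: continuous_on_def)
  from order_tendstoD(2)[OF this x(2)] show "\<forall>\<^sub>F y in at x within S. f y < c" .
qed

lemma usc_on_uminus_lsc:
  assumes "lsc_on S v"
  shows "usc_on S (\<lambda>x. - v x)"
  unfolding usc_on_def
proof (intro ballI allI impI)
  fix x c assume x: "x \<in> S" "- v x < c"
  then have "- c < v x" by simp
  from assms[unfolded lsc_on_def, rule_format, OF x(1) this]
  have "\<forall>\<^sub>F y in at x within S. - c < v y" .
  then show "\<forall>\<^sub>F y in at x within S. - v y < c"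
    by eventually_elim simp
qed

lemma usc_on_compose:
  assumes u: "usc_on S u" and g: "continuous_on T g" "g ` T \<subseteq> S"
  shows "usc_on T (\<lambda>x. u (g x))"
  unfolding usc_on_iff_open
proof (intro ballI allI impI)
  fix x c assume x: "x \<in> T" "u (g x) < c"
  then have "g x \<in> S" using g(2) by blast
  with u x(2) obtain W where W: "open W" "g x \<in> W" "\<forall>y\<in>S \<inter> W. u y < c"
    unfolding usc_on_iff_open by meson
  with g(1) x(1) obtain V where "open V" "x \<in> V" "\<forall>y\<in>T. y \<in> V \<longrightarrow> g y \<in> W"
    unfolding continuous_on_topological by meson
  with g(2) W(3) show "\<exists>V. open V \<and> x \<in> V \<and> (\<forall>y\<in>T \<inter> V. u (g y) < c)"
    by (intro exI[of _ V]) auto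
qed

section \<open>Paraboloids, convexity and the regular envelope\<close>

lemma norm_sq_add: "(norm (a + b :: 'a::real_inner))\<^sup>2 = (norm a)\<^sup>2 + 2 * (a \<bullet> b) + (norm b)\<^sup>2"
  by (simp add: power2_norm_eq_inner inner_add inner_commute)

lemma norm_sq_diff: "(norm (a - b :: 'a::real_inner))\<^sup>2 = (norm a)\<^sup>2 - 2 * (a \<bullet> b) + (norm b)\<^sup>2"
  by (simp add: power2_norm_eq_inner inner_diff inner_commute)

text \<open>Completing the square: an affine term only moves the vertex and the height of a
  paraboloid. Minimality of the envelope among paraboloids thus includes tilted ones.\<close>

lemma paraboloid_plus_affine:
  fixes p x z :: "'a::real_inner"
  assumes "k > 0"
  shows "k / 2 * (norm (x - z))\<^sup>2 + p \<bullet> x =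
    k / 2 * (norm (x - (z - (1 / k) *\<^sub>R p)))\<^sup>2 + (p \<bullet> z - (norm p)\<^sup>2 / (2 * k))"
proof -
  have e: "x - (z - (1 / k) *\<^sub>R p) = (x - z) + (1 / k) *\<^sub>R p" by simp
  show ?thesis
    unfolding e norm_sq_add using assms
    by (simp add: power_divide inner_diff_left inner_diff_right inner_commute[of p] field_simps power2_eq_square)
qed

text \<open>The upper bound is used at the opposite point \<open>x - s h\<close>. Convexity turns it
  into a lower bound at \<open>x + h\<close>, with an error \<open>s C |h|^2\<close> that vanishes
  with \<open>s\<close>.\<close>

lemma convex_tangent_of_upper_paraboloid:
  fixes G :: "'a::real_inner \<Rightarrow> real"
  assumes conv: "convex_on UNIV G"
    and upper: "\<And>h. G (x + h) \<le> G x + Q \<bullet> h + C * (norm h)\<^sup>2"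
  shows "G x + Q \<bullet> h \<le> G (x + h)"
proof (rule field_le_epsilon)
  fix e :: real assume "0 < e"
  define s where "s = e / (\<bar>C\<bar> * (norm h)\<^sup>2 + 1)"
  have den: "\<bar>C\<bar> * (norm h)\<^sup>2 + 1 > 0"
    by (smt (verit) mult_nonneg_nonneg abs_ge_zero zero_le_power2)
  have s: "0 < s" using \<open>0 < e\<close> den by (simp add: s_def)
  have "s * (\<bar>C\<bar> * (norm h)\<^sup>2 + 1) = e" using den by (simp add: s_def)
  moreover have "s * (C * (norm h)\<^sup>2) \<le> s * (\<bar>C\<bar> * (norm h)\<^sup>2 + 1)"
    using s mult_right_mono[OF abs_ge_self[of C], of "(norm h)\<^sup>2"] by (intro mult_left_mono) auto
  ultimately have Ce: "s * (C * (norm h)\<^sup>2) \<le> e" by simp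
  \<comment> \<open>The weight that writes \<open>x\<close> as a convex combination of
    \<open>x + h\<close> and \<open>x - s h\<close>.\<close>
  define l where "l = s / (1 + s)"
  have l: "0 \<le> l" "l \<le> 1" "1 - l = 1 / (1 + s)"
    using s by (auto simp: l_def field_simps)
  have xeq: "l *\<^sub>R (x + h) + (1 - l) *\<^sub>R (x + (- s) *\<^sub>R h) = x"
  proof -
    have "l = (1 - l) * s" using l(3) by (simp add: l_def)
    then have "l *\<^sub>R h = ((1 - l) * s) *\<^sub>R h" by simp
    then show ?thesis by (simp add: algebra_simps)
  qed
  have "G ((1 - l) *\<^sub>R (x + (- s) *\<^sub>R h) + l *\<^sub>R (x + h)) \<le> (1 - l) * G (x + (- s) *\<^sub>R h) + l * G (x + h)"
    by (rule convex_onD[OF conv]) (use l in auto)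
  then have "G x \<le> l * G (x + h) + (1 - l) * G (x + (- s) *\<^sub>R h)"
    using xeq by (simp only: add.commute)
  also have "\<dots> \<le> l * G (x + h) + (1 - l) * (G x - s * (Q \<bullet> h) + C * (s\<^sup>2 * (norm h)\<^sup>2))"
    using upper[of "(- s) *\<^sub>R h"] l(1,2) by (intro add_left_mono mult_left_mono) (auto simp: power_mult_distrib)
  finally have "(1 + s) * G x \<le> (1 + s) * (l * G (x + h) + (1 - l) * (G x - s * (Q \<bullet> h) + C * (s\<^sup>2 * (norm h)\<^sup>2)))"
    using s by (intro mult_left_mono) auto
  also have "\<dots> = ((1 + s) * l) * G (x + h) + ((1 + s) * (1 - l)) * (G x - s * (Q \<bullet> h) + C * (s\<^sup>2 * (norm h)\<^sup>2))"
    by (simp add: algebra_simps)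
  also have "\<dots> = s * G (x + h) + (G x - s * (Q \<bullet> h) + C * (s\<^sup>2 * (norm h)\<^sup>2))"
    using s l(3) by (simp add: l_def)
  finally have "s * (G x + Q \<bullet> h) \<le> s * (G (x + h) + s * (C * (norm h)\<^sup>2))"
    by (simp add: algebra_simps power2_eq_square)
  then have "G x + Q \<bullet> h \<le> G (x + h) + s * (C * (norm h)\<^sup>2)"
    using s by simp
  with Ce show "G x + Q \<bullet> h \<le> G (x + h) + e" by simp
qed

lemma convex_on_norm_sq: "convex_on UNIV (\<lambda>x::'a::real_inner. (norm x)\<^sup>2)"
proof (rule convex_onI)
  fix t :: real and x y :: 'a assume t: "0 < t" "t < 1"
  have "(1 - t) * (norm x)\<^sup>2 + t * (norm y)\<^sup>2 - (norm ((1 - t) *\<^sub>R x + t *\<^sub>R y))\<^sup>2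
      = t * (1 - t) * (norm (x - y))\<^sup>2"
    unfolding norm_sq_add norm_sq_diff
    by (simp add: power_mult_distrib) (simp add: algebra_simps power2_eq_square)
  moreover have "0 \<le> t * (1 - t) * (norm (x - y))\<^sup>2" using t by simp
  ultimately show "(norm ((1 - t) *\<^sub>R x + t *\<^sub>R y))\<^sup>2 \<le> (1 - t) * (norm x)\<^sup>2 + t * (norm y)\<^sup>2" by linarith
qed auto

text \<open>
  The envelope \<open>g\<close> is the smallest function above the sup-convolution of \<open>u\<close> that is an infimum of
  paraboloids of opening \<open>k\<close>. Being in turn an infimal convolution
  \<open>INF b. \<alpha> b - k/4 |b|\<^sup>2 + k/2 |x - b|\<^sup>2\<close> with \<open>\<alpha>\<close> convex, it is semiconvex with the same constant.
\<close>

lemma C11_envelope: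
  fixes u :: "'a::euclidean_space \<Rightarrow> real"
  assumes S: "bounded S" "S \<noteq> {}" and bdd: "bdd_above (u ` S)" and k: "k > 0"
  obtains g q where
    "\<And>x y. y \<in> S \<Longrightarrow> u y - k / 2 * (norm (x - y))\<^sup>2 \<le> g x"
    and "\<And>m z p x. (\<And>x y. y \<in> S \<Longrightarrow> u y - k / 2 * (norm (x - y))\<^sup>2 \<le> m + (k / 2 * (norm (x - z))\<^sup>2 + p \<bullet> x)) \<Longrightarrow>
          g x \<le> m + (k / 2 * (norm (x - z))\<^sup>2 + p \<bullet> x)"
    and "\<And>x h. \<bar>g (x + h) - g x - q x \<bullet> h\<bar> \<le> k / 2 * (norm h)\<^sup>2"
proof -
  \<comment> \<open>The sum \<open>k/2 |x - y|^2 + k/2 |x - b|^2\<close> has minimum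
    \<open>k/4 |y - b|^2\<close> over \<open>x\<close>. So the lowest paraboloid with vertex at
    \<open>b\<close> above the sup-convolution has height \<open>SUP y. u y - k/4 |y - b|^2\<close>,
    which is \<open>\<alpha> b - k/4 |b|^2\<close>.\<close>
  define \<alpha> where "\<alpha> b = (SUP y\<in>S. u y - k / 4 * (norm y)\<^sup>2 + k / 2 * (y \<bullet> b))" for b
  obtain B where B: "\<And>y. y \<in> S \<Longrightarrow> norm y \<le> B" using S(1) by (auto simp: bounded_iff)
  obtain M where M: "\<And>y. y \<in> S \<Longrightarrow> u y \<le> M" using bdd by (auto simp: bdd_above_def)
  obtain y0 where y0: "y0 \<in> S" using S(2) by blast
  have bddA: "bdd_above ((\<lambda>y. u y - k / 4 * (norm y)\<^sup>2 + k / 2 * (y \<bullet> b)) ` S)" for b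
  proof (rule bdd_aboveI2)
    fix y assume y: "y \<in> S"
    have "y \<bullet> b \<le> B * norm b"
      using norm_cauchy_schwarz[of y b] mult_right_mono[OF B[OF y], of "norm b"] by simp
    then have "k / 2 * (y \<bullet> b) \<le> k / 2 * (B * norm b)" using k by (intro mult_left_mono) auto
    moreover have "0 \<le> k / 4 * (norm y)\<^sup>2" using k by simp
    ultimately show "u y - k / 4 * (norm y)\<^sup>2 + k / 2 * (y \<bullet> b) \<le> M + k / 2 * (B * norm b)"
      using M[OF y] by linarith
  qed
  have \<alpha>_ge: "u y - k / 4 * (norm y)\<^sup>2 + k / 2 * (y \<bullet> b) \<le> \<alpha> b" if "y \<in> S" for y b
    unfolding \<alpha>_def by (rule cSUP_upper[OF that bddA])
  have \<alpha>_le: "\<alpha> b \<le> c" if "\<And>y. y \<in> S \<Longrightarrow> u y - k / 4 * (norm y)\<^sup>2 + k / 2 * (y \<bullet> b) \<le> c" for b c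
    unfolding \<alpha>_def by (rule cSUP_least[OF S(2) that])
  have \<alpha>_conv: "convex_on UNIV \<alpha>"
  proof (rule convex_onI)
    fix t :: real and b c :: 'a assume t: "0 < t" "t < 1"
    show "\<alpha> ((1 - t) *\<^sub>R b + t *\<^sub>R c) \<le> (1 - t) * \<alpha> b + t * \<alpha> c"
    proof (rule \<alpha>_le)
      fix y assume y: "y \<in> S"
      have "u y - k / 4 * (norm y)\<^sup>2 + k / 2 * (y \<bullet> ((1 - t) *\<^sub>R b + t *\<^sub>R c)) =
        (1 - t) * (u y - k / 4 * (norm y)\<^sup>2 + k / 2 * (y \<bullet> b)) + t * (u y - k / 4 * (norm y)\<^sup>2 + k / 2 * (y \<bullet> c))"
        unfolding inner_add_right inner_scaleR_right by (simp add: field_simps)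
      also have "\<dots> \<le> (1 - t) * \<alpha> b + t * \<alpha> c"
        using t \<alpha>_ge[OF y] by (intro add_mono mult_left_mono) auto
      finally show "u y - k / 4 * (norm y)\<^sup>2 + k / 2 * (y \<bullet> ((1 - t) *\<^sub>R b + t *\<^sub>R c)) \<le> (1 - t) * \<alpha> b + t * \<alpha> c" .
    qed
  qed auto
  have \<alpha>_cont: "continuous_on UNIV \<alpha>"
    using \<alpha>_conv by (intro convex_on_continuous) auto
  define \<beta> where "\<beta> x b = \<alpha> b - k / 4 * (norm b)\<^sup>2 + k / 2 * (norm (x - b))\<^sup>2" for x b
  have ex: "\<exists>b. \<forall>c. \<beta> x b \<le> \<beta> x c" for x
  proof -
    define W where "W = k * norm x + k / 2 * norm y0"
    define L where "L = u y0 - k / 4 * (norm y0)\<^sup>2"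
    have low: "k / 4 * (norm b)\<^sup>2 - W * norm b + L \<le> \<beta> x b" for b
    proof -
      have "x \<bullet> b \<le> norm x * norm b" "- (y0 \<bullet> b) \<le> norm y0 * norm b"
        using norm_cauchy_schwarz[of x b] norm_cauchy_schwarz[of "- y0" b] by auto
      then have "k * (x \<bullet> b) \<le> k * (norm x * norm b)" and "k / 2 * (- (y0 \<bullet> b)) \<le> k / 2 * (norm y0 * norm b)"
        by - (rule mult_left_mono; use k in simp)+
      moreover have "0 \<le> k / 2 * (norm x)\<^sup>2" using k by simp
      ultimately show ?thesis
        using \<alpha>_ge[OF y0, of b] unfolding \<beta>_def norm_sq_diff W_def L_def by (simp add: algebra_simps)
    qed
    \<comment> \<open>Outside this ball the quadratic lower bound, which comes from the single point
      \<open>y0\<close>, exceeds the value at the vertex \<open>0\<close>. A radius of at least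
      \<open>1\<close> permits multiplication by \<open>norm c\<close>.\<close>
    define R where "R = max 1 (4 / k * (W + \<bar>\<beta> x 0 - L\<bar>))"
    have R1: "1 \<le> R" by (simp add: R_def)
    have "continuous_on (cball 0 R) (\<beta> x)"
      unfolding \<beta>_def by (intro continuous_intros continuous_on_subset[OF \<alpha>_cont]) auto
    then obtain b where b: "b \<in> cball 0 R" "\<And>c. c \<in> cball 0 R \<Longrightarrow> \<beta> x b \<le> \<beta> x c"
      using continuous_attains_inf[of "cball 0 R" "\<beta> x"] R1 by auto
    have "\<beta> x b \<le> \<beta> x c" for c
    proof (cases "c \<in> cball 0 R")
      case False
      then have c: "norm c > R" by simp
      then have "4 / k * (W + \<bar>\<beta> x 0 - L\<bar>) < norm c" by (simp add: R_def)
      then have "W + \<bar>\<beta> x 0 - L\<bar> < k / 4 * norm c"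
        using k by (simp add: field_simps)
      then have "\<bar>\<beta> x 0 - L\<bar> < k / 4 * norm c - W" by simp
      then have "\<bar>\<beta> x 0 - L\<bar> * 1 \<le> (k / 4 * norm c - W) * norm c"
        using c R1 by (intro mult_mono) auto
      then have "\<beta> x 0 \<le> \<beta> x c"
        using low[of c] abs_ge_self[of "\<beta> x 0 - L"] by (simp add: algebra_simps power2_eq_square)
      moreover have "\<beta> x b \<le> \<beta> x 0" using R1 by (intro b(2)) auto
      ultimately show ?thesis by simp
    qed (use b in auto)
    then show ?thesis by blast
  qed
  define bm where "bm x = (SOME b. \<forall>c. \<beta> x b \<le> \<beta> x c)" for x
  have bm: "\<beta> x (bm x) \<le> \<beta> x c" for x c
    unfolding bm_def using someI_ex[OF ex[of x]] by blast
  define g where "g x = \<beta> x (bm x)" for x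
  \<comment> \<open>The gradient at \<open>x\<close> of the paraboloid that attains the infimum
    there. This paraboloid bounds \<open>g\<close> from above everywhere and touches it at
    \<open>x\<close>.\<close>
  define q where "q x = k *\<^sub>R (x - bm x)" for x
  have gle: "g x \<le> \<beta> x b" for x b
    unfolding g_def by (rule bm)
  have upper: "g (x + h) \<le> g x + q x \<bullet> h + k / 2 * (norm h)\<^sup>2" for x h
  proof -
    have "g (x + h) \<le> \<beta> (x + h) (bm x)" by (rule gle)
    also have "\<dots> = g x + q x \<bullet> h + k / 2 * (norm h)\<^sup>2"
    proof -
      have "x + h - bm x = (x - bm x) + h" by simp
      then have "(norm (x + h - bm x))\<^sup>2 = (norm (x - bm x))\<^sup>2 + 2 * ((x - bm x) \<bullet> h) + (norm h)\<^sup>2"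
        by (simp only: norm_sq_add)
      then show ?thesis
        by (simp add: g_def \<beta>_def q_def distrib_left)
    qed
    finally show ?thesis .
  qed
  define G where "G x = g x + k / 2 * (norm x)\<^sup>2" for x
  \<comment> \<open>After adding \<open>k/2 |x|^2\<close> the function is jointly convex in
    \<open>x\<close> and \<open>b\<close>, and partial minimisation in \<open>b\<close> preserves
    convexity.\<close>
  have \<beta>_eq: "\<beta> x b + k / 2 * (norm x)\<^sup>2 = \<alpha> b + k * (norm (x - (1/2) *\<^sub>R b))\<^sup>2" for x b
    unfolding \<beta>_def norm_sq_diff by (simp add: power_divide algebra_simps)
  have G_conv: "convex_on UNIV G"
  proof (rule convex_onI)
    fix t :: real and x y :: 'a assume t: "0 < t" "t < 1"
    define z where "z = (1 - t) *\<^sub>R x + t *\<^sub>R y"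
    define b where "b = (1 - t) *\<^sub>R bm x + t *\<^sub>R bm y"
    have zb: "z - (1/2) *\<^sub>R b = (1 - t) *\<^sub>R (x - (1/2) *\<^sub>R bm x) + t *\<^sub>R (y - (1/2) *\<^sub>R bm y)"
      by (simp add: z_def b_def scaleR_diff_right scaleR_add_right mult.commute)
    have "G z \<le> \<alpha> b + k * (norm (z - (1/2) *\<^sub>R b))\<^sup>2"
      using gle[of z b] \<beta>_eq[of z b] by (simp add: G_def)
    also have "\<dots> \<le> ((1 - t) * \<alpha> (bm x) + t * \<alpha> (bm y)) +
       k * ((1 - t) * (norm (x - (1/2) *\<^sub>R bm x))\<^sup>2 + t * (norm (y - (1/2) *\<^sub>R bm y))\<^sup>2)"
    proof (intro add_mono mult_left_mono)
      show "\<alpha> b \<le> (1 - t) * \<alpha> (bm x) + t * \<alpha> (bm y)"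
        unfolding b_def using t by (intro convex_onD[OF \<alpha>_conv]) auto
      show "(norm (z - (1/2) *\<^sub>R b))\<^sup>2 \<le> (1 - t) * (norm (x - (1/2) *\<^sub>R bm x))\<^sup>2 + t * (norm (y - (1/2) *\<^sub>R bm y))\<^sup>2"
        unfolding zb using t by (intro convex_onD[OF convex_on_norm_sq]) auto
    qed (use k in auto)
    also have "\<dots> = (1 - t) * (\<alpha> (bm x) + k * (norm (x - (1/2) *\<^sub>R bm x))\<^sup>2) + t * (\<alpha> (bm y) + k * (norm (y - (1/2) *\<^sub>R bm y))\<^sup>2)"
      by (simp add: algebra_simps)
    also have "\<dots> = (1 - t) * G x + t * G y"
      unfolding \<beta>_eq[symmetric] G_def g_def ..
    finally show "G ((1 - t) *\<^sub>R x + t *\<^sub>R y) \<le> (1 - t) * G x + t * G y" by (simp add: z_def)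
  qed auto
  have lower: "g x + q x \<bullet> h - k / 2 * (norm h)\<^sup>2 \<le> g (x + h)" for x h
  proof -
    have "G (x + h) \<le> G x + (q x + k *\<^sub>R x) \<bullet> h + k * (norm h)\<^sup>2" for h
      using upper[of x h] unfolding G_def norm_sq_add by (simp add: inner_add_left algebra_simps)
    from convex_tangent_of_upper_paraboloid[OF G_conv this, of h] show ?thesis
      unfolding G_def norm_sq_add by (simp add: inner_add_left algebra_simps)
  qed
  show thesis
  proof (rule that[of g q])
    show "u y - k / 2 * (norm (x - y))\<^sup>2 \<le> g x" if "y \<in> S" for x y
    proof -
      have "0 \<le> k * (norm ((x - (1/2) *\<^sub>R bm x) - (1/2) *\<^sub>R y))\<^sup>2" using k by simp
      then have "u y - k / 2 * (norm (x - y))\<^sup>2 + k / 2 * (norm x)\<^sup>2 \<le> \<alpha> (bm x) + k * (norm (x - (1/2) *\<^sub>R bm x))\<^sup>2"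
        using \<alpha>_ge[OF that, of "bm x"] unfolding norm_sq_diff
        by (simp add: power_divide inner_diff_left inner_commute algebra_simps)
      then show ?thesis
        unfolding \<beta>_eq[symmetric] g_def by simp
    qed
    have least: "g x \<le> m + k / 2 * (norm (x - b))\<^sup>2"
      if *: "\<And>x y. y \<in> S \<Longrightarrow> u y - k / 2 * (norm (x - y))\<^sup>2 \<le> m + k / 2 * (norm (x - b))\<^sup>2" for m b x
    proof -
      have "\<alpha> b \<le> m + k / 4 * (norm b)\<^sup>2"
      proof (rule \<alpha>_le)
        fix y assume "y \<in> S"
        have mid: "(1/2) *\<^sub>R (c + d) - c = (1/2) *\<^sub>R (d - c)" for c d :: 'a
        proof -
          have "(1/2) *\<^sub>R (c + d) - (1/2) *\<^sub>R (c + c) = (1/2) *\<^sub>R (d - c)"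
            unfolding scaleR_diff_right[symmetric] by simp
          then show ?thesis by (simp only: scaleR_half_double)
        qed
        \<comment> \<open>The midpoint is where the two paraboloids are closest, so the hypothesis
          there is as strong as at all points together.\<close>
        from *[OF \<open>y \<in> S\<close>, of "(1/2) *\<^sub>R (y + b)"]
        have "u y - k / 2 * (norm ((1/2) *\<^sub>R (b - y)))\<^sup>2 \<le> m + k / 2 * (norm ((1/2) *\<^sub>R (y - b)))\<^sup>2"
          using mid[of y b] mid[of b y] by (simp only: add.commute[of b y])
        then show "u y - k / 4 * (norm y)\<^sup>2 + k / 2 * (y \<bullet> b) \<le> m + k / 4 * (norm b)\<^sup>2"
          by (simp add: power_divide norm_sq_diff inner_commute algebra_simps)
      qed
      with gle[of x b] show ?thesis by (simp add: \<beta>_def)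
    qed
    show "g x \<le> m + (k / 2 * (norm (x - z))\<^sup>2 + p \<bullet> x)"
      if "\<And>x y. y \<in> S \<Longrightarrow> u y - k / 2 * (norm (x - y))\<^sup>2 \<le> m + (k / 2 * (norm (x - z))\<^sup>2 + p \<bullet> x)" for m z p x
      using least[of "m + (p \<bullet> z - (norm p)\<^sup>2 / (2 * k))" "z - (1 / k) *\<^sub>R p" x] that
      unfolding paraboloid_plus_affine[OF k] by (simp add: algebra_simps)
    show "\<bar>g (x + h) - g x - q x \<bullet> h\<bar> \<le> k / 2 * (norm h)\<^sup>2" for x h
      using upper[of x h] lower[of x h] by linarith
  qed
qed

section \<open>Second order expansions of functions with Lipschitz gradient\<close>

lemma zero_of_inner_le_norm_sq:
  fixes w :: "'a::real_inner"
  assumes "\<And>h. w \<bullet> h \<le> C * (norm h)\<^sup>2"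
  shows "w = 0"
proof (rule ccontr)
  assume "w \<noteq> 0"
  define s where "s = 1 / (2 * (\<bar>C\<bar> + 1))"
  have s: "s > 0" "s * C < 1" by (auto simp: s_def field_simps)
  have n: "(norm w)\<^sup>2 > 0" using \<open>w \<noteq> 0\<close> by simp
  have "s * (norm w)\<^sup>2 \<le> C * (s\<^sup>2 * (norm w)\<^sup>2)"
    using assms[of "s *\<^sub>R w"] by (simp add: power2_norm_eq_inner[symmetric] power_mult_distrib)
  also have "\<dots> = (s * C) * (s * (norm w)\<^sup>2)" by (simp add: power2_eq_square)
  also have "\<dots> < 1 * (s * (norm w)\<^sup>2)"
    using s n by (intro mult_strict_right_mono) auto
  finally show False by simp
qed

text \<open>Replacing \<open>h\<close> by \<open>sqrt t\<close> times \<open>h\<close> and dividing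
  by \<open>t\<close> leaves the quartic term with a factor \<open>t\<close>, which is then sent to
  zero. Letting the quartic absorb distant points keeps the expansions global in
  \<open>h\<close>.\<close>

lemma quadratic_nonpos_of_small:
  assumes hom: "\<And>t h. c (t *\<^sub>R h) = t\<^sup>2 * c h"
    and small: "\<And>e. e > 0 \<Longrightarrow> \<exists>K. \<forall>h. c h \<le> e * (norm h)\<^sup>2 + K * norm h ^ 4"
  shows "c (h :: 'a::real_normed_vector) \<le> (0::real)"
proof (rule ccontr)
  assume "\<not> c h \<le> 0"
  then have c: "c h > 0" by simp
  define m where "m = (norm h)\<^sup>2 + 1"
  define e where "e = c h / (2 * m)"
  have m: "m > 0" by (simp add: m_def add_nonneg_pos)
  have e: "e > 0" using c m by (simp add: e_def)
  have "e * m = c h / 2" using m by (simp add: e_def)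
  then have e2: "e * (norm h)\<^sup>2 \<le> c h / 2" using e by (simp add: m_def algebra_simps)
  obtain K where K: "\<And>h. c h \<le> e * (norm h)\<^sup>2 + K * norm h ^ 4" using small[OF e] by blast
  define D where "D = \<bar>K\<bar> * norm h ^ 4"
  have D: "D \<ge> 0" by (simp add: D_def)
  have "c h / 2 \<le> t * D" if "t > 0" for t
  proof -
    define s where "s = sqrt t"
    have s: "s\<^sup>2 = t" "s > 0" using that by (auto simp: s_def)
    have s4: "s ^ 4 = s\<^sup>2 * s\<^sup>2" by (simp add: power_add[symmetric])
    have "s\<^sup>2 * c h \<le> e * (s\<^sup>2 * (norm h)\<^sup>2) + K * (s\<^sup>2 * s\<^sup>2 * norm h ^ 4)"
      using K[of "s *\<^sub>R h"] s by (simp add: hom power_mult_distrib s4)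
    also have "\<dots> = s\<^sup>2 * (e * (norm h)\<^sup>2 + s\<^sup>2 * (K * norm h ^ 4))" by (simp add: algebra_simps)
    finally have "c h \<le> e * (norm h)\<^sup>2 + t * (K * norm h ^ 4)" using s that by simp
    moreover have "t * (K * norm h ^ 4) \<le> t * D"
      unfolding D_def using that by (intro mult_left_mono mult_right_mono) auto
    ultimately show ?thesis using e2 by linarith
  qed
  from this[of "c h / (4 * (D + 1))"] c D have "c h / 2 \<le> c h / (4 * (D + 1)) * D" by simp
  also have "\<dots> \<le> c h / 4" using c D by (simp add: field_simps)
  finally show False using c by simp
qed

text \<open>The value at \<open>y + h\<close> is expanded both from \<open>y\<close> and from
  \<open>x\<close>, with \<open>h\<close> along \<open>q y - q x\<close> and of length
  \<open>|y - x|\<close>. The errors are \<open>4 C\<close> for the vector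
  \<open>(y - x) + h\<close> and \<open>C\<close> for each of \<open>h\<close> and
  \<open>y - x\<close>, hence the factor \<open>6\<close>.\<close>

lemma C11_gradient_lipschitz:
  fixes q :: "'a::euclidean_space \<Rightarrow> 'a"
  assumes g: "\<And>x h. \<bar>g (x + h) - g x - q x \<bullet> h\<bar> \<le> C * (norm h)\<^sup>2"
  shows "(6 * C)-lipschitz_on UNIV q"
proof (rule lipschitz_onI)
  obtain b :: 'a where "b \<in> Basis" using nonempty_Basis by blast
  then have "norm b = 1" by simp
  with g[of 0 b] show C: "0 \<le> 6 * C" by simp
  fix x y
  show "dist (q x) (q y) \<le> 6 * C * dist x y"
  proof (cases "q x = q y \<or> x = y")
    case True then show ?thesis using C by auto
  next
    case False
    define d where "d = norm (y - x)"
    define w where "w = q y - q x"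
    define h where "h = (d / norm w) *\<^sub>R w"
    have d: "d > 0" "norm w > 0" using False by (auto simp: d_def w_def)
    have nh: "norm h = d" using d by (simp add: h_def)
    have wh: "w \<bullet> h = d * norm w" using d by (simp add: h_def power2_norm_eq_inner[symmetric] power2_eq_square)
    have "w \<bullet> h \<le> C * (norm ((y - x) + h))\<^sup>2 + C * (norm h)\<^sup>2 + C * (norm (y - x))\<^sup>2"
      using g[of y h] g[of x "(y - x) + h"] g[of x "y - x"]
      by (simp add: w_def inner_diff_left inner_add_right add.assoc[symmetric])
    also have "\<dots> \<le> C * (d + d)\<^sup>2 + C * d\<^sup>2 + C * d\<^sup>2"
      unfolding nh d_def[symmetric] using C norm_triangle_ineq[of "y - x" h] nh d
      by (intro add_mono mult_left_mono power_mono) (auto simp: d_def)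
    also have "\<dots> = 6 * C * d * d" by (simp add: power2_eq_square algebra_simps)
    finally have "norm w * d \<le> (6 * C * d) * d" unfolding wh by (simp add: mult.commute)
    then have "norm w \<le> 6 * C * d" using d by simp
    then show ?thesis by (simp add: w_def d_def dist_norm norm_minus_commute)
  qed
qed

lemma C11_has_derivative:
  fixes q :: "'a::euclidean_space \<Rightarrow> 'a"
  assumes g: "\<And>x h. \<bar>g (x + h) - g x - q x \<bullet> h\<bar> \<le> C * (norm h)\<^sup>2"
  shows "(g has_derivative (\<lambda>h. q x \<bullet> h)) (at x)"
  unfolding has_derivative_at_alt
proof (intro conjI allI impI)
  show "bounded_linear (\<lambda>h. q x \<bullet> h)" by (rule bounded_linear_inner_right)
  fix e :: real assume e: "0 < e"
  define d where "d = e / (\<bar>C\<bar> + 1)"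
  have d: "d > 0" using e by (simp add: d_def)
  have "norm (g y - g x - q x \<bullet> (y - x)) \<le> e * norm (y - x)" if y: "norm (y - x) < d" for y
  proof -
    have "\<bar>g y - g x - q x \<bullet> (y - x)\<bar> \<le> C * (norm (y - x))\<^sup>2"
      using g[of x "y - x"] by simp
    also have "\<dots> \<le> (\<bar>C\<bar> + 1) * (norm (y - x) * norm (y - x))"
      unfolding power2_eq_square by (intro mult_right_mono) auto
    also have "\<dots> \<le> (\<bar>C\<bar> + 1) * (d * norm (y - x))"
      using y by (intro mult_left_mono mult_right_mono) auto
    also have "\<dots> = e * norm (y - x)" by (simp add: d_def)
    finally show ?thesis by simp
  qed
  then show "\<exists>d>0. \<forall>y. norm (y - x) < d \<longrightarrow> norm (g y - g x - q x \<bullet> (y - x)) \<le> e * norm (y - x)"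
    using d by blast
qed

text \<open>Differentiability of \<open>q\<close> at the single point \<open>x\<close> suffices:
  near \<open>x\<close> the mean value theorem is applied along a segment, and for
  \<open>norm h \<ge> d\<close> the quadratic bounds are absorbed into the quartic term through
  division by \<open>d\<^sup>2\<close>.\<close>

lemma C11_second_order_Taylor:
  fixes q :: "'a::euclidean_space \<Rightarrow> 'a"
  assumes g: "\<And>x h. \<bar>g (x + h) - g x - q x \<bullet> h\<bar> \<le> C * (norm h)\<^sup>2"
    and A: "(q has_derivative A) (at x)" and e: "e > 0"
  shows "\<exists>K\<ge>0. \<forall>h. \<bar>g (x + h) - g x - q x \<bullet> h - (h \<bullet> A h) / 2\<bar> \<le> e * (norm h)\<^sup>2 + K * norm h ^ 4"
proof -
  have linA: "bounded_linear A" using A by (rule has_derivative_bounded_linear)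
  interpret A: bounded_linear A by fact
  obtain B where B: "B > 0" "\<And>h. norm (A h) \<le> norm h * B" using A.pos_bounded by blast
  obtain d where d: "d > 0" "\<And>y. norm (y - x) < d \<Longrightarrow> norm (q y - q x - A (y - x)) \<le> e * norm (y - x)"
    using A e unfolding has_derivative_at_alt by blast
  have near: "\<bar>g (x + h) - g x - q x \<bullet> h - (h \<bullet> A h) / 2\<bar> \<le> e * (norm h)\<^sup>2" if h: "norm h < d" for h
  proof -
    define \<phi> where "\<phi> t = g (x + t *\<^sub>R h) - t * (q x \<bullet> h) - t\<^sup>2 * ((h \<bullet> A h) / 2)" for t
    have der: "(\<phi> has_real_derivative (q (x + t *\<^sub>R h) \<bullet> h - q x \<bullet> h - t * (h \<bullet> A h))) (at t)" for t
    proof -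
      have "((\<lambda>t. g (x + t *\<^sub>R h)) has_derivative (\<lambda>s. q (x + t *\<^sub>R h) \<bullet> (s *\<^sub>R h))) (at t)"
        by (rule has_derivative_compose[OF _ C11_has_derivative[of g q C, OF g]]) (auto intro!: derivative_eq_intros)
      then have "((\<lambda>t. g (x + t *\<^sub>R h)) has_real_derivative (q (x + t *\<^sub>R h) \<bullet> h)) (at t)"
        by (simp add: has_field_derivative_def mult.commute[of _ "q (x + t *\<^sub>R h) \<bullet> h"])
      then show ?thesis
        unfolding \<phi>_def by (auto intro!: derivative_eq_intros)
    qed
    obtain t where t: "0 < t" "t < 1" "\<phi> 1 - \<phi> 0 = (1 - 0) * (q (x + t *\<^sub>R h) \<bullet> h - q x \<bullet> h - t * (h \<bullet> A h))"
      using MVT2[of 0 1 \<phi>, OF _ der] by auto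
    have "\<phi> 1 - \<phi> 0 = (q (x + t *\<^sub>R h) - q x - A (t *\<^sub>R h)) \<bullet> h"
      using t(3) by (simp add: A.scaleR inner_diff_left inner_commute[of h "A h"])
    also have "\<bar>\<dots>\<bar> \<le> norm (q (x + t *\<^sub>R h) - q x - A (t *\<^sub>R h)) * norm h"
      by (rule Cauchy_Schwarz_ineq2)
    also have "\<dots> \<le> (e * norm (t *\<^sub>R h)) * norm h"
    proof (rule mult_right_mono)
      have "norm (t *\<^sub>R h) < d"
        using t h by (simp) (smt (verit) mult_left_le_one_le norm_ge_zero)
      then show "norm (q (x + t *\<^sub>R h) - q x - A (t *\<^sub>R h)) \<le> e * norm (t *\<^sub>R h)"
        using d(2)[of "x + t *\<^sub>R h"] by simp
    qed auto
    also have "\<dots> = t * (e * (norm h)\<^sup>2)" using t by (simp add: power2_eq_square)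
    also have "\<dots> \<le> 1 * (e * (norm h)\<^sup>2)" using t e by (intro mult_right_mono) auto
    finally show ?thesis by (simp add: \<phi>_def)
  qed
  define K where "K = (\<bar>C\<bar> + B / 2) / d\<^sup>2"
  have K: "K \<ge> 0" using B d by (simp add: K_def)
  have "\<bar>g (x + h) - g x - q x \<bullet> h - (h \<bullet> A h) / 2\<bar> \<le> e * (norm h)\<^sup>2 + K * norm h ^ 4" for h
  proof (cases "norm h < d")
    case True
    have "0 \<le> K * norm h ^ 4" using K by simp
    with near[OF True] show ?thesis by linarith
  next
    case False
    have "\<bar>h \<bullet> A h\<bar> \<le> norm h * (norm h * B)"
      using Cauchy_Schwarz_ineq2[of h "A h"] mult_left_mono[OF B(2)[of h], of "norm h"] by simp
    then have "\<bar>g (x + h) - g x - q x \<bullet> h - (h \<bullet> A h) / 2\<bar> \<le> C * (norm h)\<^sup>2 + (norm h)\<^sup>2 * B / 2"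
      using g[of x h] by (simp add: power2_eq_square mult.assoc)
    also have "\<dots> \<le> (\<bar>C\<bar> + B / 2) * (norm h)\<^sup>2"
      using mult_right_mono[OF abs_ge_self[of C], of "(norm h)\<^sup>2"] by (simp add: algebra_simps)
    also have "\<dots> = K * (d\<^sup>2 * (norm h)\<^sup>2)" using d by (simp add: K_def)
    also have "\<dots> \<le> K * ((norm h)\<^sup>2 * (norm h)\<^sup>2)"
      using False d K by (intro mult_left_mono mult_right_mono power_mono) auto
    also have "\<dots> = K * norm h ^ 4" by (simp add: power_add[symmetric])
    finally have "\<bar>g (x + h) - g x - q x \<bullet> h - (h \<bullet> A h) / 2\<bar> \<le> K * norm h ^ 4" .
    moreover have "0 \<le> e * (norm h)\<^sup>2" using e by simp
    ultimately show ?thesis by linarith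
  qed
  with K show ?thesis by blast
qed

section \<open>Contact points of two envelopes\<close>

text \<open>Completing the square in \<open>x\<close>: the best \<open>x\<close> is the midpoint of
  \<open>y\<close> and \<open>z\<close>, corrected by the slope. This removes the unbounded variable
  and leaves a maximum problem on the compact set of pairs.\<close>

lemma two_paraboloids_plus_affine:
  fixes p x y z :: "'a::real_inner"
  assumes "k > 0"
  shows "k / 2 * (norm (x - y))\<^sup>2 + k / 2 * (norm (x - z))\<^sup>2 + p \<bullet> x =
    k * (norm (x - ((1/2) *\<^sub>R (y + z) - (1 / (2 * k)) *\<^sub>R p)))\<^sup>2 +
    (k / 4 * (norm (y - z))\<^sup>2 + p \<bullet> (y + z) / 2 - (norm p)\<^sup>2 / (4 * k))"
proof -
  define m where "m = (1/2) *\<^sub>R (y + z)"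
  define d where "d = (1/2) *\<^sub>R (y - z)"
  have y: "y = m + d" and z: "z = m - d"
    by (simp_all add: m_def d_def scaleR_add_right scaleR_diff_right scaleR_half_double[symmetric] flip: scaleR_add_right scaleR_diff_right)
  have e: "x - (m - (1 / (2 * k)) *\<^sub>R p) = (x - m) + (1 / (2 * k)) *\<^sub>R p" "x - (m + d) = (x - m) - d"
    "x - (m - d) = (x - m) + d" "(m + d) - (m - d) = 2 *\<^sub>R d" "(m + d) + (m - d) = 2 *\<^sub>R m"
    by (simp_all add: scaleR_2)
  show ?thesis
    unfolding m_def[symmetric] unfolding y z e unfolding norm_sq_add norm_sq_diff using assms
    by (simp add: power_divide power_mult_distrib inner_diff_left inner_diff_right inner_commute[of p] field_simps power2_eq_square)
qed

lemma envelope_gradient_at_contact: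
  assumes C: "\<And>h. \<bar>g (x + h) - g x - q \<bullet> h\<bar> \<le> k / 2 * (norm h)\<^sup>2"
    and lo: "\<And>x. c - k / 2 * (norm (x - y))\<^sup>2 \<le> g x" and touch: "g x = c - k / 2 * (norm (x - y))\<^sup>2"
  shows "q = k *\<^sub>R (y - x :: 'a::real_inner)"
proof -
  have "(q - k *\<^sub>R (y - x)) \<bullet> (-h) \<le> k * (norm (-h))\<^sup>2" for h
  proof -
    have e: "x + h - y = (x - y) + h" by simp
    have "g x - k * ((x - y) \<bullet> h) - k / 2 * (norm h)\<^sup>2 \<le> g (x + h)"
      using lo[of "x + h"] unfolding e norm_sq_add touch by (simp add: algebra_simps)
    moreover have "g (x + h) - g x - q \<bullet> h \<le> k / 2 * (norm h)\<^sup>2"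
      using C[of h] by (simp only: abs_le_iff)
    ultimately show ?thesis
      by (simp add: inner_diff_left algebra_simps)
  qed
  from this[of "- h" for h] have "q - k *\<^sub>R (y - x) = 0"
    by (intro zero_of_inner_le_norm_sq[of _ k]) simp
  then show ?thesis by simp
qed

lemma bounded_linear_form_scale:
  "bounded_linear A \<Longrightarrow> (t *\<^sub>R h) \<bullet> A (t *\<^sub>R h) = t\<^sup>2 * (h \<bullet> A h)"
  by (simp add: linear_simps(5) power2_eq_square)

lemma C11_second_derivative_ge:
  assumes C: "\<And>h. \<bar>g (x + h) - g x - q \<bullet> h\<bar> \<le> k / 2 * (norm h)\<^sup>2" and A: "bounded_linear A"
    and T: "\<And>e. e > 0 \<Longrightarrow> \<exists>K\<ge>0. \<forall>h. \<bar>g (x + h) - g x - q \<bullet> h - (h \<bullet> A h) / 2\<bar> \<le> e * (norm h)\<^sup>2 + K * norm h ^ 4"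
  shows "- k * (norm h)\<^sup>2 \<le> h \<bullet> A (h :: 'a::real_inner)"
proof -
  have "- k * (norm h)\<^sup>2 - h \<bullet> A h \<le> 0"
  proof (rule quadratic_nonpos_of_small[of "\<lambda>h. - k * (norm h)\<^sup>2 - h \<bullet> A h"])
    show "- k * (norm (t *\<^sub>R h))\<^sup>2 - (t *\<^sub>R h) \<bullet> A (t *\<^sub>R h) = t\<^sup>2 * (- k * (norm h)\<^sup>2 - h \<bullet> A h)" for t h
      unfolding bounded_linear_form_scale[OF A] by (simp add: power_mult_distrib right_diff_distrib)
    fix e :: real assume "e > 0"
    then have e: "e / 2 > 0" by simp
    obtain K where K: "\<And>h. \<bar>g (x + h) - g x - q \<bullet> h - (h \<bullet> A h) / 2\<bar> \<le> e / 2 * (norm h)\<^sup>2 + K * norm h ^ 4"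
      using T[OF e] by blast
    have "- k * (norm h)\<^sup>2 - h \<bullet> A h \<le> e * (norm h)\<^sup>2 + 2 * K * norm h ^ 4" for h
      using K[of h] C[of h] by (simp only: abs_le_iff) linarith
    then show "\<exists>K. \<forall>h. - k * (norm h)\<^sup>2 - h \<bullet> A h \<le> e * (norm h)\<^sup>2 + K * norm h ^ 4" by blast
  qed
  then show ?thesis by simp
qed

text \<open>A one-sided second order expansion at \<open>x\<close> of the sup-convolution of
  \<open>u\<close>, attained at \<open>y\<close> when \<open>y\<close> lies in \<open>S\<close>; its
  gradient is \<open>k (y - x)\<close>. It mentions \<open>u\<close> only, so the envelope can be
  forgotten afterwards. The lower bound on \<open>A\<close> records semiconvexity.\<close>

definition sup_conv_jet :: "real \<Rightarrow> 'a::real_inner set \<Rightarrow> ('a \<Rightarrow> real) \<Rightarrow> 'a \<Rightarrow> 'a \<Rightarrow> ('a \<Rightarrow> 'a) \<Rightarrow> bool" where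
  "sup_conv_jet k S u x y A \<longleftrightarrow> bounded_linear A \<and> (\<forall>h. - k * (norm h)\<^sup>2 \<le> h \<bullet> A h) \<and>
    (\<forall>e>0. \<exists>K\<ge>0. \<forall>h. \<forall>y'\<in>S. u y' - k / 2 * (norm (x + h - y'))\<^sup>2 \<le>
      u y - k / 2 * (norm (x - y))\<^sup>2 + k * ((y - x) \<bullet> h) + (h \<bullet> A h) / 2 + e * (norm h)\<^sup>2 + K * norm h ^ 4)"

lemma envelope_jet_at_contact:
  assumes lo: "\<And>x y. y \<in> S \<Longrightarrow> u y - k / 2 * (norm (x - y))\<^sup>2 \<le> g x"
    and touch: "g x = u y - k / 2 * (norm (x - y))\<^sup>2" and q: "q = k *\<^sub>R (y - x)"
    and C: "\<And>h. \<bar>g (x + h) - g x - q \<bullet> h\<bar> \<le> k / 2 * (norm h)\<^sup>2" and A: "bounded_linear A"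
    and T: "\<And>e. e > 0 \<Longrightarrow> \<exists>K\<ge>0. \<forall>h. \<bar>g (x + h) - g x - q \<bullet> h - (h \<bullet> A h) / 2\<bar> \<le> e * (norm h)\<^sup>2 + K * norm h ^ 4"
  shows "sup_conv_jet k S u x y A"
  unfolding sup_conv_jet_def
proof (intro conjI A allI impI)
  show "- k * (norm h)\<^sup>2 \<le> h \<bullet> A h" for h
    by (rule C11_second_derivative_ge[OF C A T])
  fix e :: real assume "e > 0"
  then obtain K where "K \<ge> 0" and K: "\<And>h. \<bar>g (x + h) - g x - q \<bullet> h - (h \<bullet> A h) / 2\<bar> \<le> e * (norm h)\<^sup>2 + K * norm h ^ 4"
    using T by blast
  have "u y' - k / 2 * (norm (x + h - y'))\<^sup>2 \<le>
    u y - k / 2 * (norm (x - y))\<^sup>2 + k * ((y - x) \<bullet> h) + (h \<bullet> A h) / 2 + e * (norm h)\<^sup>2 + K * norm h ^ 4" if "y' \<in> S" for h y'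
  proof -
    have "q \<bullet> h = k * ((y - x) \<bullet> h)" by (simp add: q)
    with lo[OF that, of "x + h"] K[of h] touch show ?thesis
      by (simp only: abs_le_iff) linarith
  qed
  with \<open>K \<ge> 0\<close> show "\<exists>K\<ge>0. \<forall>h. \<forall>y'\<in>S. u y' - k / 2 * (norm (x + h - y'))\<^sup>2 \<le>
      u y - k / 2 * (norm (x - y))\<^sup>2 + k * ((y - x) \<bullet> h) + (h \<bullet> A h) / 2 + e * (norm h)\<^sup>2 + K * norm h ^ 4"
    by blast
qed

theorem contact_point:
  fixes u1 u2 :: "'a::euclidean_space \<Rightarrow> real"
  assumes S: "compact S" "S \<noteq> {}" and usc: "usc_on S u1" "usc_on S u2" and k: "k > 0" and r: "r > 0"
  obtains x y z p A1 A2 where "y \<in> S" "z \<in> S" "norm p \<le> r" "p = k *\<^sub>R (y - x) + k *\<^sub>R (z - x)"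
    and "\<And>x' y' z'. y' \<in> S \<Longrightarrow> z' \<in> S \<Longrightarrow>
      u1 y' - k / 2 * (norm (x' - y'))\<^sup>2 + (u2 z' - k / 2 * (norm (x' - z'))\<^sup>2) - p \<bullet> x' \<le>
      u1 y - k / 2 * (norm (x - y))\<^sup>2 + (u2 z - k / 2 * (norm (x - z))\<^sup>2) - p \<bullet> x"
    and "sup_conv_jet k S u1 x y A1" "sup_conv_jet k S u2 x z A2"
    and "\<And>h. h \<bullet> A1 h + h \<bullet> A2 h \<le> 0"
proof -
  have bdd: "bdd_above (u1 ` S)" "bdd_above (u2 ` S)"
    using usc_on_attains_max[OF S usc(1)] usc_on_attains_max[OF S usc(2)] by (meson bdd_aboveI2)+
  have bS: "bounded S" using S(1) by (rule compact_imp_bounded)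
  obtain g1 q1 where lo1: "\<And>x y. y \<in> S \<Longrightarrow> u1 y - k / 2 * (norm (x - y))\<^sup>2 \<le> g1 x"
    and up1: "\<And>m z p x. (\<And>x y. y \<in> S \<Longrightarrow> u1 y - k / 2 * (norm (x - y))\<^sup>2 \<le> m + (k / 2 * (norm (x - z))\<^sup>2 + p \<bullet> x)) \<Longrightarrow>
          g1 x \<le> m + (k / 2 * (norm (x - z))\<^sup>2 + p \<bullet> x)"
    and C1: "\<And>x h. \<bar>g1 (x + h) - g1 x - q1 x \<bullet> h\<bar> \<le> k / 2 * (norm h)\<^sup>2"
    using C11_envelope[OF bS S(2) bdd(1) k] by blast
  obtain g2 q2 where lo2: "\<And>x y. y \<in> S \<Longrightarrow> u2 y - k / 2 * (norm (x - y))\<^sup>2 \<le> g2 x"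
    and up2: "\<And>m z p x. (\<And>x y. y \<in> S \<Longrightarrow> u2 y - k / 2 * (norm (x - y))\<^sup>2 \<le> m + (k / 2 * (norm (x - z))\<^sup>2 + p \<bullet> x)) \<Longrightarrow>
          g2 x \<le> m + (k / 2 * (norm (x - z))\<^sup>2 + p \<bullet> x)"
    and C2: "\<And>x h. \<bar>g2 (x + h) - g2 x - q2 x \<bullet> h\<bar> \<le> k / 2 * (norm h)\<^sup>2"
    using C11_envelope[OF bS S(2) bdd(2) k] by blast
  define \<Psi> where "\<Psi> p x y z = u1 y - k / 2 * (norm (x - y))\<^sup>2 + (u2 z - k / 2 * (norm (x - z))\<^sup>2) - p \<bullet> x" for p x y z
  define contact where "contact p x y z \<longleftrightarrow> y \<in> S \<and> z \<in> S \<and> (\<forall>x'. \<forall>y'\<in>S. \<forall>z'\<in>S. \<Psi> p x' y' z' \<le> \<Psi> p x y z)" for p x y z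
  have ex: "\<exists>x y z. contact p x y z" for p
  proof -
    define c where "c w = - (k / 4 * (norm (fst w - snd w))\<^sup>2 + p \<bullet> (fst w + snd w) / 2 - (norm p)\<^sup>2 / (4 * k))" for w :: "'a \<times> 'a"
    have cS: "continuous_on (S \<times> S) c"
      unfolding c_def by (intro continuous_intros) auto
    have "usc_on (S \<times> S) (\<lambda>w. (u1 (fst w) + u2 (snd w)) + c w)"
      by (intro usc_on_add usc_on_compose[OF usc(1)] usc_on_compose[OF usc(2)] usc_on_continuous[OF cS] continuous_intros) auto
    then obtain w where w: "w \<in> S \<times> S" "\<And>v. v \<in> S \<times> S \<Longrightarrow> u1 (fst v) + u2 (snd v) + c v \<le> u1 (fst w) + u2 (snd w) + c w"
      by (rule usc_on_attains_max[rotated 2]) (use S in \<open>auto simp: compact_Times\<close>)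
    define x where "x = (1/2) *\<^sub>R (fst w + snd w) - (1 / (2 * k)) *\<^sub>R p"
    have \<Psi>_eq: "\<Psi> p x' y' z' = u1 y' + u2 z' + c (y', z') - k * (norm (x' - ((1/2) *\<^sub>R (y' + z') - (1 / (2 * k)) *\<^sub>R p)))\<^sup>2" for x' y' z'
      using two_paraboloids_plus_affine[OF k, of x' y' z' p] by (simp add: \<Psi>_def c_def)
    have "\<Psi> p x' y' z' \<le> \<Psi> p x (fst w) (snd w)" if "y' \<in> S" "z' \<in> S" for x' y' z'
    proof -
      have "\<Psi> p x' y' z' \<le> u1 y' + u2 z' + c (y', z')"
        unfolding \<Psi>_eq using k by simp
      also have "\<dots> \<le> u1 (fst w) + u2 (snd w) + c w"
        using w(2)[of "(y', z')"] that by simp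
      also have "\<dots> = \<Psi> p x (fst w) (snd w)"
        unfolding \<Psi>_eq by (simp add: x_def)
      finally show ?thesis .
    qed
    then have "contact p x (fst w) (snd w)"
      using w(1) by (auto simp: contact_def)
    then show ?thesis by blast
  qed
  \<comment> \<open>Minimality of the envelopes is used one after the other. With \<open>z'\<close>
    fixed, the maximum property bounds the sup-convolution of \<open>u1\<close> by a paraboloid.
    Then \<open>g1\<close> is replaced by its lower tangent paraboloid at \<open>x'\<close>, which
    leaves a tilted paraboloid of opening \<open>k\<close> above that of \<open>u2\<close>.\<close>
  have below: "g1 x' + g2 x' \<le> \<Psi> p x y z + p \<bullet> x'" if "contact p x y z" for p x y z x'
  proof -
    define c where "c = \<Psi> p x y z"
    have max: "\<Psi> p x' y' z' \<le> c" if "y' \<in> S" "z' \<in> S" for x' y' z'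
      using \<open>contact p x y z\<close> that by (simp add: contact_def c_def)
    have s1: "g1 v \<le> (c - u2 z') + (k / 2 * (norm (v - z'))\<^sup>2 + p \<bullet> v)" if "z' \<in> S" for v z'
      by (rule up1) (use max[OF _ that] in \<open>simp add: \<Psi>_def algebra_simps\<close>)
    have s2: "g1 x' + q1 x' \<bullet> (v - x') - k / 2 * (norm (v - x'))\<^sup>2 \<le> g1 v" for v
    proof -
      have "x' + (v - x') = v" by simp
      with C1[of x' "v - x'"] show ?thesis by (simp only: abs_le_iff) linarith
    qed
    have "g2 x' \<le> (c - g1 x' + q1 x' \<bullet> x') + (k / 2 * (norm (x' - x'))\<^sup>2 + (p - q1 x') \<bullet> x')"
    proof (rule up2)
      fix v z' assume "z' \<in> S"
      from s1[OF this, of v] s2[of v]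
      show "u2 z' - k / 2 * (norm (v - z'))\<^sup>2 \<le> (c - g1 x' + q1 x' \<bullet> x') + (k / 2 * (norm (v - x'))\<^sup>2 + (p - q1 x') \<bullet> v)"
        by (simp add: inner_diff_left inner_diff_right)
    qed
    then show ?thesis by (simp add: c_def inner_diff_left)
  qed
  \<comment> \<open>Each envelope lies above its own term, and the sum does not exceed the sum of
    the two terms, so both are equalities.\<close>
  have touch: "g1 x = u1 y - k / 2 * (norm (x - y))\<^sup>2" "g2 x = u2 z - k / 2 * (norm (x - z))\<^sup>2"
    if "contact p x y z" for p x y z
    using below[OF that, of x] lo1[of y x] lo2[of z x] that by (auto simp: contact_def \<Psi>_def)
  have grad1: "q1 x = k *\<^sub>R (y - x)" and grad2: "q2 x = k *\<^sub>R (z - x)" if "contact p x y z" for p x y z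
    using that touch[OF that] unfolding contact_def
    by (auto intro!: envelope_gradient_at_contact[of g1 x "q1 x" k, OF C1] envelope_gradient_at_contact[of g2 x "q2 x" k, OF C2] lo1 lo2)
  have grad: "q1 x + q2 x = p" if "contact p x y z" for p x y z
  proof -
    have "(q1 x + q2 x - p) \<bullet> h \<le> k * (norm h)\<^sup>2" for h
    proof -
      have "g1 (x + h) + g2 (x + h) \<le> g1 x + g2 x + p \<bullet> h"
        using below[OF that, of "x + h"] touch[OF that] by (simp add: \<Psi>_def inner_add_right)
      moreover have "- (g1 (x + h) - g1 x - q1 x \<bullet> h) \<le> k / 2 * (norm h)\<^sup>2" "- (g2 (x + h) - g2 x - q2 x \<bullet> h) \<le> k / 2 * (norm h)\<^sup>2"
        using C1[of x h] C2[of x h] by (simp_all only: abs_le_iff)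
      ultimately show ?thesis
        by (simp add: inner_diff_left inner_add_left)
    qed
    then have "q1 x + q2 x - p = 0" by (rule zero_of_inner_le_norm_sq)
    then show ?thesis by simp
  qed
  have lip1: "(6 * (k / 2))-lipschitz_on UNIV q1" and lip2: "(6 * (k / 2))-lipschitz_on UNIV q2"
    using C11_gradient_lipschitz[of g1 q1, OF C1] C11_gradient_lipschitz[of g2 q2, OF C2] by blast+
  define K where "K = {x. \<exists>p y z. norm p \<le> r \<and> contact p x y z}"
  have "\<exists>x\<in>K. q1 differentiable at x \<and> q2 differentiable at x"
  proof (rule ccontr)
    assume neg: "\<not> ?thesis"
    have "AE x in lborel. q1 differentiable at x \<and> q2 differentiable at x"
      using Rademacher[OF lip1] Rademacher[OF lip2] by eventually_elim simp
    then obtain N where N: "N \<in> null_sets lborel"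
      "{x \<in> space lborel. \<not> (q1 differentiable at x \<and> q2 differentiable at x)} \<subseteq> N"
      by (elim AE_E) (auto simp: null_sets_def)
    from N(1) have "negligible N"
      by (simp add: negligible_iff_null_sets null_sets_completionI)
    moreover have "K \<subseteq> N" using N(2) neg by auto
    ultimately have "negligible K" by (rule negligible_subset)
    moreover have "(6 * (k / 2) + 6 * (k / 2))-lipschitz_on UNIV (\<lambda>x. q1 x + q2 x)"
      by (intro lipschitz_on_add lip1 lip2)
    ultimately have "negligible ((\<lambda>x. q1 x + q2 x) ` K)"
      by (intro negligible_locally_Lipschitz_image)
         (auto intro!: exI[of _ UNIV] exI[of _ "6 * (k / 2) + 6 * (k / 2)"] dest: lipschitz_onD simp: dist_norm[symmetric])
    moreover have "ball 0 r \<subseteq> (\<lambda>x. q1 x + q2 x) ` K"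
    proof
      fix p :: 'a assume "p \<in> ball 0 r"
      moreover obtain x y z where c: "contact p x y z" using ex by blast
      ultimately have "x \<in> K" unfolding K_def by (auto intro: less_imp_le)
      with grad[OF c] show "p \<in> (\<lambda>x. q1 x + q2 x) ` K" by blast
    qed
    ultimately have "negligible (ball (0::'a) r)" by (rule negligible_subset)
    then show False using r open_not_negligible[of "ball (0::'a) r"] by simp
  qed
  then obtain x p y z A1 A2 where p: "norm p \<le> r" and c: "contact p x y z"
    and A1: "(q1 has_derivative A1) (at x)" and A2: "(q2 has_derivative A2) (at x)"
    by (auto simp: K_def differentiable_def)
  note T1 = C11_second_order_Taylor[of g1 q1, OF C1 A1] and T2 = C11_second_order_Taylor[of g2 q2, OF C2 A2]
  have L1: "bounded_linear A1" and L2: "bounded_linear A2"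
    using A1 A2 has_derivative_bounded_linear by blast+
  show thesis
  proof (rule that[of y z p x A1 A2])
    show "y \<in> S" "z \<in> S" using c by (auto simp: contact_def)
    show "norm p \<le> r" by fact
    show "p = k *\<^sub>R (y - x) + k *\<^sub>R (z - x)"
      using grad[OF c] grad1[OF c] grad2[OF c] by simp
    show "u1 y' - k / 2 * (norm (x' - y'))\<^sup>2 + (u2 z' - k / 2 * (norm (x' - z'))\<^sup>2) - p \<bullet> x' \<le>
      u1 y - k / 2 * (norm (x - y))\<^sup>2 + (u2 z - k / 2 * (norm (x - z))\<^sup>2) - p \<bullet> x"
      if "y' \<in> S" "z' \<in> S" for x' y' z'
      using c that by (auto simp: contact_def \<Psi>_def)
    show "sup_conv_jet k S u1 x y A1"
      by (rule envelope_jet_at_contact[OF lo1 touch(1)[OF c] grad1[OF c] C1 L1 T1])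
    show "sup_conv_jet k S u2 x z A2"
      by (rule envelope_jet_at_contact[OF lo2 touch(2)[OF c] grad2[OF c] C2 L2 T2])
    show "h \<bullet> A1 h + h \<bullet> A2 h \<le> 0" for h
    proof (rule quadratic_nonpos_of_small[of "\<lambda>h. h \<bullet> A1 h + h \<bullet> A2 h"])
      show "(t *\<^sub>R h) \<bullet> A1 (t *\<^sub>R h) + (t *\<^sub>R h) \<bullet> A2 (t *\<^sub>R h) = t\<^sup>2 * (h \<bullet> A1 h + h \<bullet> A2 h)" for t h
        by (simp only: bounded_linear_form_scale[OF L1] bounded_linear_form_scale[OF L2] distrib_left)
      fix e :: real assume "e > 0"
      then have e: "e / 4 > 0" by simp
      obtain K1 K2 where K: "\<And>h. \<bar>g1 (x + h) - g1 x - q1 x \<bullet> h - (h \<bullet> A1 h) / 2\<bar> \<le> e / 4 * (norm h)\<^sup>2 + K1 * norm h ^ 4"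
         "\<And>h. \<bar>g2 (x + h) - g2 x - q2 x \<bullet> h - (h \<bullet> A2 h) / 2\<bar> \<le> e / 4 * (norm h)\<^sup>2 + K2 * norm h ^ 4"
        using T1[OF e] T2[OF e] by blast
      have "h \<bullet> A1 h + h \<bullet> A2 h \<le> e * (norm h)\<^sup>2 + (2 * K1 + 2 * K2) * norm h ^ 4" for h
      proof -
        have "g1 (x + h) + g2 (x + h) \<le> g1 x + g2 x + p \<bullet> h"
          using below[OF c, of "x + h"] touch[OF c] by (simp add: \<Psi>_def inner_add_right)
        moreover have "p \<bullet> h = q1 x \<bullet> h + q2 x \<bullet> h"
          using grad[OF c] by (simp add: inner_add_left[symmetric])
        ultimately show ?thesis
          using K(1)[of h] K(2)[of h] by (simp add: distrib_right abs_le_iff)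
      qed
      then show "\<exists>K. \<forall>h. h \<bullet> A1 h + h \<bullet> A2 h \<le> e * (norm h)\<^sup>2 + K * norm h ^ 4" by blast
    qed
  qed
qed

section \<open>Determinants of symmetric matrices\<close>

text \<open>A maximiser \<open>x\<close> of the Rayleigh quotient on the unit sphere of
  \<open>S\<close> is an eigenvector. Otherwise \<open>w = T x - l *\<^sub>R x\<close> is nonzero
  and orthogonal to \<open>x\<close>, and a step along \<open>w\<close> gains
  \<open>2 s |w|^2\<close> at first order against a second order loss of at most
  \<open>s^2 c\<close>.\<close>

lemma symmetric_eigenvector_exists:
  fixes T :: "'a::euclidean_space \<Rightarrow> 'a"
  assumes lin: "linear T" and sym: "\<And>x y. T x \<bullet> y = x \<bullet> T y"
    and S: "subspace S" "\<And>x. x \<in> S \<Longrightarrow> T x \<in> S" and ne: "S \<noteq> {0}"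
  obtains x l where "x \<in> S" "norm x = 1" "T x = l *\<^sub>R x"
proof -
  interpret T: linear T by fact
  let ?K = "S \<inter> sphere 0 1"
  obtain v where v: "v \<in> S" "v \<noteq> 0"
    using ne subspace_0[OF S(1)] by blast
  then have "(1 / norm v) *\<^sub>R v \<in> ?K"
    using S(1) by (simp add: subspace_scale)
  moreover have "compact ?K"
    using closed_subspace[OF S(1)] by (simp add: closed_Int_compact)
  moreover have "continuous_on ?K (\<lambda>x. x \<bullet> T x)"
    by (intro continuous_intros linear_continuous_on) (use lin in \<open>simp add: linear_conv_bounded_linear\<close>)
  ultimately obtain x where x: "x \<in> ?K" and max: "\<And>y. y \<in> ?K \<Longrightarrow> y \<bullet> T y \<le> x \<bullet> T x"
    using continuous_attains_sup[of ?K "\<lambda>x. x \<bullet> T x"] by blast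
  define l where "l = x \<bullet> T x"
  have bound: "h \<bullet> T h \<le> l * (norm h)\<^sup>2" if "h \<in> S" for h
  proof (cases "h = 0")
    case False
    then have "(1 / norm h) *\<^sub>R h \<in> ?K" using S(1) that by (simp add: subspace_scale)
    from max[OF this] False show ?thesis
      by (simp add: T.scale l_def field_simps power2_eq_square)
  qed (simp add: T.zero)
  define w where "w = T x - l *\<^sub>R x"
  have xS: "x \<in> S" "norm x = 1" using x by auto
  have wS: "w \<in> S" unfolding w_def using S xS by (intro subspace_diff subspace_scale) auto
  have xx: "x \<bullet> x = 1" using xS(2) by (simp add: dot_square_norm)
  have wx: "w \<bullet> x = 0" by (simp add: w_def l_def inner_diff_left xx inner_commute[of "T x"])
  have "w = 0"
  proof (rule ccontr)
    assume "w \<noteq> 0"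
    define c where "c = l * (norm w)\<^sup>2 - w \<bullet> T w"
    define s where "s = (norm w)\<^sup>2 / (\<bar>c\<bar> + 1)"
    have nw: "(norm w)\<^sup>2 > 0" using \<open>w \<noteq> 0\<close> by simp
    have s: "s > 0" using nw by (simp add: s_def)
    have xTw: "x \<bullet> T w = (norm w)\<^sup>2"
    proof -
      have "x \<bullet> T w = T x \<bullet> w" by (simp add: sym)
      also have "\<dots> = w \<bullet> w + l * (x \<bullet> w)" by (simp add: w_def inner_diff_left)
      finally show ?thesis using wx by (simp add: inner_commute power2_norm_eq_inner)
    qed
    have "(x + s *\<^sub>R w) \<bullet> T (x + s *\<^sub>R w) \<le> l * (norm (x + s *\<^sub>R w))\<^sup>2"
      by (rule bound) (use S(1) xS wS in \<open>simp add: subspace_add subspace_scale\<close>)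
    moreover have "(x + s *\<^sub>R w) \<bullet> T (x + s *\<^sub>R w) = l + 2 * s * (norm w)\<^sup>2 + s\<^sup>2 * (w \<bullet> T w)"
    proof -
      have "w \<bullet> T x = (norm w)\<^sup>2" using xTw sym[of w x] by (simp add: inner_commute)
      with xTw show ?thesis
        by (simp add: T.add T.scale inner_add_left inner_add_right l_def power2_eq_square algebra_simps)
    qed
    moreover have "(norm (x + s *\<^sub>R w))\<^sup>2 = 1 + s\<^sup>2 * (norm w)\<^sup>2"
      unfolding power2_norm_eq_inner
      by (simp add: inner_add_left inner_add_right xx wx inner_commute[of x w] power2_eq_square)
    ultimately have "2 * s * (norm w)\<^sup>2 \<le> s\<^sup>2 * c"
      by (simp add: c_def algebra_simps)
    then have "s * (2 * (norm w)\<^sup>2) \<le> s * (s * c)"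
      by (simp add: power2_eq_square algebra_simps)
    then have "2 * (norm w)\<^sup>2 \<le> s * c"
      using s by simp
    also have "\<dots> \<le> s * (\<bar>c\<bar> + 1)" using s by (intro mult_left_mono) auto
    also have "\<dots> = (norm w)\<^sup>2" by (simp add: s_def)
    finally show False using nw by simp
  qed
  with xS that show thesis by (simp add: w_def)
qed

text \<open>By symmetry the orthogonal complement of an eigenvector in \<open>S\<close> is again
  invariant, and its dimension is smaller by one.\<close>

lemma symmetric_orthonormal_eigenbasis:
  fixes T :: "'a::euclidean_space \<Rightarrow> 'a"
  assumes lin: "linear T" and sym: "\<And>x y. T x \<bullet> y = x \<bullet> T y"
  shows "subspace S \<Longrightarrow> (\<And>x. x \<in> S \<Longrightarrow> T x \<in> S) \<Longrightarrow>
    \<exists>B\<subseteq>S. pairwise orthogonal B \<and> (\<forall>b\<in>B. norm b = 1 \<and> (\<exists>l. T b = l *\<^sub>R b)) \<and> finite B \<and> card B = dim S"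
proof (induction "dim S" arbitrary: S)
  case 0
  then show ?case by (intro exI[of _ "{}"]) auto
next
  case (Suc n)
  then have "S \<noteq> {0}" by auto
  then obtain x l where x: "x \<in> S" "norm x = 1" "T x = l *\<^sub>R x"
    using symmetric_eigenvector_exists[OF lin sym Suc.prems] by blast
  define S' where "S' = {y \<in> S. \<forall>v\<in>span {x}. orthogonal v y}"
  have S'_iff: "y \<in> S' \<longleftrightarrow> y \<in> S \<and> x \<bullet> y = 0" for y
    by (auto simp: S'_def orthogonal_def span_singleton)
  have "span {x} \<subseteq> S" using x(1) Suc.prems(1) by (simp add: span_minimal)
  then have "dim S' + dim (span {x}) = dim S"
    unfolding S'_def by (intro dim_subspace_orthogonal_to_vectors Suc.prems(1)) auto
  moreover have "x \<noteq> 0" using x(2) by auto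
  ultimately have dim: "n = dim S'" using Suc.hyps(2) by (simp add: dim_singleton)
  have "subspace S'"
    using Suc.prems(1) by (auto simp: subspace_def S'_iff inner_add_right)
  moreover have "T y \<in> S'" if "y \<in> S'" for y
    using that Suc.prems(2) x(3) sym[of x y] by (auto simp: S'_iff)
  ultimately obtain B where B: "B \<subseteq> S'" "pairwise orthogonal B" "\<forall>b\<in>B. norm b = 1 \<and> (\<exists>l. T b = l *\<^sub>R b)" "finite B" "card B = dim S'"
    using Suc.hyps(1)[OF dim] by blast
  have xB: "x \<bullet> b = 0" if "b \<in> B" for b using that B(1) by (auto simp: S'_iff)
  then have "x \<notin> B" using \<open>x \<noteq> 0\<close> by fastforce
  show ?case
  proof (intro exI[of _ "insert x B"] conjI)
    show "insert x B \<subseteq> S" using x(1) B(1) by (auto simp: S'_iff)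
    show "pairwise orthogonal (insert x B)"
      using B(2) xB by (auto simp: pairwise_insert orthogonal_def inner_commute)
    show "card (insert x B) = dim S"
      using \<open>x \<notin> B\<close> B(4,5) dim Suc.hyps(2) by simp
    show "\<forall>b\<in>insert x B. norm b = 1 \<and> (\<exists>l. T b = l *\<^sub>R b)"
      using B(3) x(2,3) by blast
    show "finite (insert x B)" using B(4) by simp
  qed
qed

definition diag_mat :: "('m \<Rightarrow> real) \<Rightarrow> real^'m^'m" where
  "diag_mat l = (\<chi> i j. if i = j then l i else 0)"

lemma det_diag_mat: "det (diag_mat l) = prod l UNIV"
  unfolding diag_mat_def by (subst det_diagonal) auto

lemma diag_mat_mult: "diag_mat l ** diag_mat k = diag_mat (\<lambda>i. l i * k i)"
proof -
  have "(\<Sum>j\<in>UNIV. (if i = j then l i else 0) * (if j = h then k j else 0)) = (if i = h then l i * k i else 0)" for i h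
  proof -
    have "(\<Sum>j\<in>UNIV. (if i = j then l i else 0) * (if j = h then k j else 0)) =
      (\<Sum>j\<in>UNIV. if i = j then l i * (if i = h then k i else 0) else 0)"
      by (rule sum.cong) auto
    then show ?thesis by simp
  qed
  then show ?thesis
    by (simp add: diag_mat_def matrix_matrix_mult_def vec_eq_iff)
qed

lemma inner_matrix_vector_mult: "x \<bullet> (A *v y) = (transpose A *v x) \<bullet> (y :: real^'n)"
  by (simp only: transpose_matrix_vector dot_lmul_matrix)

text \<open>Besides the factorisation, the columns of \<open>P\<close> are recorded as unit
  eigenvectors. Evaluating a quadratic form on them gives the bounds on the eigenvalues
  \<open>l i\<close>.\<close>

definition orthogonally_diagonalizes :: "real^'m^'m \<Rightarrow> ('m \<Rightarrow> real) \<Rightarrow> real^'m^'m \<Rightarrow> bool" where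
  "orthogonally_diagonalizes P l A \<longleftrightarrow> transpose P ** P = mat 1 \<and> P ** transpose P = mat 1 \<and>
     A = P ** diag_mat l ** transpose P \<and>
     (\<forall>i. norm (column i P) = 1) \<and> (\<forall>i. A *v column i P = l i *\<^sub>R column i P)"

lemma sym_mat_diagonalizable:
  fixes A :: "real^'m^'m"
  assumes "sym_mat A"
  obtains P l where "orthogonally_diagonalizes P l A"
proof -
  have sym: "(A *v x) \<bullet> y = x \<bullet> (A *v y)" for x y
    using assms inner_matrix_vector_mult[of x A y] by (simp add: sym_mat_def)
  obtain B where B: "pairwise orthogonal B" "\<And>b. b \<in> B \<Longrightarrow> norm b = 1" "\<And>b. b \<in> B \<Longrightarrow> \<exists>l. A *v b = l *\<^sub>R b"
    "finite B" "card B = CARD('m)"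
    using symmetric_orthonormal_eigenbasis[of "(*v) A" UNIV, OF _ sym] by auto
  obtain f :: "'m \<Rightarrow> real^'m" where f: "bij_betw f UNIV B"
    using B(4,5) finite_same_card_bij[of "UNIV :: 'm set" B] by auto
  then have fB: "f i \<in> B" for i by (auto simp: bij_betw_def)
  obtain l where l: "\<And>i. A *v f i = l i *\<^sub>R f i" using B(3)[OF fB] by metis
  define P :: "real^'m^'m" where "P = (\<chi> i j. f j $ i)"
  have col: "column j P = f j" for j by (simp add: P_def column_def vec_eq_iff)
  have "f i \<bullet> f j = (if i = j then 1 else 0)" for i j
  proof (cases "i = j")
    case True then show ?thesis using B(2)[OF fB] by (simp add: dot_square_norm)
  next
    case False
    then have "f i \<noteq> f j" using f by (auto simp: bij_betw_def inj_def)
    then have "orthogonal (f i) (f j)" using B(1) fB by (auto simp: pairwise_def)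
    then show ?thesis using False by (simp add: orthogonal_def)
  qed
  then have PP: "transpose P ** P = mat 1"
    by (simp add: P_def matrix_matrix_mult_def transpose_def mat_def vec_eq_iff inner_vec_def)
  then have PP': "P ** transpose P = mat 1"
    using matrix_left_right_inverse by blast
  have "A ** P = P ** diag_mat l"
  proof -
    have "(A ** P) $ i $ j = (P ** diag_mat l) $ i $ j" for i j
    proof -
      have "(A ** P) $ i $ j = (A *v f j) $ i"
        by (simp add: P_def matrix_matrix_mult_def matrix_vector_mult_def)
      also have "\<dots> = (P ** diag_mat l) $ i $ j"
      proof -
        have "(\<Sum>h\<in>UNIV. f h $ i * (if h = j then l h else 0)) = (\<Sum>h\<in>UNIV. if h = j then f j $ i * l j else 0)"
          by (rule sum.cong) auto
        then show ?thesis
          by (simp add: l P_def matrix_matrix_mult_def diag_mat_def)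
      qed
      finally show ?thesis .
    qed
    then show ?thesis by (simp add: vec_eq_iff)
  qed
  then have "A ** (P ** transpose P) = P ** diag_mat l ** transpose P"
    by (simp add: matrix_mul_assoc)
  then have "A = P ** diag_mat l ** transpose P" by (simp add: PP')
  with PP PP' B(2) fB l have "orthogonally_diagonalizes P l A"
    by (simp add: orthogonally_diagonalizes_def col)
  with that show thesis .
qed

lemma det_conjugate_orthogonal:
  fixes P D :: "real^'m^'m"
  assumes "P ** transpose P = mat 1"
  shows "det (P ** D ** transpose P) = det D"
proof -
  have "det P * det (transpose P) = 1" using assms by (metis det_I det_mul)
  then show ?thesis by (simp add: det_mul)
qed

section \<open>Determinant inequalities\<close>

text \<open>On expansion all mixed terms are nonnegative. For the empty set the claim would read
  \<open>2 \<le> 1\<close>.\<close>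

lemma prod_add_const_ge:
  fixes l :: "'a \<Rightarrow> real"
  assumes "finite I" "I \<noteq> {}" "\<And>i. i \<in> I \<Longrightarrow> 0 \<le> l i" "0 \<le> c"
  shows "prod l I + c ^ card I \<le> (\<Prod>i\<in>I. l i + c)"
  using assms
proof (induction I rule: finite_ne_induct)
  case (singleton i) then show ?case by simp
next
  case (insert i I)
  have p: "0 \<le> prod l I" using insert by (intro prod_nonneg) auto
  have "prod l (insert i I) + c ^ card (insert i I) \<le> (l i + c) * (prod l I + c ^ card I)"
    using insert p by (simp add: distrib_right distrib_left)
  also have "\<dots> \<le> (l i + c) * (\<Prod>i\<in>I. l i + c)"
    using insert by (intro mult_left_mono) auto
  finally show ?case using insert by simp
qed

lemma matrix_matrix_add_rdistrib: "(B + C) ** (A :: real^'n^'m) = B ** A + C ** A"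
  by (simp add: matrix_matrix_mult_def vec_eq_iff sum.distrib distrib_right)

lemma det_add_scalar_ge:
  fixes A :: "real^'m^'m"
  assumes A: "sym_mat A" "\<And>\<xi>. 0 \<le> \<xi> \<bullet> (A *v \<xi>)" and c: "0 \<le> c"
  shows "det A + c ^ CARD('m) \<le> det (A + c *\<^sub>R mat 1)"
proof -
  obtain P l where Pl: "orthogonally_diagonalizes P l A"
    using sym_mat_diagonalizable[OF A(1)] by blast
  from Pl have P: "transpose P ** P = mat 1" "P ** transpose P = mat 1" "A = P ** diag_mat l ** transpose P"
    unfolding orthogonally_diagonalizes_def by simp_all
  from Pl have n: "norm (column i P) = 1" "A *v column i P = l i *\<^sub>R column i P" for i
    unfolding orthogonally_diagonalizes_def by blast+
  have l: "0 \<le> l i" for i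
    using A(2)[of "column i P"] n[of i] by (simp add: dot_square_norm)
  have "diag_mat (\<lambda>i. l i + c) = diag_mat l + c *\<^sub>R mat 1"
    by (auto simp: diag_mat_def mat_def vec_eq_iff)
  then have "P ** diag_mat (\<lambda>i. l i + c) ** transpose P = A + c *\<^sub>R mat 1"
    using P(2,3) by (simp add: matrix_add_ldistrib matrix_matrix_add_rdistrib matrix_scalar_ac scalar_matrix_assoc[symmetric])
  then have "det (A + c *\<^sub>R mat 1) = (\<Prod>i\<in>UNIV. l i + c)"
    using det_conjugate_orthogonal[OF P(2)] det_diag_mat by metis
  moreover have "det A = prod l UNIV"
    using det_conjugate_orthogonal[OF P(2)] det_diag_mat P(3) by metis
  ultimately show ?thesis
    using prod_add_const_ge[of UNIV l c] l c by simp
qed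

text \<open>Conjugation by \<open>R\<close>, the inverse square root of \<open>A\<close>, turns
  \<open>A\<close> into the identity. All eigenvalues of \<open>C = R ** B ** R\<close> are then at
  least \<open>1\<close>, and both determinants change by the same factor
  \<open>(det R)\<^sup>2\<close>.\<close>

lemma det_mono_pos_def:
  fixes A B :: "real^'m^'m"
  assumes A: "pos_def A" and B: "sym_mat B" and le: "\<And>\<xi>. \<xi> \<bullet> (A *v \<xi>) \<le> \<xi> \<bullet> (B *v \<xi>)"
  shows "det A \<le> det B"
proof -
  have sA: "sym_mat A" using A by (simp add: pos_def_def)
  obtain P l where Pl: "orthogonally_diagonalizes P l A"
    using sym_mat_diagonalizable[OF sA] by blast
  from Pl have P: "transpose P ** P = mat 1" "P ** transpose P = mat 1" "A = P ** diag_mat l ** transpose P"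
    unfolding orthogonally_diagonalizes_def by simp_all
  from Pl have n: "norm (column i P) = 1" "A *v column i P = l i *\<^sub>R column i P" for i
    unfolding orthogonally_diagonalizes_def by blast+
  have l: "0 < l i" for i
  proof -
    have "column i P \<noteq> 0" using n(1)[of i] by auto
    then have "0 < column i P \<bullet> (A *v column i P)" using A by (auto simp: pos_def_def)
    then show ?thesis using n[of i] by (simp add: dot_square_norm)
  qed
  define R where "R = P ** diag_mat (\<lambda>i. 1 / sqrt (l i)) ** transpose P"
  have tD: "transpose (diag_mat k) = diag_mat k" for k :: "'m \<Rightarrow> real"
    by (auto simp: diag_mat_def transpose_def vec_eq_iff)
  have tR: "transpose R = R"
    by (simp add: R_def matrix_transpose_mul tD matrix_mul_assoc)
  have "R ** A ** R = P ** diag_mat (\<lambda>i. 1 / sqrt (l i)) ** (transpose P ** P) ** diag_mat l ** (transpose P ** P) ** diag_mat (\<lambda>i. 1 / sqrt (l i)) ** transpose P"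
    by (simp only: R_def P(3) matrix_mul_assoc)
  also have "\<dots> = P ** (diag_mat (\<lambda>i. 1 / sqrt (l i)) ** diag_mat l ** diag_mat (\<lambda>i. 1 / sqrt (l i))) ** transpose P"
    by (simp add: P(1) matrix_mul_assoc)
  also have "diag_mat (\<lambda>i. 1 / sqrt (l i)) ** diag_mat l ** diag_mat (\<lambda>i. 1 / sqrt (l i)) = mat 1"
  proof -
    have "1 / sqrt (l i) * l i * (1 / sqrt (l i)) = 1" for i
      using l[of i] by (simp add: field_simps)
    then show ?thesis
      unfolding diag_mat_mult by (simp add: diag_mat_def mat_def)
  qed
  finally have RAR: "R ** A ** R = mat 1" by (simp add: P(2))
  define C where "C = R ** B ** R"
  have quad: "\<xi> \<bullet> ((R ** M ** R) *v \<xi>) = (R *v \<xi>) \<bullet> (M *v (R *v \<xi>))" for M \<xi>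
  proof -
    have "\<xi> \<bullet> ((R ** M ** R) *v \<xi>) = \<xi> \<bullet> (R *v (M *v (R *v \<xi>)))"
      by (simp add: matrix_vector_mul_assoc matrix_mul_assoc)
    then show ?thesis using tR by (simp only: inner_matrix_vector_mult)
  qed
  have "sym_mat C"
    using B tR by (simp add: sym_mat_def C_def matrix_transpose_mul matrix_mul_assoc)
  then obtain Q k where Qk: "orthogonally_diagonalizes Q k C"
    using sym_mat_diagonalizable by blast
  from Qk have Q: "Q ** transpose Q = mat 1" "C = Q ** diag_mat k ** transpose Q"
    unfolding orthogonally_diagonalizes_def by simp_all
  from Qk have m: "norm (column i Q) = 1" "C *v column i Q = k i *\<^sub>R column i Q" for i
    unfolding orthogonally_diagonalizes_def by blast+
  have "1 \<le> k i" for i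
  proof -
    have "column i Q \<bullet> ((R ** A ** R) *v column i Q) \<le> column i Q \<bullet> (C *v column i Q)"
      unfolding C_def quad by (rule le)
    then show ?thesis using m[of i] by (simp add: RAR dot_square_norm)
  qed
  then have "1 \<le> prod k UNIV" by (simp add: prod_ge_1)
  then have C1: "1 \<le> det C"
    using det_conjugate_orthogonal[OF Q(1)] det_diag_mat Q(2) by metis
  have "det R * det A * det R = 1" using RAR by (metis det_I det_mul)
  then have dA: "(det R)\<^sup>2 * det A = 1" by (simp add: power2_eq_square algebra_simps)
  have "det C = (det R)\<^sup>2 * det B" by (simp add: C_def det_mul power2_eq_square)
  with C1 dA have "(det R)\<^sup>2 * det A \<le> (det R)\<^sup>2 * det B" by simp
  moreover have "0 < (det R)\<^sup>2" using dA by (cases "det R = 0") auto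
  ultimately show ?thesis by simp
qed

section \<open>Second derivatives along vector fields\<close>

lemma C2_on_of_gradient:
  fixes \<phi> :: "'a::euclidean_space \<Rightarrow> real"
  assumes \<phi>: "\<And>y. (\<phi> has_derivative (\<lambda>h. \<gamma> y \<bullet> h)) (at y)"
    and \<gamma>: "\<And>y. (\<gamma> has_derivative H y) (at y)"
    and H: "\<And>h. continuous_on UNIV (\<lambda>y. H y h)"
  shows "C2_on \<Omega> S \<phi>"
proof -
  have cont: "continuous_on S \<phi>" for S
    using \<phi> by (meson has_derivative_continuous continuous_at_imp_continuous_on)
  have cont\<gamma>: "continuous_on S \<gamma>" for S
    using \<gamma> by (meson has_derivative_continuous continuous_at_imp_continuous_on)
  have lin: "bounded_linear (H y)" for y
    using \<gamma> by (rule has_derivative_bounded_linear)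
  define G where "G y = Blinfun (\<lambda>h. blinfun_inner_right (H y h))" for y
  have G: "blinfun_apply (G y) h = blinfun_inner_right (H y h)" for y h
    unfolding G_def
    by (subst bounded_linear_Blinfun_apply) (auto intro!: bounded_linear_compose[OF bounded_linear_blinfun_inner_right lin])
  have "C1_on \<Omega> S (\<lambda>y. blinfun_inner_right (\<gamma> y))"
    unfolding C1_on_def
  proof (intro conjI exI[of _ G] ballI)
    show "continuous_on S (\<lambda>y. blinfun_inner_right (\<gamma> y))"
      by (intro bounded_linear.continuous_on[OF bounded_linear_blinfun_inner_right] cont\<gamma>)
    show "continuous_on S G"
    proof (rule continuous_on_blinfun_componentwise)
      fix i :: 'a
      show "continuous_on S (\<lambda>x. blinfun_apply (G x) i)"
        unfolding G
        by (intro bounded_linear.continuous_on[OF bounded_linear_blinfun_inner_right] continuous_on_subset[OF H]) auto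
    qed
    fix y
    have "((\<lambda>y. blinfun_inner_right (\<gamma> y)) has_derivative (\<lambda>h. blinfun_inner_right (H y h))) (at y)"
      by (rule bounded_linear.has_derivative[OF bounded_linear_blinfun_inner_right \<gamma>])
    then show "((\<lambda>y. blinfun_inner_right (\<gamma> y)) has_derivative blinfun_apply (G y)) (at y)"
      by (simp add: G[abs_def])
  qed
  then show ?thesis
    unfolding C2_on_def using cont \<phi>
    by (intro conjI exI[of _ "\<lambda>y. blinfun_inner_right (\<gamma> y)"]) auto
qed

text \<open>The last term removes the quadratic perturbation of \<open>u\<close> from a test function for the perturbed one.\<close>

definition test_poly :: "'a::real_inner \<Rightarrow> ('a \<Rightarrow> 'a) \<Rightarrow> real \<Rightarrow> real \<Rightarrow> ('a \<Rightarrow> 'a) \<Rightarrow> 'a \<Rightarrow> 'a \<Rightarrow> real" where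
  "test_poly q A K t P y0 y = q \<bullet> (y - y0) + ((y - y0) \<bullet> A (y - y0)) / 2 + K * ((y - y0) \<bullet> (y - y0))\<^sup>2 - t * (y \<bullet> P y) / 2"

definition test_poly_grad :: "'a::real_inner \<Rightarrow> ('a \<Rightarrow> 'a) \<Rightarrow> real \<Rightarrow> real \<Rightarrow> ('a \<Rightarrow> 'a) \<Rightarrow> 'a \<Rightarrow> 'a \<Rightarrow> 'a" where
  "test_poly_grad q A K t P y0 y = q + A (y - y0) + (4 * K * ((y - y0) \<bullet> (y - y0))) *\<^sub>R (y - y0) - t *\<^sub>R P y"

definition test_poly_hess :: "('a::real_inner \<Rightarrow> 'a) \<Rightarrow> real \<Rightarrow> real \<Rightarrow> ('a \<Rightarrow> 'a) \<Rightarrow> 'a \<Rightarrow> 'a \<Rightarrow> 'a \<Rightarrow> 'a" where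
  "test_poly_hess A K t P y0 y h = A h + ((4 * K * ((y - y0) \<bullet> (y - y0))) *\<^sub>R h +
     (8 * K * ((y - y0) \<bullet> h)) *\<^sub>R (y - y0)) - t *\<^sub>R P h"

context
  fixes A P :: "'a::euclidean_space \<Rightarrow> 'a" and q y0 :: 'a and K t :: real
  assumes A: "bounded_linear A" "\<And>v w. A v \<bullet> w = v \<bullet> A w"
    and P: "bounded_linear P" "\<And>v w. P v \<bullet> w = v \<bullet> P w"
begin

lemma test_poly_has_derivative:
  "(test_poly q A K t P y0 has_derivative (\<lambda>h. test_poly_grad q A K t P y0 y \<bullet> h)) (at y)"
proof -
  note dA = bounded_linear.has_derivative[OF A(1)] and dP = bounded_linear.has_derivative[OF P(1)]
  have "((\<lambda>y. q \<bullet> (y - y0) + ((y - y0) \<bullet> A (y - y0)) / 2 + K * ((y - y0) \<bullet> (y - y0))\<^sup>2 - t * (y \<bullet> P y) / 2)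
     has_derivative (\<lambda>h. q \<bullet> h + ((y - y0) \<bullet> A h + h \<bullet> A (y - y0)) / 2 +
       K * (2 * ((y - y0) \<bullet> (y - y0)) * ((y - y0) \<bullet> h + h \<bullet> (y - y0))) - t * (y \<bullet> P h + h \<bullet> P y) / 2)) (at y)"
    by (auto intro!: derivative_eq_intros dA dP simp: fun_eq_iff field_simps)
  moreover have "(\<lambda>h. q \<bullet> h + ((y - y0) \<bullet> A h + h \<bullet> A (y - y0)) / 2 +
       K * (2 * ((y - y0) \<bullet> (y - y0)) * ((y - y0) \<bullet> h + h \<bullet> (y - y0))) - t * (y \<bullet> P h + h \<bullet> P y) / 2)
     = (\<lambda>h. test_poly_grad q A K t P y0 y \<bullet> h)"
  proof
    fix h
    have "(y - y0) \<bullet> A h = A (y - y0) \<bullet> h" "h \<bullet> A (y - y0) = A (y - y0) \<bullet> h" "h \<bullet> (y - y0) = (y - y0) \<bullet> h"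
      "y \<bullet> P h = P y \<bullet> h" "h \<bullet> P y = P y \<bullet> h"
      by (rule A(2)[symmetric] P(2)[symmetric] inner_commute)+
    then show "q \<bullet> h + ((y - y0) \<bullet> A h + h \<bullet> A (y - y0)) / 2 +
       K * (2 * ((y - y0) \<bullet> (y - y0)) * ((y - y0) \<bullet> h + h \<bullet> (y - y0))) - t * (y \<bullet> P h + h \<bullet> P y) / 2
       = test_poly_grad q A K t P y0 y \<bullet> h"
      unfolding test_poly_grad_def by (simp add: inner_add_left inner_diff_left[of _ "t *\<^sub>R P y"])
  qed
  ultimately show ?thesis
    unfolding test_poly_def[abs_def] by simp
qed

lemma test_poly_grad_has_derivative:
  "(test_poly_grad q A K t P y0 has_derivative test_poly_hess A K t P y0 y) (at y)"
proof -
  note dA = bounded_linear.has_derivative[OF A(1)] and dP = bounded_linear.has_derivative[OF P(1)]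
  have "((\<lambda>y. q + A (y - y0) + (4 * K * ((y - y0) \<bullet> (y - y0))) *\<^sub>R (y - y0) - t *\<^sub>R P y) has_derivative
     (\<lambda>h. A h + ((4 * K * ((y - y0) \<bullet> (y - y0))) *\<^sub>R h + (4 * K * ((y - y0) \<bullet> h + h \<bullet> (y - y0))) *\<^sub>R (y - y0)) - t *\<^sub>R P h)) (at y)"
    by (auto intro!: derivative_eq_intros dA dP)
  moreover have "4 * K * ((y - y0) \<bullet> h + h \<bullet> (y - y0)) = 8 * K * ((y - y0) \<bullet> h)" for h
    by (simp add: inner_commute)
  ultimately show ?thesis
    unfolding test_poly_grad_def[abs_def] test_poly_hess_def[abs_def] by simp
qed

lemma C2_on_test_poly: "C2_on \<Omega> S (test_poly q A K t P y0)"
proof (rule C2_on_of_gradient[OF test_poly_has_derivative test_poly_grad_has_derivative])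
  show "continuous_on UNIV (\<lambda>y. test_poly_hess A K t P y0 y h)" for h
    unfolding test_poly_hess_def by (intro continuous_intros)
qed

end

section \<open>The X-Hessian as a quadratic form\<close>

text \<open>With \<open>s j\<close> the derivative of the field \<open>X_j\<close>, the inner
  product of this vector with \<open>p\<close> is the quadratic form of \<open>Q(y,p)\<close> at
  \<xi>. As a vector it separates the dependence on the gradient from that on the point.\<close>

definition X_sym_deriv :: "(real^'n \<Rightarrow> real^'m^'n) \<Rightarrow> ('m \<Rightarrow> real^'n \<Rightarrow> ((real^'n) \<Rightarrow>\<^sub>L (real^'n))) \<Rightarrow> real^'n \<Rightarrow> real^'m \<Rightarrow> real^'n" where
  "X_sym_deriv \<sigma> s y \<xi> = (\<Sum>i\<in>UNIV. \<Sum>j\<in>UNIV. (\<xi> $ i * \<xi> $ j) *\<^sub>R s j y (vfield \<sigma> i y))"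

lemma matrix_vector_mult_vfield: "\<sigma> x *v \<xi> = (\<Sum>j\<in>UNIV. \<xi> $ j *\<^sub>R vfield \<sigma> j x)"
  by (simp add: vec_eq_iff matrix_vector_mult_def vfield_def column_def mult.commute)

lemma inner_matrix_form: "\<xi> \<bullet> (M *v \<xi>) = (\<Sum>i\<in>UNIV. \<Sum>j\<in>UNIV. \<xi> $ i * \<xi> $ j * M $ i $ j)" for M :: "real^'m^'m"
  by (simp add: inner_vec_def matrix_vector_mult_def sum_distrib_left mult_ac)

lemma inner_linear_form:
  assumes "bounded_linear H"
  shows "(\<sigma> x *v \<xi>) \<bullet> H (\<sigma> x *v \<xi>) = (\<Sum>i\<in>UNIV. \<Sum>j\<in>UNIV. \<xi> $ i * \<xi> $ j * (vfield \<sigma> i x \<bullet> H (vfield \<sigma> j x)))"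
proof -
  interpret H: bounded_linear H by fact
  show ?thesis
    unfolding matrix_vector_mult_vfield H.sum H.scaleR inner_sum_left inner_sum_right
    by (simp add: sum_distrib_left mult_ac) (subst sum.swap, simp add: mult_ac)
qed

lemma sum_swap_symmetrize:
  fixes F :: "'m::finite \<Rightarrow> 'm \<Rightarrow> real"
  shows "(\<Sum>i\<in>UNIV. \<Sum>j\<in>UNIV. c i * c j * ((F i j + F j i) / 2)) = (\<Sum>i\<in>UNIV. \<Sum>j\<in>UNIV. c i * c j * F i j)"
proof -
  have "(\<Sum>i\<in>UNIV. \<Sum>j\<in>UNIV. c i * c j * F j i) = (\<Sum>i\<in>UNIV. \<Sum>j\<in>UNIV. c i * c j * F i j)"
    by (subst sum.swap) (simp add: mult.commute mult.left_commute)
  moreover have "(\<Sum>i\<in>UNIV. \<Sum>j\<in>UNIV. c i * c j * ((F i j + F j i) / 2)) =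
     ((\<Sum>i\<in>UNIV. \<Sum>j\<in>UNIV. c i * c j * F i j) + (\<Sum>i\<in>UNIV. \<Sum>j\<in>UNIV. c i * c j * F j i)) / 2"
    by (simp add: sum.distrib[symmetric] sum_divide_distrib distrib_left add_divide_distrib)
  ultimately show ?thesis by simp
qed

lemma sym_mat_D2X: "sym_mat (D2X \<sigma> \<phi> x)"
  by (simp add: sym_mat_def D2X_def transpose_def vec_eq_iff add.commute)

text \<open>The product rule for \<open>X_j \<phi> = \<gamma> \<bullet> X_j\<close> gives one term
  with \<open>H\<close> and one with the derivative of the field. The symmetrisation in
  \<open>D2X\<close> does not affect the quadratic form.\<close>

lemma D2X_quadratic_form:
  fixes \<sigma> :: "real^'n \<Rightarrow> real^'m^'n" and s :: "'m \<Rightarrow> real^'n \<Rightarrow> ((real^'n) \<Rightarrow>\<^sub>L (real^'n))"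
  assumes \<Omega>: "open \<Omega>" "x \<in> \<Omega>"
    and \<phi>: "\<And>y. y \<in> \<Omega> \<Longrightarrow> (\<phi> has_derivative (\<lambda>h. \<gamma> y \<bullet> h)) (at y)"
    and \<gamma>: "(\<gamma> has_derivative H) (at x)"
    and s: "\<And>j. (vfield \<sigma> j has_derivative s j x) (at x)"
  shows "\<xi> \<bullet> (D2X \<sigma> \<phi> x *v \<xi>) = (\<sigma> x *v \<xi>) \<bullet> H (\<sigma> x *v \<xi>) + \<gamma> x \<bullet> X_sym_deriv \<sigma> s x \<xi>"
proof -
  have X1: "X_deriv \<sigma> j \<phi> y = \<gamma> y \<bullet> vfield \<sigma> j y" if "y \<in> \<Omega>" for j y
    by (simp add: X_deriv_def flip: frechet_derivative_at[OF \<phi>[OF that]])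
  have X2: "X_deriv \<sigma> i (X_deriv \<sigma> j \<phi>) x = vfield \<sigma> j x \<bullet> H (vfield \<sigma> i x) + \<gamma> x \<bullet> s j x (vfield \<sigma> i x)" for i j
  proof -
    have "((\<lambda>y. \<gamma> y \<bullet> vfield \<sigma> j y) has_derivative (\<lambda>h. \<gamma> x \<bullet> s j x h + H h \<bullet> vfield \<sigma> j x)) (at x)"
      by (rule has_derivative_inner[OF \<gamma> s])
    then have "(X_deriv \<sigma> j \<phi> has_derivative (\<lambda>h. \<gamma> x \<bullet> s j x h + H h \<bullet> vfield \<sigma> j x)) (at x)"
      using \<Omega> by (rule has_derivative_transform_within_open) (simp add: X1)
    from frechet_derivative_at[OF this, symmetric] show ?thesis
      unfolding X_deriv_def[of \<sigma> i] by (simp add: inner_commute[of "vfield \<sigma> j x"])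
  qed
  define F where "F i j = vfield \<sigma> i x \<bullet> H (vfield \<sigma> j x) + \<gamma> x \<bullet> s i x (vfield \<sigma> j x)" for i j
  have "\<xi> \<bullet> (D2X \<sigma> \<phi> x *v \<xi>) = (\<Sum>i\<in>UNIV. \<Sum>j\<in>UNIV. \<xi> $ i * \<xi> $ j * ((F i j + F j i) / 2))"
    unfolding inner_matrix_form by (simp add: D2X_def X2 F_def add.commute)
  also have "\<dots> = (\<Sum>i\<in>UNIV. \<Sum>j\<in>UNIV. \<xi> $ i * \<xi> $ j * F i j)"
    by (rule sum_swap_symmetrize)
  also have "\<dots> = (\<sigma> x *v \<xi>) \<bullet> H (\<sigma> x *v \<xi>) + (\<Sum>i\<in>UNIV. \<Sum>j\<in>UNIV. \<xi> $ i * \<xi> $ j * (\<gamma> x \<bullet> s i x (vfield \<sigma> j x)))"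
    unfolding inner_linear_form[OF has_derivative_bounded_linear[OF \<gamma>]] F_def
    by (simp add: distrib_left sum.distrib)
  also have "(\<Sum>i\<in>UNIV. \<Sum>j\<in>UNIV. \<xi> $ i * \<xi> $ j * (\<gamma> x \<bullet> s i x (vfield \<sigma> j x))) = \<gamma> x \<bullet> X_sym_deriv \<sigma> s x \<xi>"
    unfolding X_sym_deriv_def inner_sum_right
    by (subst sum.swap) (simp add: mult.commute)
  finally show ?thesis .
qed

section \<open>Local bounds on the coefficients\<close>

lemma C1_on_lipschitz_cball:
  fixes g :: "'a::euclidean_space \<Rightarrow> 'b::real_normed_vector"
  assumes g: "C1_on \<Omega> S g" and sub: "cball x \<rho> \<subseteq> \<Omega>" "\<Omega> \<subseteq> S"
  obtains L where "0 \<le> L" "\<And>y z. y \<in> cball x \<rho> \<Longrightarrow> z \<in> cball x \<rho> \<Longrightarrow> norm (g y - g z) \<le> L * norm (y - z)"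
    "\<And>y. y \<in> cball x \<rho> \<Longrightarrow> norm (g y) \<le> L"
proof -
  obtain g' where cg: "continuous_on S g" and g': "continuous_on S g'"
    "\<And>y. y \<in> \<Omega> \<Longrightarrow> (g has_derivative blinfun_apply (g' y)) (at y)"
    using g unfolding C1_on_def by blast
  have sS: "cball x \<rho> \<subseteq> S" using sub by blast
  have "bounded (g ` cball x \<rho>)" "bounded (g' ` cball x \<rho>)"
    using compact_continuous_image[OF continuous_on_subset[OF cg sS]]
      compact_continuous_image[OF continuous_on_subset[OF g'(1) sS]] compact_imp_bounded by auto
  then obtain B B' where B: "\<And>y. y \<in> cball x \<rho> \<Longrightarrow> norm (g y) \<le> B" "\<And>y. y \<in> cball x \<rho> \<Longrightarrow> norm (g' y) \<le> B'"
    unfolding bounded_iff by (metis imageI)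
  define L where "L = \<bar>B\<bar> + \<bar>B'\<bar>"
  show thesis
  proof (rule that[of L])
    show "0 \<le> L" by (simp add: L_def)
    show "norm (g y) \<le> L" if "y \<in> cball x \<rho>" for y
      using B(1)[OF that] by (simp add: L_def)
    show "norm (g y - g z) \<le> L * norm (y - z)" if "y \<in> cball x \<rho>" "z \<in> cball x \<rho>" for y z
    proof (rule differentiable_bound[of "cball x \<rho>" g "\<lambda>y. blinfun_apply (g' y)"])
      show "(g has_derivative blinfun_apply (g' y)) (at y within cball x \<rho>)" if "y \<in> cball x \<rho>" for y
        using g'(2) sub that by (blast intro: has_derivative_at_withinI)
      show "onorm (blinfun_apply (g' y)) \<le> L" if "y \<in> cball x \<rho>" for y
        using B(2)[OF that] by (simp add: L_def norm_blinfun.rep_eq[symmetric])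
    qed (use that in auto)
  qed
qed

lemma C2_on_obtain_derivative:
  fixes X :: "'m::finite \<Rightarrow> 'a::euclidean_space \<Rightarrow> 'b::euclidean_space"
  assumes "\<And>j. C2_on \<Omega> (closure \<Omega>) (X j)"
  obtains s where "\<And>j. C1_on \<Omega> (closure \<Omega>) (s j)"
    "\<And>j x. x \<in> \<Omega> \<Longrightarrow> (X j has_derivative blinfun_apply (s j x)) (at x)"
    "\<And>j. C1_on \<Omega> (closure \<Omega>) (X j)"
proof -
  have "\<forall>j. \<exists>s. C1_on \<Omega> (closure \<Omega>) s \<and> (\<forall>x\<in>\<Omega>. (X j has_derivative blinfun_apply (s x)) (at x))"
    using assms unfolding C2_on_def by blast
  then obtain s where s: "\<And>j. C1_on \<Omega> (closure \<Omega>) (s j)"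
    "\<And>j x. x \<in> \<Omega> \<Longrightarrow> (X j has_derivative blinfun_apply (s j x)) (at x)"
    by metis
  moreover have "C1_on \<Omega> (closure \<Omega>) (X j)" for j
    unfolding C1_on_def
  proof (intro conjI exI[of _ "s j"] ballI)
    show "continuous_on (closure \<Omega>) (X j)" using assms[of j] by (simp add: C2_on_def)
    show "continuous_on (closure \<Omega>) (s j)" using s(1)[of j] by (simp add: C1_on_def)
  qed (rule s(2))
  ultimately show thesis using that by blast
qed

lemma vfield_local_bounds:
  fixes \<sigma> :: "real^'n \<Rightarrow> real^'m^'n" and s :: "'m \<Rightarrow> real^'n \<Rightarrow> ((real^'n) \<Rightarrow>\<^sub>L (real^'n))"
  assumes X: "\<And>j. C1_on \<Omega> (closure \<Omega>) (vfield \<sigma> j)" and s: "\<And>j. C1_on \<Omega> (closure \<Omega>) (s j)"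
    and sub: "cball x \<rho> \<subseteq> \<Omega>"
  obtains L where "0 \<le> L"
    "\<And>y z \<xi>. y \<in> cball x \<rho> \<Longrightarrow> z \<in> cball x \<rho> \<Longrightarrow> norm (\<sigma> y *v \<xi> - \<sigma> z *v \<xi>) \<le> L * norm (y - z) * norm \<xi>"
    "\<And>y \<xi>. y \<in> cball x \<rho> \<Longrightarrow> norm (\<sigma> y *v \<xi>) \<le> L * norm \<xi>"
    "\<And>y z \<xi>. y \<in> cball x \<rho> \<Longrightarrow> z \<in> cball x \<rho> \<Longrightarrow>
       norm (X_sym_deriv \<sigma> s y \<xi> - X_sym_deriv \<sigma> s z \<xi>) \<le> L * norm (y - z) * (norm \<xi>)\<^sup>2"
    "\<And>y \<xi>. y \<in> cball x \<rho> \<Longrightarrow> norm (X_sym_deriv \<sigma> s y \<xi>) \<le> L * (norm \<xi>)\<^sup>2"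
proof -
  let ?B = "cball x \<rho>"
  have sub2: "\<Omega> \<subseteq> closure \<Omega>" by (rule closure_subset)
  have "\<forall>j. \<exists>L\<ge>0. (\<forall>y\<in>?B. \<forall>z\<in>?B. norm (vfield \<sigma> j y - vfield \<sigma> j z) \<le> L * norm (y - z)) \<and> (\<forall>y\<in>?B. norm (vfield \<sigma> j y) \<le> L)"
    using C1_on_lipschitz_cball[OF X sub sub2] by metis
  then obtain LX where LX: "\<And>j. 0 \<le> LX j" "\<And>j y z. y \<in> ?B \<Longrightarrow> z \<in> ?B \<Longrightarrow> norm (vfield \<sigma> j y - vfield \<sigma> j z) \<le> LX j * norm (y - z)"
    "\<And>j y. y \<in> ?B \<Longrightarrow> norm (vfield \<sigma> j y) \<le> LX j"
    by metis
  have "\<forall>j. \<exists>L\<ge>0. (\<forall>y\<in>?B. \<forall>z\<in>?B. norm (s j y - s j z) \<le> L * norm (y - z)) \<and> (\<forall>y\<in>?B. norm (s j y) \<le> L)"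
    using C1_on_lipschitz_cball[OF s sub sub2] by metis
  then obtain Ls where Ls: "\<And>j. 0 \<le> Ls j" "\<And>j y z. y \<in> ?B \<Longrightarrow> z \<in> ?B \<Longrightarrow> norm (s j y - s j z) \<le> Ls j * norm (y - z)"
    "\<And>j y. y \<in> ?B \<Longrightarrow> norm (s j y) \<le> Ls j"
    by metis
  define M where "M = (\<Sum>j\<in>UNIV. LX j + Ls j)"
  have M0: "0 \<le> M" using LX(1) Ls(1) by (auto simp: M_def intro!: sum_nonneg)
  have M: "LX j \<le> M" "Ls j \<le> M" for j
  proof -
    have "LX j + Ls j \<le> M"
      unfolding M_def using LX(1) Ls(1) by (intro member_le_sum) auto
    then show "LX j \<le> M" "Ls j \<le> M" using LX(1)[of j] Ls(1)[of j] by linarith+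
  qed
  have Xl: "norm (vfield \<sigma> j y - vfield \<sigma> j z) \<le> M * norm (y - z)" if "y \<in> ?B" "z \<in> ?B" for j y z
    using LX(2)[OF that, of j] mult_right_mono[OF M(1)[of j], of "norm (y - z)"] by simp
  have Xb: "norm (vfield \<sigma> j y) \<le> M" if "y \<in> ?B" for j y
    using LX(3)[OF that, of j] M(1)[of j] by simp
  have sl: "norm (s j y - s j z) \<le> M * norm (y - z)" if "y \<in> ?B" "z \<in> ?B" for j y z
    using Ls(2)[OF that, of j] mult_right_mono[OF M(2)[of j], of "norm (y - z)"] by simp
  have sb: "norm (s j y) \<le> M" if "y \<in> ?B" for j y
    using Ls(3)[OF that, of j] M(2)[of j] by simp
  have nb: "norm (s j y (vfield \<sigma> i y)) \<le> M * M" if "y \<in> ?B" for i j y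
    using norm_blinfun[of "s j y" "vfield \<sigma> i y"] mult_mono[OF sb[OF that] Xb[OF that] M0 norm_ge_zero, of j i] by linarith
  have nl: "norm (s j y (vfield \<sigma> i y) - s j z (vfield \<sigma> i z)) \<le> 2 * M * M * norm (y - z)" if y: "y \<in> ?B" and z: "z \<in> ?B" for i j y z
  proof -
    have e: "s j y (vfield \<sigma> i y) - s j z (vfield \<sigma> i z) = (s j y - s j z) (vfield \<sigma> i y) + s j z (vfield \<sigma> i y - vfield \<sigma> i z)"
      by (simp add: blinfun.diff_left blinfun.diff_right)
    have "norm ((s j y - s j z) (vfield \<sigma> i y)) \<le> M * norm (y - z) * M"
      using norm_blinfun[of "s j y - s j z" "vfield \<sigma> i y"] mult_mono[OF sl[OF y z, of j] Xb[OF y, of i]] M0 by fastforce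
    moreover have "norm (s j z (vfield \<sigma> i y - vfield \<sigma> i z)) \<le> M * (M * norm (y - z))"
      using norm_blinfun[of "s j z" "vfield \<sigma> i y - vfield \<sigma> i z"] mult_mono[OF sb[OF z, of j] Xl[OF y z, of i]] M0 by fastforce
    ultimately show ?thesis
      unfolding e using norm_triangle_ineq[of "(s j y - s j z) (vfield \<sigma> i y)" "s j z (vfield \<sigma> i y - vfield \<sigma> i z)"] by (simp add: algebra_simps)
  qed
  define c where "c = real CARD('m)"
  have c0: "0 \<le> c" by (simp add: c_def)
  have one: "norm (\<Sum>j\<in>UNIV. (\<xi> $ j) *\<^sub>R v j) \<le> c * D * norm \<xi>" if "\<And>j. norm (v j) \<le> D"
    for v :: "'m \<Rightarrow> real^'n" and D and \<xi> :: "real^'m"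
  proof -
    have "norm (\<Sum>j\<in>UNIV. (\<xi> $ j) *\<^sub>R v j) \<le> (\<Sum>j::'m\<in>UNIV. norm \<xi> * D)"
    proof (rule sum_norm_le)
      fix j
      show "norm ((\<xi> $ j) *\<^sub>R v j) \<le> norm \<xi> * D"
        using component_le_norm_cart[of \<xi> j] that[of j] by (auto intro!: mult_mono)
    qed
    then show ?thesis by (simp add: c_def mult_ac)
  qed
  have two: "norm (\<Sum>i\<in>UNIV. \<Sum>j\<in>UNIV. (\<xi> $ i * \<xi> $ j) *\<^sub>R v i j) \<le> c * c * D * (norm \<xi>)\<^sup>2" if "\<And>i j. norm (v i j) \<le> D"
    for v :: "'m \<Rightarrow> 'm \<Rightarrow> real^'n" and D and \<xi> :: "real^'m"
  proof -
    have "(\<Sum>i\<in>UNIV. \<Sum>j\<in>UNIV. (\<xi> $ i * \<xi> $ j) *\<^sub>R v i j) = (\<Sum>i\<in>UNIV. \<xi> $ i *\<^sub>R (\<Sum>j\<in>UNIV. \<xi> $ j *\<^sub>R v i j))"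
      by (simp add: scaleR_sum_right)
    moreover have "norm (\<Sum>i\<in>UNIV. \<xi> $ i *\<^sub>R (\<Sum>j\<in>UNIV. \<xi> $ j *\<^sub>R v i j)) \<le> c * (c * D * norm \<xi>) * norm \<xi>"
      by (rule one, rule one, rule that)
    ultimately show ?thesis by (simp add: power2_eq_square mult_ac)
  qed
  \<comment> \<open>One constant for all four bounds: \<open>c * M\<close> serves the terms linear
    in \<xi>, \<open>c * c * M * M\<close> the quadratic ones, and the factor \<open>2\<close> comes
    from splitting the difference of the products of \<open>s j\<close> with the fields.\<close>
  define L where "L = c * M + 2 * (c * c * M * M)"
  have L: "c * M \<le> L" "2 * (c * c * M * M) \<le> L" "c * c * M * M \<le> L"
    using c0 M0 by (auto simp: L_def)
  show thesis
  proof (rule that[of L])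
    show "0 \<le> L" using c0 M0 by (auto simp: L_def)
    show "norm (\<sigma> y *v \<xi> - \<sigma> z *v \<xi>) \<le> L * norm (y - z) * norm \<xi>" if y: "y \<in> ?B" and z: "z \<in> ?B" for y z \<xi>
    proof -
      have "\<sigma> y *v \<xi> - \<sigma> z *v \<xi> = (\<Sum>j\<in>UNIV. (\<xi> $ j) *\<^sub>R (vfield \<sigma> j y - vfield \<sigma> j z))"
        unfolding matrix_vector_mult_vfield by (simp add: sum_subtractf[symmetric] scaleR_diff_right)
      also have "norm \<dots> \<le> c * (M * norm (y - z)) * norm \<xi>"
        by (rule one, rule Xl[OF y z])
      also have "\<dots> = (c * M) * (norm (y - z) * norm \<xi>)" by simp
      also have "\<dots> \<le> L * (norm (y - z) * norm \<xi>)" by (rule mult_right_mono[OF L(1)]) simp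
      finally show ?thesis by (simp add: mult.assoc)
    qed
    show "norm (\<sigma> y *v \<xi>) \<le> L * norm \<xi>" if y: "y \<in> ?B" for y \<xi>
    proof -
      have "norm (\<sigma> y *v \<xi>) \<le> c * M * norm \<xi>"
        unfolding matrix_vector_mult_vfield by (rule one, rule Xb[OF y])
      also have "\<dots> \<le> L * norm \<xi>" by (rule mult_right_mono[OF L(1)]) simp
      finally show ?thesis .
    qed
    show "norm (X_sym_deriv \<sigma> s y \<xi> - X_sym_deriv \<sigma> s z \<xi>) \<le> L * norm (y - z) * (norm \<xi>)\<^sup>2"
      if y: "y \<in> ?B" and z: "z \<in> ?B" for y z \<xi>
    proof -
      have "X_sym_deriv \<sigma> s y \<xi> - X_sym_deriv \<sigma> s z \<xi> =
        (\<Sum>i\<in>UNIV. \<Sum>j\<in>UNIV. (\<xi> $ i * \<xi> $ j) *\<^sub>R (s j y (vfield \<sigma> i y) - s j z (vfield \<sigma> i z)))"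
        unfolding X_sym_deriv_def by (simp add: sum_subtractf[symmetric] scaleR_diff_right)
      also have "norm \<dots> \<le> c * c * (2 * M * M * norm (y - z)) * (norm \<xi>)\<^sup>2"
        by (rule two, rule nl[OF y z])
      also have "\<dots> = (2 * (c * c * M * M)) * (norm (y - z) * (norm \<xi>)\<^sup>2)" by simp
      also have "\<dots> \<le> L * (norm (y - z) * (norm \<xi>)\<^sup>2)" by (rule mult_right_mono[OF L(2)]) simp
      finally show ?thesis by (simp add: mult.assoc)
    qed
    show "norm (X_sym_deriv \<sigma> s y \<xi>) \<le> L * (norm \<xi>)\<^sup>2" if y: "y \<in> ?B" for y \<xi>
    proof -
      have "norm (X_sym_deriv \<sigma> s y \<xi>) \<le> c * c * (M * M) * (norm \<xi>)\<^sup>2"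
        unfolding X_sym_deriv_def by (rule two, rule nb[OF y])
      also have "\<dots> = (c * c * M * M) * (norm \<xi>)\<^sup>2" by simp
      also have "\<dots> \<le> L * (norm \<xi>)\<^sup>2" by (rule mult_right_mono[OF L(3)]) simp
      finally show ?thesis .
    qed
  qed
qed

section \<open>A quadratic with uniformly positive X-Hessian\<close>

lemma jacobian_cl_mult:
  assumes "x \<in> \<Omega>" "(g has_derivative g') (at x)"
  shows "jacobian_cl \<Omega> g x *v v = g' v"
proof -
  have "jacobian_cl \<Omega> g x = matrix g'"
    using assms(1) by (simp add: jacobian_cl_def jacobian_def frechet_derivative_at[OF assms(2), symmetric])
  then show ?thesis
    using matrix_works[of g' v] has_derivative_linear[OF assms(2)] by simp
qed

text \<open>The right-hand side is the X-Hessian form of \<open>(x \<bullet> P x) / 2\<close>. For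
  Carnot type fields \<open>P\<close> keeps the coordinates in which \<sigma> is the identity. In
  the other case \<open>P\<close> is the identity and the bound is the assumption itself.\<close>

lemma X_elliptic_quadratic_exists:
  fixes \<sigma> :: "real^'n \<Rightarrow> real^'m^'n" and s :: "'m \<Rightarrow> real^'n \<Rightarrow> ((real^'n) \<Rightarrow>\<^sub>L (real^'n))"
  assumes \<Omega>: "open \<Omega>" and s: "\<And>j x. x \<in> \<Omega> \<Longrightarrow> (vfield \<sigma> j has_derivative blinfun_apply (s j x)) (at x)"
    and alt: "carnot_type \<Omega> \<sigma> \<or>
         (\<exists>\<eta>>0. \<forall>x\<in>closure \<Omega>.
            sym_le (\<eta> *\<^sub>R mat 1) (transpose (\<sigma> x) ** \<sigma> x + Q_mat \<Omega> \<sigma> x x))"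
  obtains P \<eta> where "bounded_linear P" "\<And>v w. P v \<bullet> w = v \<bullet> P w" "\<eta> > 0"
    "\<And>x \<xi>. x \<in> \<Omega> \<Longrightarrow> \<eta> * (norm \<xi>)\<^sup>2 \<le> (\<sigma> x *v \<xi>) \<bullet> P (\<sigma> x *v \<xi>) + P x \<bullet> X_sym_deriv \<sigma> s x \<xi>"
  using alt
proof (elim disjE exE conjE)
  assume "carnot_type \<Omega> \<sigma>"
  then obtain \<iota> :: "'m \<Rightarrow> 'n" where inj: "inj \<iota>"
    and row: "\<And>x i j. x \<in> closure \<Omega> \<Longrightarrow> \<sigma> x $ \<iota> i $ j = (mat 1 :: real^'m^'m) $ i $ j"
    unfolding carnot_type_def by blast
  define P where "P v = (\<chi> k. if k \<in> range \<iota> then v $ k else 0)" for v :: "real^'n"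
  show thesis
  proof (rule that[of P 1])
    show "bounded_linear P"
      unfolding linear_conv_bounded_linear[symmetric]
      by (rule linearI) (auto simp: P_def vec_eq_iff)
    show "P v \<bullet> w = v \<bullet> P w" for v w
      unfolding P_def inner_vec_def by (intro sum.cong) auto
    fix x \<xi> assume x: "x \<in> \<Omega>"
    then have xc: "x \<in> closure \<Omega>" using closure_subset by blast
    have comp: "(\<sigma> x *v \<xi>) $ \<iota> i = \<xi> $ i" for i
      by (simp add: matrix_vector_mult_def row[OF xc] mat_def if_distrib[of "\<lambda>a. a * _"] cong: if_cong)
    have "(\<sigma> x *v \<xi>) \<bullet> P (\<sigma> x *v \<xi>) = (\<Sum>k\<in>UNIV. if k \<in> range \<iota> then ((\<sigma> x *v \<xi>) $ k)\<^sup>2 else 0)"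
      unfolding P_def inner_vec_def by (intro sum.cong) (auto simp: power2_eq_square)
    also have "\<dots> = (\<Sum>k\<in>range \<iota>. ((\<sigma> x *v \<xi>) $ k)\<^sup>2)"
      by (simp add: sum.If_cases)
    also have "\<dots> = (\<Sum>i\<in>UNIV. (\<xi> $ i)\<^sup>2)"
      by (simp add: sum.reindex[OF inj] comp)
    also have "\<dots> = (norm \<xi>)\<^sup>2"
      unfolding power2_norm_eq_inner inner_vec_def by (simp add: power2_eq_square)
    finally have 1: "(\<sigma> x *v \<xi>) \<bullet> P (\<sigma> x *v \<xi>) = (norm \<xi>)\<^sup>2" .
    \<comment> \<open>The fields have constant components in these coordinates, so their derivatives
      vanish there and \<open>P x\<close> is orthogonal to the first order term.\<close>
    have s0: "s j x v $ \<iota> i = 0" for i j v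
    proof -
      have "((\<lambda>y. vfield \<sigma> j y $ \<iota> i) has_derivative (\<lambda>v. s j x v $ \<iota> i)) (at x)"
        by (rule bounded_linear.has_derivative[OF bounded_linear_vec_nth s[OF x]])
      moreover have "((\<lambda>y. vfield \<sigma> j y $ \<iota> i) has_derivative (\<lambda>v. 0)) (at x)"
      proof (rule has_derivative_transform_within_open[OF _ \<Omega> x])
        show "((\<lambda>y. (mat 1 :: real^'m^'m) $ i $ j) has_derivative (\<lambda>v. 0)) (at x)" by simp
        show "(mat 1 :: real^'m^'m) $ i $ j = vfield \<sigma> j y $ \<iota> i" if "y \<in> \<Omega>" for y
          using row[of y i j] subsetD[OF closure_subset that] by (simp add: vfield_def column_def)
      qed
      ultimately have "(\<lambda>v. s j x v $ \<iota> i) = (\<lambda>v. 0)" by (rule has_derivative_unique)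
      then show ?thesis by meson
    qed
    have "X_sym_deriv \<sigma> s x \<xi> $ k = 0" if "k \<in> range \<iota>" for k
      using that s0 by (auto simp: X_sym_deriv_def sum_component)
    then have "P x \<bullet> X_sym_deriv \<sigma> s x \<xi> = 0"
      unfolding P_def inner_vec_def by (intro sum.neutral) auto
    with 1 show "1 * (norm \<xi>)\<^sup>2 \<le> (\<sigma> x *v \<xi>) \<bullet> P (\<sigma> x *v \<xi>) + P x \<bullet> X_sym_deriv \<sigma> s x \<xi>" by simp
  qed simp
next
  fix \<eta> :: real assume \<eta>: "0 < \<eta>" and le: "\<forall>x\<in>closure \<Omega>. sym_le (\<eta> *\<^sub>R mat 1) (transpose (\<sigma> x) ** \<sigma> x + Q_mat \<Omega> \<sigma> x x)"
  show thesis
  proof (rule that[of "\<lambda>v. v" \<eta>])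
    fix x \<xi> assume x: "x \<in> \<Omega>"
    then have xc: "x \<in> closure \<Omega>" using closure_subset by blast
    have "\<xi> \<bullet> (\<eta> *\<^sub>R mat 1 *v \<xi>) \<le> \<xi> \<bullet> ((transpose (\<sigma> x) ** \<sigma> x + Q_mat \<Omega> \<sigma> x x) *v \<xi>)"
      using le xc by (simp add: sym_le_def)
    moreover have "\<xi> \<bullet> (\<eta> *\<^sub>R mat 1 *v \<xi>) = \<eta> * (norm \<xi>)\<^sup>2"
      unfolding power2_norm_eq_inner by (simp add: scaleR_matrix_vector_assoc[symmetric])
    moreover have "\<xi> \<bullet> ((transpose (\<sigma> x) ** \<sigma> x) *v \<xi>) = (\<sigma> x *v \<xi>) \<bullet> (\<sigma> x *v \<xi>)"
      unfolding matrix_vector_mul_assoc[symmetric] by (simp only: inner_matrix_vector_mult transpose_transpose)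
    moreover have "\<xi> \<bullet> (Q_mat \<Omega> \<sigma> x x *v \<xi>) = x \<bullet> X_sym_deriv \<sigma> s x \<xi>"
    proof -
      define F where "F i j = s i x (vfield \<sigma> j x) \<bullet> x" for i j
      have "\<xi> \<bullet> (Q_mat \<Omega> \<sigma> x x *v \<xi>) = (\<Sum>i\<in>UNIV. \<Sum>j\<in>UNIV. \<xi> $ i * \<xi> $ j * ((F i j + F j i) / 2))"
        unfolding inner_matrix_form Q_mat_def
        by (simp add: jacobian_cl_mult[OF x s[OF x]] F_def inner_add_left add.commute)
      also have "\<dots> = (\<Sum>i\<in>UNIV. \<Sum>j\<in>UNIV. \<xi> $ i * \<xi> $ j * F i j)"
        by (rule sum_swap_symmetrize)
      also have "\<dots> = x \<bullet> X_sym_deriv \<sigma> s x \<xi>"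
        unfolding X_sym_deriv_def inner_sum_right
        by (subst sum.swap) (simp add: F_def mult.commute inner_commute)
      finally show ?thesis .
    qed
    ultimately show "\<eta> * (norm \<xi>)\<^sup>2 \<le> (\<sigma> x *v \<xi>) \<bullet> (\<sigma> x *v \<xi>) + x \<bullet> X_sym_deriv \<sigma> s x \<xi>"
      by (simp add: matrix_vector_mult_add_rdistrib inner_add_right)
  qed (use \<eta> in auto)
qed

section \<open>Doubling of variables\<close>

text \<open>Only the form \<open>h \<bullet> A h\<close> enters the expansions, so the derivative of
  the gradient may be replaced by its symmetric part without proving that it is symmetric.\<close>

lemma symmetric_part_exists:
  fixes A :: "'a::euclidean_space \<Rightarrow> 'a"
  assumes "bounded_linear A"
  obtains B where "bounded_linear B" "\<And>v w. B v \<bullet> w = v \<bullet> B w" "\<And>h. h \<bullet> B h = h \<bullet> A h"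
proof -
  have lin: "linear A" using assms by (simp add: linear_conv_bounded_linear)
  have adj: "bounded_linear (adjoint A)"
    using adjoint_linear[OF lin] by (simp add: linear_conv_bounded_linear)
  define B where "B v = (1/2) *\<^sub>R (A v + adjoint A v)" for v
  show thesis
  proof (rule that[of B])
    show "bounded_linear B"
      unfolding B_def by (intro bounded_linear_add[THEN bounded_linear_compose[OF bounded_linear_scaleR_right]] assms adj)
    show "B v \<bullet> w = v \<bullet> B w" for v w
      using adjoint_works[OF lin, of v w] adjoint_works[OF lin, of w v]
      by (simp add: B_def inner_add_left inner_add_right inner_commute)
    show "h \<bullet> B h = h \<bullet> A h" for h
      using adjoint_works[OF lin, of h h] by (simp add: B_def inner_add_right inner_commute)
  qed
qed

text \<open>The bound holds on all of \<open>S\<close> and its right-hand side is a polynomial in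
  \<open>y'\<close>, so it is itself a \<open>C^2\<close> test function touching \<open>u\<close>
  from above at \<open>y\<close>.\<close>

definition upper_jet :: "'a::real_inner set \<Rightarrow> ('a \<Rightarrow> real) \<Rightarrow> 'a \<Rightarrow> 'a \<Rightarrow> ('a \<Rightarrow> 'a) \<Rightarrow> real \<Rightarrow> bool" where
  "upper_jet S u y q C K \<longleftrightarrow> bounded_linear C \<and> (\<forall>v w. C v \<bullet> w = v \<bullet> C w) \<and>
     (\<forall>y'\<in>S. u y' \<le> u y + q \<bullet> (y' - y) + ((y' - y) \<bullet> C (y' - y)) / 2 + K * norm (y' - y) ^ 4)"

text \<open>
  \<open>C\<close> is the Hessian form \<open>v \<mapsto> min\<^sub>w (w \<bullet> A0 w + 2 e |w|\<^sup>2 + k |w - v|\<^sup>2)\<close>, attained at \<open>w = T v\<close>; the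
  test function is obtained by moving \<open>x\<close> by \<open>T (z' - z)\<close> when \<open>z\<close> moves to \<open>z'\<close>.
\<close>

lemma jet_transfer:
  fixes A0 :: "'a::euclidean_space \<Rightarrow> 'a"
  assumes J: "sup_conv_jet k S u x z A0" and pos: "k > 0" "e > 0"
  obtains C K where "upper_jet S u z (k *\<^sub>R (z - x)) C K"
    "\<And>v w. v \<bullet> C v \<le> w \<bullet> A0 w + 2 * e * (norm w)\<^sup>2 + k * (norm (w - v))\<^sup>2"
proof -
  have "bounded_linear A0" using J by (simp add: sup_conv_jet_def)
  then obtain A where A: "bounded_linear A" "\<And>v w. A v \<bullet> w = v \<bullet> A w" and A0: "\<And>h. h \<bullet> A0 h = h \<bullet> A h"
    using symmetric_part_exists by metis
  have lower: "- k * (norm h)\<^sup>2 \<le> h \<bullet> A h" for h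
    using J by (simp add: sup_conv_jet_def A0)
  obtain K where K: "K \<ge> 0" and jet: "\<And>h z'. z' \<in> S \<Longrightarrow> u z' - k / 2 * (norm (x + h - z'))\<^sup>2 \<le>
      u z - k / 2 * (norm (x - z))\<^sup>2 + k * ((z - x) \<bullet> h) + (h \<bullet> A h) / 2 + e * (norm h)\<^sup>2 + K * norm h ^ 4"
    using J pos(2) unfolding sup_conv_jet_def A0 by meson
  interpret A: bounded_linear A by fact
  \<comment> \<open>The minimiser \<open>w\<close> solves \<open>(A + 2 e + k) w = k v\<close>, that
    is \<open>B w = v\<close>. Since \<open>A\<close> is at least \<open>-k\<close>, the operator on
    the left is at least \<open>2 e\<close>, so \<open>B\<close> is invertible and its inverse is
    \<open>T\<close>.\<close>
  define B where "B v = v + (1 / k) *\<^sub>R (A v + (2 * e) *\<^sub>R v)" for v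
  have linB: "linear B"
    unfolding B_def by (rule linearI) (simp_all add: A.add A.scaleR algebra_simps)
  have symB: "B v \<bullet> w = v \<bullet> B w" for v w
    using A(2)[of v w] by (simp add: B_def inner_add_left inner_add_right)
  have kB: "k * (v \<bullet> B v) = k * (norm v)\<^sup>2 + v \<bullet> A v + 2 * e * (norm v)\<^sup>2" for v
    using pos(1) by (simp add: B_def inner_add_right power2_norm_eq_inner algebra_simps)
  have posB: "0 \<le> v \<bullet> B v" for v
  proof -
    have "0 \<le> 2 * e * (norm v)\<^sup>2" using pos(2) by simp
    then have "0 \<le> k * (v \<bullet> B v)" using kB[of v] lower[of v] by linarith
    then show ?thesis using pos(1) by (simp add: zero_le_mult_iff)
  qed
  have "inj B"
    unfolding linear_injective_0[OF linB]
  proof (intro allI impI)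
    fix v assume "B v = 0"
    then have "0 = k * (norm v)\<^sup>2 + v \<bullet> A v + 2 * e * (norm v)\<^sup>2" using kB[of v] by simp
    with lower[of v] have "2 * e * (norm v)\<^sup>2 \<le> 0" by linarith
    then show "v = 0" using pos(2) by (simp add: mult_le_0_iff)
  qed
  then obtain T where linT: "linear T" and TB: "\<And>v. T (B v) = v" and BT: "\<And>v. B (T v) = v"
    using linear_injective_isomorphism[OF linB] by blast
  have bT: "bounded_linear T" using linT by (simp add: linear_conv_bounded_linear)
  interpret T: bounded_linear T by fact
  have symT: "T v \<bullet> w = v \<bullet> T w" for v w
    using symB[of "T v" "T w"] by (simp add: BT)
  define C where "C v = k *\<^sub>R (v - T v)" for v
  have bC: "bounded_linear C"
    unfolding C_def by (intro bounded_linear_compose[OF bounded_linear_scaleR_right] bounded_linear_sub bounded_linear_ident bT)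
  have form: "w \<bullet> A w + 2 * e * (norm w)\<^sup>2 + k * (norm (w - v))\<^sup>2 = k * (w \<bullet> B w) - 2 * k * (w \<bullet> v) + k * (norm v)\<^sup>2" for v w
    unfolding kB norm_sq_diff by (simp add: algebra_simps)
  have formT: "T v \<bullet> A (T v) + 2 * e * (norm (T v))\<^sup>2 + k * (norm (T v - v))\<^sup>2 = v \<bullet> C v" for v
    unfolding form BT by (simp add: C_def inner_diff_right power2_norm_eq_inner inner_commute algebra_simps)
  obtain D where D: "D > 0" "\<And>v. norm (T v) \<le> norm v * D" using T.pos_bounded by blast
  show thesis
  proof (rule that[of C "K * D ^ 4"])
    show "v \<bullet> C v \<le> w \<bullet> A0 w + 2 * e * (norm w)\<^sup>2 + k * (norm (w - v))\<^sup>2" for v w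
    proof -
      interpret B: linear B by fact
      have "0 \<le> k * ((w - T v) \<bullet> B (w - T v))" using posB pos(1) by simp
      also have "\<dots> = k * (w \<bullet> B w) - 2 * k * (w \<bullet> v) + k * (T v \<bullet> v)"
        using symB[of "T v" w]
        by (simp add: B.diff BT inner_diff_left inner_diff_right inner_commute algebra_simps)
      finally show ?thesis
        unfolding A0 form C_def by (simp add: inner_diff_right power2_norm_eq_inner inner_commute algebra_simps)
    qed
    have "C v \<bullet> w = v \<bullet> C w" for v w
      using symT[of v w] by (simp add: C_def inner_diff_left inner_diff_right)
    moreover have "u z' \<le> u z + (k *\<^sub>R (z - x)) \<bullet> (z' - z) + ((z' - z) \<bullet> C (z' - z)) / 2 + K * D ^ 4 * norm (z' - z) ^ 4"
      if z': "z' \<in> S" for z'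
    proof -
    define v where "v = z' - z"
    have e1: "x + T v - z' = (x - z) + (T v - v)" by (simp add: v_def)
    have "u z' \<le> u z + k * ((z - x) \<bullet> T v) + (T v \<bullet> A (T v)) / 2 + e * (norm (T v))\<^sup>2 + K * norm (T v) ^ 4
        + k * ((x - z) \<bullet> (T v - v)) + k / 2 * (norm (T v - v))\<^sup>2"
      using jet[OF z', of "T v"] unfolding e1 norm_sq_add by (simp add: algebra_simps)
    also have "\<dots> = u z + k * ((z - x) \<bullet> v) + (v \<bullet> C v) / 2 + K * norm (T v) ^ 4"
      unfolding formT[of v, symmetric] by (simp add: inner_diff_left inner_diff_right field_simps)
    also have "\<dots> \<le> u z + k * ((z - x) \<bullet> v) + (v \<bullet> C v) / 2 + K * (norm v * D) ^ 4"
      using D K by (intro add_left_mono mult_left_mono power_mono) auto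
    finally show ?thesis
      by (simp add: v_def power_mult_distrib mult_ac)
    qed
    ultimately show "upper_jet S u z (k *\<^sub>R (z - x)) C (K * D ^ 4)"
      using bC by (simp add: upper_jet_def)
  qed
qed

text \<open>The same \<open>r\<close> bounds the slope and is the margin in both transfers. With a
  common \<open>w\<close> the forms of \<open>A1\<close> and \<open>A2\<close> cancel up to sign,
  and the two margins \<open>2 * r\<close> give \<open>4 * r\<close>.\<close>

lemma doubling_jets:
  fixes u1 u2 :: "'a::euclidean_space \<Rightarrow> real"
  assumes S: "compact S" "S \<noteq> {}" and usc: "usc_on S u1" "usc_on S u2" and k: "k > 0" and r: "r > 0"
  obtains x y z C1 K1 C2 K2 where "y \<in> S" "z \<in> S" "norm (k *\<^sub>R (y - x) + k *\<^sub>R (z - x)) \<le> r"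
    and "\<And>x0. x0 \<in> S \<Longrightarrow> u1 x0 + u2 x0 + k / 2 * ((norm (x - y))\<^sup>2 + (norm (x - z))\<^sup>2) \<le> u1 y + u2 z + r * norm (x - x0)"
    and "upper_jet S u1 y (k *\<^sub>R (y - x)) C1 K1" "upper_jet S u2 z (k *\<^sub>R (z - x)) C2 K2"
    and "\<And>v1 v2 w. v1 \<bullet> C1 v1 + v2 \<bullet> C2 v2 \<le> 4 * r * (norm w)\<^sup>2 + k * (norm (w - v1))\<^sup>2 + k * (norm (w - v2))\<^sup>2"
proof -
  obtain x y z p A1 A2 where yz: "y \<in> S" "z \<in> S" and p: "norm p \<le> r" "p = k *\<^sub>R (y - x) + k *\<^sub>R (z - x)"
    and max: "\<And>x' y' z'. y' \<in> S \<Longrightarrow> z' \<in> S \<Longrightarrow>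
      u1 y' - k / 2 * (norm (x' - y'))\<^sup>2 + (u2 z' - k / 2 * (norm (x' - z'))\<^sup>2) - p \<bullet> x' \<le>
      u1 y - k / 2 * (norm (x - y))\<^sup>2 + (u2 z - k / 2 * (norm (x - z))\<^sup>2) - p \<bullet> x"
    and J: "sup_conv_jet k S u1 x y A1" "sup_conv_jet k S u2 x z A2" and sum: "\<And>h. h \<bullet> A1 h + h \<bullet> A2 h \<le> 0"
    by (rule contact_point[OF S usc k r]) blast
  obtain C1 K1 where C1: "upper_jet S u1 y (k *\<^sub>R (y - x)) C1 K1"
    "\<And>v w. v \<bullet> C1 v \<le> w \<bullet> A1 w + 2 * r * (norm w)\<^sup>2 + k * (norm (w - v))\<^sup>2"
    using jet_transfer[OF J(1) k r] by blast
  obtain C2 K2 where C2: "upper_jet S u2 z (k *\<^sub>R (z - x)) C2 K2"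
    "\<And>v w. v \<bullet> C2 v \<le> w \<bullet> A2 w + 2 * r * (norm w)\<^sup>2 + k * (norm (w - v))\<^sup>2"
    using jet_transfer[OF J(2) k r] by blast
  show thesis
  proof (rule that[of y z x C1 K1 C2 K2])
    show "y \<in> S" "z \<in> S" by fact+
    show "norm (k *\<^sub>R (y - x) + k *\<^sub>R (z - x)) \<le> r" using p by simp
    show "u1 x0 + u2 x0 + k / 2 * ((norm (x - y))\<^sup>2 + (norm (x - z))\<^sup>2) \<le> u1 y + u2 z + r * norm (x - x0)"
      if "x0 \<in> S" for x0
    proof -
      have "- (p \<bullet> (x - x0)) \<le> norm p * norm (x - x0)"
        using norm_cauchy_schwarz[of "- p" "x - x0"] by simp
      also have "\<dots> \<le> r * norm (x - x0)" using p(1) by (intro mult_right_mono) auto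
      finally show ?thesis
        using max[OF that that, of x0] by (simp add: inner_diff_right distrib_left)
    qed
    show "upper_jet S u1 y (k *\<^sub>R (y - x)) C1 K1" "upper_jet S u2 z (k *\<^sub>R (z - x)) C2 K2"
      by fact+
    show "v1 \<bullet> C1 v1 + v2 \<bullet> C2 v2 \<le> 4 * r * (norm w)\<^sup>2 + k * (norm (w - v1))\<^sup>2 + k * (norm (w - v2))\<^sup>2" for v1 v2 w
      using C1(2)[of v1 w] C2(2)[of v2 w] sum[of w] by simp
  qed
qed

section \<open>Passing to the limit in the penalisation\<close>

text \<open>Collects what the limit provides at precision \<open>e\<close>. There is no bound on
  \<open>k\<close> or on \<open>q1\<close>; only their products with powers of
  \<open>|y - z|\<close> are small, as needed against Lipschitz coefficients.\<close>

definition opposite_jets :: "'a::real_inner set \<Rightarrow> ('a \<Rightarrow> real) \<Rightarrow> ('a \<Rightarrow> real) \<Rightarrow> 'a \<Rightarrow> real \<Rightarrow> bool" where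
  "opposite_jets S u1 u2 a e \<longleftrightarrow> (\<exists>y\<in>S. \<exists>z\<in>S. \<exists>q1 q2 C1 K1 C2 K2 k. 0 \<le> k \<and> dist y a < e \<and> dist z a < e \<and>
      norm (q1 + q2) \<le> e \<and> norm q1 * norm (y - z) \<le> e \<and> k * (norm (y - z))\<^sup>2 \<le> e \<and>
      upper_jet S u1 y q1 C1 K1 \<and> upper_jet S u2 z q2 C2 K2 \<and>
      (\<forall>v1 v2. v1 \<bullet> C1 v1 + v2 \<bullet> C2 v2 \<le> e * (norm v1)\<^sup>2 + k * (norm (v1 - v2))\<^sup>2))"

text \<open>Comparison with a maximum point bounds the penalty, so \<open>Y\<close> and
  \<open>Z\<close> have a common limit \<open>a\<close> along a subsequence. Semicontinuity then
  makes \<open>a\<close> a maximum point and leaves no room for a penalty that does not tend to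
  zero.\<close>

lemma doubling_limit:
  fixes u1 u2 :: "'a::euclidean_space \<Rightarrow> real"
  assumes S: "compact S" "S \<noteq> {}" and usc: "usc_on S u1" "usc_on S u2"
  obtains a where "a \<in> S" "\<And>x. x \<in> S \<Longrightarrow> u1 x + u2 x \<le> u1 a + u2 a"
    and "\<And>e. e > 0 \<Longrightarrow> opposite_jets S u1 u2 a e"
proof -
  define k where "k n = real n + 1" for n :: nat
  define r where "r n = 1 / (real n + 1)" for n :: nat
  have k: "k n > 0" "k n \<ge> 1" and r: "r n > 0" "r n \<le> 1" for n by (auto simp: k_def r_def)
  have r0: "r \<longlonglongrightarrow> 0"
    using LIMSEQ_inverse_real_of_nat unfolding r_def by (simp add: inverse_eq_divide add.commute)
  define J where "J n x y z \<longleftrightarrow> (\<exists>C1 K1 C2 K2. upper_jet S u1 y (k n *\<^sub>R (y - x)) C1 K1 \<and> upper_jet S u2 z (k n *\<^sub>R (z - x)) C2 K2 \<and>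
    (\<forall>v1 v2 w. v1 \<bullet> C1 v1 + v2 \<bullet> C2 v2 \<le> 4 * r n * (norm w)\<^sup>2 + k n * (norm (w - v1))\<^sup>2 + k n * (norm (w - v2))\<^sup>2))" for n x y z
  have "\<forall>n. \<exists>x y z. y \<in> S \<and> z \<in> S \<and> norm (k n *\<^sub>R (y - x) + k n *\<^sub>R (z - x)) \<le> r n \<and>
    (\<forall>x0\<in>S. u1 x0 + u2 x0 + k n / 2 * ((norm (x - y))\<^sup>2 + (norm (x - z))\<^sup>2) \<le> u1 y + u2 z + r n * norm (x - x0)) \<and> J n x y z"
  proof
    fix n
    obtain x y z C1 K1 C2 K2 where *: "y \<in> S" "z \<in> S" "norm (k n *\<^sub>R (y - x) + k n *\<^sub>R (z - x)) \<le> r n"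
      "\<And>x0. x0 \<in> S \<Longrightarrow> u1 x0 + u2 x0 + k n / 2 * ((norm (x - y))\<^sup>2 + (norm (x - z))\<^sup>2) \<le> u1 y + u2 z + r n * norm (x - x0)"
      "upper_jet S u1 y (k n *\<^sub>R (y - x)) C1 K1" "upper_jet S u2 z (k n *\<^sub>R (z - x)) C2 K2"
      "\<And>v1 v2 w. v1 \<bullet> C1 v1 + v2 \<bullet> C2 v2 \<le> 4 * r n * (norm w)\<^sup>2 + k n * (norm (w - v1))\<^sup>2 + k n * (norm (w - v2))\<^sup>2"
      by (rule doubling_jets[OF S usc k(1) r(1), of n n]) blast
    have "J n x y z" unfolding J_def using *(5-7) by blast
    with *(1-4) show "\<exists>x y z. y \<in> S \<and> z \<in> S \<and> norm (k n *\<^sub>R (y - x) + k n *\<^sub>R (z - x)) \<le> r n \<and>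
      (\<forall>x0\<in>S. u1 x0 + u2 x0 + k n / 2 * ((norm (x - y))\<^sup>2 + (norm (x - z))\<^sup>2) \<le> u1 y + u2 z + r n * norm (x - x0)) \<and> J n x y z"
      by blast
  qed
  then obtain X Y Z where Y: "\<And>n. Y n \<in> S" and Z: "\<And>n. Z n \<in> S"
    and q: "\<And>n. norm (k n *\<^sub>R (Y n - X n) + k n *\<^sub>R (Z n - X n)) \<le> r n"
    and max: "\<And>n x0. x0 \<in> S \<Longrightarrow> u1 x0 + u2 x0 + k n / 2 * ((norm (X n - Y n))\<^sup>2 + (norm (X n - Z n))\<^sup>2) \<le> u1 (Y n) + u2 (Z n) + r n * norm (X n - x0)"
    and J: "\<And>n. J n (X n) (Y n) (Z n)"
    by metis
  define \<delta> where "\<delta> n = k n * ((norm (X n - Y n))\<^sup>2 + (norm (X n - Z n))\<^sup>2)" for n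
  have \<delta>0: "0 \<le> \<delta> n" for n using k(1)[of n] by (simp add: \<delta>_def)
  obtain R where R: "\<And>y. y \<in> S \<Longrightarrow> norm y \<le> R" using compact_imp_bounded[OF S(1)] by (auto simp: bounded_iff)
  \<comment> \<open>The points \<open>X n\<close> are not confined to \<open>S\<close>, but
    smallness of the summed gradients keeps them near the midpoint of \<open>Y n\<close> and
    \<open>Z n\<close>.\<close>
  have Xb: "norm (X n - x0) \<le> 2 * R + 1" if "x0 \<in> S" for n x0
  proof -
    define w where "w = Y n + Z n - 2 *\<^sub>R X n"
    have "k n *\<^sub>R (Y n - X n) + k n *\<^sub>R (Z n - X n) = k n *\<^sub>R w"
      by (simp add: w_def algebra_simps scaleR_2)
    then have "k n * norm w \<le> 1" using q[of n] r(2)[of n] k(1)[of n] by simp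
    moreover have "1 * norm w \<le> k n * norm w" by (intro mult_right_mono k(2)) auto
    ultimately have w: "norm w \<le> 1" by simp
    have "X n - x0 = (1/2) *\<^sub>R (Y n + Z n - w) - x0" by (simp add: w_def)
    also have "norm \<dots> \<le> norm ((1/2) *\<^sub>R (Y n + Z n - w)) + norm x0" by (rule norm_triangle_ineq4)
    also have "norm ((1/2) *\<^sub>R (Y n + Z n - w)) \<le> 1 / 2 * (R + R + 1)"
      using norm_triangle_ineq4[of "Y n + Z n" w] norm_triangle_ineq[of "Y n" "Z n"] R[OF Y[of n]] R[OF Z[of n]] w
      by simp
    finally show ?thesis using R[OF that] by (simp add: field_simps)
  qed
  obtain x0 where x0: "x0 \<in> S" "\<And>x. x \<in> S \<Longrightarrow> u1 x + u2 x \<le> u1 x0 + u2 x0"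
    using usc_on_attains_max[OF S usc_on_add[OF usc]] by blast
  define M where "M = u1 x0 + u2 x0"
  have main: "M + \<delta> n / 2 \<le> u1 (Y n) + u2 (Z n) + r n * (2 * R + 1)" for n
    using max[OF x0(1), of n] mult_left_mono[OF Xb[OF x0(1)] less_imp_le[OF r(1)], of n n] by (simp add: M_def \<delta>_def)
  have R0: "0 \<le> 2 * R + 1" using Xb[OF x0(1), of 0] norm_ge_zero order_trans by blast
  obtain b1 b2 where b: "\<And>x. x \<in> S \<Longrightarrow> u1 x \<le> u1 b1" "\<And>x. x \<in> S \<Longrightarrow> u2 x \<le> u2 b2"
    using usc_on_attains_max[OF S usc(1)] usc_on_attains_max[OF S usc(2)] by metis
  define E where "E = 2 * (u1 b1 + u2 b2 + (2 * R + 1) - M)"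
  have \<delta>E: "\<delta> n \<le> E" for n
    using main[of n] b(1)[OF Y, of n] b(2)[OF Z, of n] mult_right_mono[OF r(2) R0, of n] by (simp add: E_def)
  obtain a s where a: "a \<in> S" "strict_mono s" and Ya: "(\<lambda>j. Y (s j)) \<longlonglongrightarrow> a"
    using S(1) Y unfolding compact_def o_def by metis
  have YZ: "k n * (norm (Y n - Z n))\<^sup>2 \<le> 2 * \<delta> n" for n
  proof -
    have "(norm (Y n - Z n))\<^sup>2 \<le> (norm (X n - Y n) + norm (X n - Z n))\<^sup>2"
      using norm_triangle_ineq4[of "X n - Z n" "X n - Y n"] by (intro power_mono) auto
    also have "\<dots> \<le> 2 * ((norm (X n - Y n))\<^sup>2 + (norm (X n - Z n))\<^sup>2)"
      using sum_squares_bound[of "norm (X n - Y n)" "norm (X n - Z n)"] by (simp add: power2_sum)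
    finally have "k n * (norm (Y n - Z n))\<^sup>2 \<le> k n * (2 * ((norm (X n - Y n))\<^sup>2 + (norm (X n - Z n))\<^sup>2))"
      using k(1)[of n] by (intro mult_left_mono) auto
    then show ?thesis by (simp add: \<delta>_def mult_ac)
  qed
  have s_r: "(\<lambda>j. r (s j)) \<longlonglongrightarrow> 0"
    using LIMSEQ_subseq_LIMSEQ[OF r0 a(2)] by (simp add: o_def)
  have "(\<lambda>j. Y (s j) - Z (s j)) \<longlonglongrightarrow> 0"
  proof -
    have bd: "(norm (Y n - Z n))\<^sup>2 \<le> r n * (2 * E)" for n
    proof -
      have "k n * (norm (Y n - Z n))\<^sup>2 \<le> 2 * E" using YZ[of n] \<delta>E[of n] by linarith
      then show ?thesis by (simp add: k_def r_def field_simps)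
    qed
    have "(\<lambda>j. (norm (Y (s j) - Z (s j)))\<^sup>2) \<longlonglongrightarrow> 0"
    proof (rule tendsto_sandwich[of "\<lambda>_. 0" _ _ "\<lambda>j. r (s j) * (2 * E)"])
      show "(\<lambda>j. r (s j) * (2 * E)) \<longlonglongrightarrow> 0"
        by (rule tendsto_mult_left_zero[OF s_r])
      show "\<forall>\<^sub>F j in sequentially. (norm (Y (s j) - Z (s j)))\<^sup>2 \<le> r (s j) * (2 * E)"
        using bd by simp
    qed simp_all
    then have "(\<lambda>j. sqrt ((norm (Y (s j) - Z (s j)))\<^sup>2)) \<longlonglongrightarrow> sqrt 0"
      by (rule tendsto_real_sqrt)
    then show ?thesis by (simp add: tendsto_norm_zero_iff)
  qed
  from tendsto_diff[OF Ya this] have Za: "(\<lambda>j. Z (s j)) \<longlonglongrightarrow> a" by simp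
  have usc_ev: "\<forall>\<^sub>F j in sequentially. u (W (s j)) < u a + e"
    if us: "usc_on S u" and e: "e > 0" and W: "\<And>n. W n \<in> S" "(\<lambda>j. W (s j)) \<longlonglongrightarrow> a" for u W and e :: real
  proof -
    have "u a < u a + e" using e by simp
    then obtain T where T: "open T" "a \<in> T" "\<forall>y\<in>S \<inter> T. u y < u a + e"
      using us a(1) unfolding usc_on_iff_open by meson
    have "\<forall>\<^sub>F j in sequentially. W (s j) \<in> T" using topological_tendstoD[OF W(2) T(1,2)] .
    then show ?thesis by eventually_elim (use T(3) W(1) in blast)
  qed
  have ev: "\<forall>\<^sub>F j in sequentially. M + \<delta> (s j) / 2 \<le> u1 a + u2 a + 3 * e" if "e > 0" for e
  proof -
    have "(\<lambda>j. r (s j) * (2 * R + 1)) \<longlonglongrightarrow> 0"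
      by (rule tendsto_mult_left_zero[OF s_r])
    from order_tendstoD(2)[OF this that]
    have "\<forall>\<^sub>F j in sequentially. r (s j) * (2 * R + 1) < e" .
    with usc_ev[OF usc(1) that Y Ya] usc_ev[OF usc(2) that Z Za] show ?thesis
    proof eventually_elim
      case (elim j)
      with main[of "s j"] show ?case by linarith
    qed
  qed
  have Ma: "M \<le> u1 a + u2 a"
  proof (rule field_le_epsilon)
    fix e :: real assume "e > 0"
    then have "e / 3 > 0" by simp
    from eventually_happens'[OF sequentially_bot ev[OF this]]
    obtain j where "M + \<delta> (s j) / 2 \<le> u1 a + u2 a + 3 * (e / 3)" by blast
    with \<delta>0[of "s j"] show "M \<le> u1 a + u2 a + e" by simp
  qed
  have maxa: "u1 x + u2 x \<le> u1 a + u2 a" if "x \<in> S" for x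
    using x0(2)[OF that] Ma by (simp add: M_def)
  have aM: "u1 a + u2 a \<le> M" using x0(2)[OF a(1)] by (simp add: M_def)
  show thesis
  proof (rule that[OF a(1) maxa])
    fix e :: real assume e: "e > 0"
    \<comment> \<open>Three errors of \<open>e / 12\<close> give half the penalty at most
      \<open>e / 4\<close>, so \<open>\<delta> n \<le> e / 2\<close>; this suffices because the
      products to be bounded by \<open>e\<close> are at most twice the penalty.\<close>
    have "e / 12 > 0" "e / 4 > 0" using e by auto
    have "\<forall>\<^sub>F j in sequentially. dist (Y (s j)) a < e" "\<forall>\<^sub>F j in sequentially. dist (Z (s j)) a < e"
      using tendstoD[OF Ya e] tendstoD[OF Za e] by auto
    with ev[OF \<open>e / 12 > 0\<close>] order_tendstoD(2)[OF s_r \<open>e / 4 > 0\<close>]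
    have "\<forall>\<^sub>F j in sequentially. dist (Y (s j)) a < e \<and> dist (Z (s j)) a < e \<and> r (s j) < e / 4 \<and> \<delta> (s j) \<le> e / 2"
    proof eventually_elim
      case (elim j)
      then show ?case using aM by linarith
    qed
    then obtain j where "dist (Y (s j)) a < e \<and> dist (Z (s j)) a < e \<and> r (s j) < e / 4 \<and> \<delta> (s j) \<le> e / 2"
      using eventually_happens'[OF sequentially_bot] by blast
    then obtain n where n: "dist (Y n) a < e" "dist (Z n) a < e" "r n < e / 4" "\<delta> n \<le> e / 2" by blast
    obtain C1 K1 C2 K2 where C: "upper_jet S u1 (Y n) (k n *\<^sub>R (Y n - X n)) C1 K1" "upper_jet S u2 (Z n) (k n *\<^sub>R (Z n - X n)) C2 K2"
      and form: "\<And>v1 v2 w. v1 \<bullet> C1 v1 + v2 \<bullet> C2 v2 \<le> 4 * r n * (norm w)\<^sup>2 + k n * (norm (w - v1))\<^sup>2 + k n * (norm (w - v2))\<^sup>2"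
      using J[of n] unfolding J_def by blast
    have "norm (k n *\<^sub>R (Y n - X n)) * norm (Y n - Z n) \<le> e"
    proof -
      have "norm (Y n - Z n) \<le> norm (X n - Y n) + norm (X n - Z n)"
        using norm_triangle_ineq4[of "X n - Z n" "X n - Y n"] by simp
      then have "norm (X n - Y n) * norm (Y n - Z n) \<le> norm (X n - Y n) * (norm (X n - Y n) + norm (X n - Z n))"
        by (intro mult_left_mono) auto
      also have "\<dots> \<le> 2 * ((norm (X n - Y n))\<^sup>2 + (norm (X n - Z n))\<^sup>2)"
        using sum_squares_bound[of "norm (X n - Y n)" "norm (X n - Z n)"]
          zero_le_power2[of "norm (X n - Y n)"] zero_le_power2[of "norm (X n - Z n)"]
        unfolding distrib_left power2_eq_square by linarith
      finally have "k n * (norm (X n - Y n) * norm (Y n - Z n)) \<le> k n * (2 * ((norm (X n - Y n))\<^sup>2 + (norm (X n - Z n))\<^sup>2))"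
        using k(1)[of n] by (intro mult_left_mono) auto
      moreover have "k n * (2 * ((norm (X n - Y n))\<^sup>2 + (norm (X n - Z n))\<^sup>2)) = 2 * \<delta> n"
        by (simp add: \<delta>_def)
      moreover have "norm (k n *\<^sub>R (Y n - X n)) * norm (Y n - Z n) = k n * (norm (X n - Y n) * norm (Y n - Z n))"
        using k(1)[of n] by (simp add: norm_minus_commute[of "Y n" "X n"])
      ultimately show ?thesis using n(4) by linarith
    qed
    moreover have "norm (k n *\<^sub>R (Y n - X n) + k n *\<^sub>R (Z n - X n)) \<le> e"
      using q[of n] n(3) e by linarith
    moreover have "k n * (norm (Y n - Z n))\<^sup>2 \<le> e"
      using YZ[of n] n(4) by linarith
    \<comment> \<open>The choice \<open>w = v1\<close> removes one of the two penalty terms.\<close>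
    moreover have "v1 \<bullet> C1 v1 + v2 \<bullet> C2 v2 \<le> e * (norm v1)\<^sup>2 + k n * (norm (v1 - v2))\<^sup>2" for v1 v2
    proof -
      have "4 * r n * (norm v1)\<^sup>2 \<le> e * (norm v1)\<^sup>2" using n(3) by (intro mult_right_mono) auto
      with form[of v1 v2 v1] show ?thesis by simp
    qed
    ultimately show "opposite_jets S u1 u2 a e"
      unfolding opposite_jets_def
      using Y[of n] Z[of n] n(1,2) C less_imp_le[OF k(1)[of n]] by blast
  qed
qed

section \<open>X-Hessians of the test functions at the touching points\<close>

text \<open>At its centre the quartic term has zero gradient and Hessian, so its coefficient is
  invisible to the equation, and the last term subtracts \<open>t\<close> times the X-Hessian of
  \<open>(x \<bullet> P x) / 2\<close>.\<close>

lemma test_poly_D2X_form: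
  fixes \<sigma> :: "real^'n \<Rightarrow> real^'m^'n" and s :: "'m \<Rightarrow> real^'n \<Rightarrow> ((real^'n) \<Rightarrow>\<^sub>L (real^'n))"
  assumes \<Omega>: "open \<Omega>" "y \<in> \<Omega>" and s: "\<And>j. (vfield \<sigma> j has_derivative s j y) (at y)"
    and A: "bounded_linear A" "\<And>v w. A v \<bullet> w = v \<bullet> A w"
    and P: "bounded_linear P" "\<And>v w. P v \<bullet> w = v \<bullet> P w"
  shows "\<xi> \<bullet> (D2X \<sigma> (test_poly q A K t P y) y *v \<xi>) =
    (\<sigma> y *v \<xi>) \<bullet> A (\<sigma> y *v \<xi>) + q \<bullet> X_sym_deriv \<sigma> s y \<xi>
     - t * ((\<sigma> y *v \<xi>) \<bullet> P (\<sigma> y *v \<xi>) + P y \<bullet> X_sym_deriv \<sigma> s y \<xi>)"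
proof -
  have "A 0 = 0" using A(1) by (rule linear_simps(3))
  moreover have "\<xi> \<bullet> (D2X \<sigma> (test_poly q A K t P y) y *v \<xi>) =
    (\<sigma> y *v \<xi>) \<bullet> test_poly_hess A K t P y y (\<sigma> y *v \<xi>) + test_poly_grad q A K t P y y \<bullet> X_sym_deriv \<sigma> s y \<xi>"
    by (rule D2X_quadratic_form[where \<gamma> = "test_poly_grad q A K t P y" and H = "test_poly_hess A K t P y y" and s = s])
       (rule \<Omega> s test_poly_has_derivative[OF A P] test_poly_grad_has_derivative[OF A P])+
  ultimately show ?thesis
    by (simp add: test_poly_hess_def test_poly_grad_def inner_diff_left inner_diff_right algebra_simps)
qed

lemma upper_jet_test_poly:
  assumes jet: "upper_jet S (\<lambda>x. u x + t * (x \<bullet> P x) / 2) y q C K" and "x \<in> S"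
  shows "u x - test_poly q C K t P y x \<le> u y - test_poly q C K t P y y"
proof -
  have "C 0 = 0" using jet linear_simps(3) by (auto simp: upper_jet_def)
  moreover have "norm (x - y) ^ 4 = ((x - y) \<bullet> (x - y))\<^sup>2"
    unfolding power2_norm_eq_inner[symmetric] by simp
  ultimately show ?thesis
    using jet \<open>x \<in> S\<close> unfolding upper_jet_def test_poly_def by fastforce
qed

lemma upper_jet_test_poly_below:
  assumes jet: "upper_jet S (\<lambda>x. - v x) y q C K" and "x \<in> S"
  shows "v y - test_poly (- q) (\<lambda>h. - C h) (- K) 0 P y y \<le> v x - test_poly (- q) (\<lambda>h. - C h) (- K) 0 P y x"
proof -
  have "C 0 = 0" using jet linear_simps(3) by (auto simp: upper_jet_def)
  moreover have "norm (x - y) ^ 4 = ((x - y) \<bullet> (x - y))\<^sup>2"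
    unfolding power2_norm_eq_inner[symmetric] by simp
  ultimately show ?thesis
    using jet \<open>x \<in> S\<close> unfolding upper_jet_def test_poly_def by fastforce
qed

section \<open>The comparison principle\<close>

lemma det_scaleR: "det (s *\<^sub>R V) = s ^ CARD('m) * det V" for V :: "real^'m^'m"
proof -
  have "(s *\<^sub>R mat 1) ** V = s *\<^sub>R V"
    by (simp add: scalar_matrix_assoc[symmetric])
  moreover have "s *\<^sub>R mat 1 = (diag_mat (\<lambda>_. s) :: real^'m^'m)"
    by (simp add: diag_mat_def mat_def vec_eq_iff)
  ultimately have "det (s *\<^sub>R V) = det (diag_mat (\<lambda>_. s) :: real^'m^'m) * det V"
    by (metis det_mul)
  then show ?thesis by (simp add: det_diag_mat)
qed

text \<open>The test function at \<open>y\<close> touches the unperturbed \<open>u\<close>, so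
  \<open>B\<close> obeys X-convexity and the subsolution inequality, while the jet of the perturbed
  function supplies the surplus \<open>c I\<close> in the comparison with \<open>V\<close>.\<close>

lemma no_interior_contact:
  fixes \<Omega> :: "(real^'n) set" and \<sigma> :: "real^'n \<Rightarrow> real^'m^'n" and u v f :: "real^'n \<Rightarrow> real"
    and s :: "'m \<Rightarrow> real^'n \<Rightarrow> ((real^'n) \<Rightarrow>\<^sub>L (real^'n))"
  assumes \<Omega>: "open \<Omega>" and a: "a \<in> \<Omega>"
    and X: "\<And>j. C1_on \<Omega> (closure \<Omega>) (vfield \<sigma> j)" and s1: "\<And>j. C1_on \<Omega> (closure \<Omega>) (s j)"
    and s: "\<And>j x. x \<in> \<Omega> \<Longrightarrow> (vfield \<sigma> j has_derivative blinfun_apply (s j x)) (at x)"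
    and P: "bounded_linear P" "\<And>v w. P v \<bullet> w = v \<bullet> P w" and \<eta>: "\<eta> > 0"
    and ell: "\<And>x \<xi>. x \<in> \<Omega> \<Longrightarrow> \<eta> * (norm \<xi>)\<^sup>2 \<le>
      (\<sigma> x *v \<xi>) \<bullet> P (\<sigma> x *v \<xi>) + P x \<bullet> X_sym_deriv \<sigma> s x \<xi>"
    and conv: "X_convex \<Omega> \<sigma> u" and f: "continuous_on (closure \<Omega>) f"
    and sub: "MA_subsolution \<Omega> \<sigma> f u" and super: "MA_supersolution \<Omega> \<sigma> f v" and \<theta>: "\<theta> > 0"
    and approx: "\<And>e. e > 0 \<Longrightarrow> 
      opposite_jets (closure \<Omega>) (\<lambda>x. u x + \<theta> * (x \<bullet> P x) / 2) (\<lambda>x. - v x) a e"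
  shows False
proof -
  obtain \<rho> where \<rho>: "\<rho> > 0" "cball a \<rho> \<subseteq> \<Omega>"
    using \<Omega> a by (auto simp: open_contains_cball)
  let ?N = "X_sym_deriv \<sigma> s"
  obtain L where L: "0 \<le> L"
    and L1: "\<And>y z \<xi>. y \<in> cball a \<rho> \<Longrightarrow> z \<in> cball a \<rho> \<Longrightarrow> norm (\<sigma> y *v \<xi> - \<sigma> z *v \<xi>) \<le> L * norm (y - z) * norm \<xi>"
    and L2: "\<And>y \<xi>. y \<in> cball a \<rho> \<Longrightarrow> norm (\<sigma> y *v \<xi>) \<le> L * norm \<xi>"
    and L3: "\<And>y z \<xi>. y \<in> cball a \<rho> \<Longrightarrow> z \<in> cball a \<rho> \<Longrightarrow> norm (?N y \<xi> - ?N z \<xi>) \<le> L * norm (y - z) * (norm \<xi>)\<^sup>2"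
    and L4: "\<And>y \<xi>. y \<in> cball a \<rho> \<Longrightarrow> norm (?N y \<xi>) \<le> L * (norm \<xi>)\<^sup>2"
    by (rule vfield_local_bounds[OF X s1 \<rho>(2)], rule that, assumption, (assumption | simp only:)+)
  define c where "c = \<theta> * \<eta>"
  have c: "c > 0" using \<theta> \<eta> by (simp add: c_def)
  \<comment> \<open>The error in comparing the X-Hessians: \<open>2 * L\<^sup>2\<close> collects the
    two terms from the jet forms, \<open>2 * L\<close> the two terms from the gradients.\<close>
  define \<omega> where "\<omega> e = (2 * L\<^sup>2 + 2 * L) * e" for e
  \<comment> \<open>The chain of determinant inequalities at precision \<open>e\<close> will end in
    \<open>c ^ CARD('m) < F e\<close>, whereas \<open>F\<close> tends to \<open>0\<close> as
    \<open>e\<close> does.\<close>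
  define F where "F e = (1 + 2 * \<omega> e / c) ^ CARD('m) * (f a + e) - (f a - e)" for e
  have "isCont F 0" "isCont \<omega> 0"
    unfolding F_def \<omega>_def using c by (auto intro!: continuous_intros)
  then have "(F \<longlongrightarrow> F 0) (at_right 0)" "(\<omega> \<longlongrightarrow> \<omega> 0) (at_right 0)"
    by (auto simp: isCont_def intro: tendsto_within_subset)
  then have "(F \<longlongrightarrow> 0) (at_right 0)" "(\<omega> \<longlongrightarrow> 0) (at_right 0)"
    by (simp_all add: F_def \<omega>_def)
  moreover have "0 < c ^ CARD('m)" "0 < c / 2" using c by auto
  ultimately have "\<forall>\<^sub>F e in at_right 0. F e < c ^ CARD('m)" "\<forall>\<^sub>F e in at_right 0. \<omega> e < c / 2"
    by (blast intro: order_tendstoD(2))+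
  then have "\<forall>\<^sub>F e in at_right 0. F e < c ^ CARD('m) \<and> \<omega> e < c / 2 \<and> (0::real) < e"
    using eventually_at_right_less[of "0::real"] by eventually_elim simp
  then obtain e where e: "F e < c ^ CARD('m)" "\<omega> e < c / 2" "0 < e"
    using eventually_happens'[of "at_right (0::real)"] by auto
  have ac: "a \<in> closure \<Omega>" using a closure_subset by blast
  obtain \<delta> where \<delta>: "\<delta> > 0" "\<And>y. y \<in> closure \<Omega> \<Longrightarrow> dist y a < \<delta> \<Longrightarrow> dist (f y) (f a) < e"
    using f ac e(3) unfolding continuous_on_iff by blast
  define d where "d = min e (min \<delta> \<rho>)"
  have d: "d > 0" "d \<le> e" "d \<le> \<delta>" "d \<le> \<rho>" using e(3) \<delta>(1) \<rho>(1) by (auto simp: d_def)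
  obtain y z q1 q2 C1 K1 C2 K2 k where y: "y \<in> closure \<Omega>" "dist y a < d" and z: "z \<in> closure \<Omega>" "dist z a < d"
    and k: "0 \<le> k" and q: "norm (q1 + q2) \<le> d" "norm q1 * norm (y - z) \<le> d" "k * (norm (y - z))\<^sup>2 \<le> d"
    and J1: "upper_jet (closure \<Omega>) (\<lambda>x. u x + \<theta> * (x \<bullet> P x) / 2) y q1 C1 K1"
    and J2: "upper_jet (closure \<Omega>) (\<lambda>x. - v x) z q2 C2 K2"
    and form: "\<And>v1 v2. v1 \<bullet> C1 v1 + v2 \<bullet> C2 v2 \<le> d * (norm v1)\<^sup>2 + k * (norm (v1 - v2))\<^sup>2"
    using approx[OF d(1)] unfolding opposite_jets_def by blast
  have yb: "y \<in> cball a \<rho>" and zb: "z \<in> cball a \<rho>" using y z d by (auto simp: dist_commute)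
  then have y\<Omega>: "y \<in> \<Omega>" and z\<Omega>: "z \<in> \<Omega>" using \<rho>(2) by auto
  have C1: "bounded_linear C1" "\<And>v w. C1 v \<bullet> w = v \<bullet> C1 w" using J1 by (auto simp: upper_jet_def)
  have C2: "bounded_linear C2" "\<And>v w. C2 v \<bullet> w = v \<bullet> C2 w" using J2 by (auto simp: upper_jet_def)
  have mC2: "bounded_linear (\<lambda>h. - C2 h)" "\<And>v w. - C2 v \<bullet> w = v \<bullet> - C2 w"
    using bounded_linear_minus[OF C2(1)] C2(2) by auto
  have Z: "bounded_linear (\<lambda>_::real^'n. 0 :: real^'n)" "\<And>v w :: real^'n. 0 \<bullet> w = v \<bullet> 0" by auto
  define \<phi> where "\<phi> = test_poly q1 C1 K1 \<theta> P y"
  define \<psi> where "\<psi> = test_poly (- q2) (\<lambda>h. - C2 h) (- K2) 0 (\<lambda>_. 0) z"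
  define B where "B = D2X \<sigma> \<phi> y"
  define V where "V = D2X \<sigma> \<psi> z"
  have \<phi>2: "C2_on \<Omega> S \<phi>" for S unfolding \<phi>_def by (rule C2_on_test_poly[OF C1 P])
  have \<psi>2: "C2_on \<Omega> S \<psi>" for S unfolding \<psi>_def by (rule C2_on_test_poly[OF mC2 Z])
  have touch_u: "u x - \<phi> x \<le> u y - \<phi> y" if "x \<in> closure \<Omega>" for x
    unfolding \<phi>_def by (rule upper_jet_test_poly[OF J1 that])
  have touch_v: "v z - \<psi> z \<le> v x - \<psi> x" if "x \<in> closure \<Omega>" for x
    unfolding \<psi>_def by (rule upper_jet_test_poly_below[OF J2 that])
  have symB: "sym_mat B" and symV: "sym_mat V" by (simp_all add: B_def V_def sym_mat_D2X)
  have touch_u': "\<forall>x\<in>\<Omega>. u x - \<phi> x \<le> u y - \<phi> y"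
    using touch_u subsetD[OF closure_subset] by blast
  have "sym_le 0 B"
    unfolding B_def by (rule conv[unfolded X_convex_def, rule_format, OF conjI[OF \<phi>2 conjI[OF y\<Omega> touch_u']]])
  then have B0: "0 \<le> \<xi> \<bullet> (B *v \<xi>)" for \<xi> by (simp add: sym_le_def)
  have touch_uc: "\<forall>x\<in>closure \<Omega>. u x - \<phi> x \<le> u y - \<phi> y"
    using touch_u by blast
  have detB: "f y \<le> det B"
    using sub[unfolded MA_subsolution_def, rule_format, OF conjI[OF \<phi>2 conjI[OF y\<Omega> touch_uc]]]
    by (simp add: B_def)
  have fB: "\<xi> \<bullet> (B *v \<xi>) = (\<sigma> y *v \<xi>) \<bullet> C1 (\<sigma> y *v \<xi>) + q1 \<bullet> ?N y \<xi> -
      \<theta> * ((\<sigma> y *v \<xi>) \<bullet> P (\<sigma> y *v \<xi>) + P y \<bullet> ?N y \<xi>)" for \<xi>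
    unfolding B_def \<phi>_def by (rule test_poly_D2X_form[where s = s and A = C1 and P = P, OF \<Omega> y\<Omega> s[OF y\<Omega>] C1 P])
  have fV: "\<xi> \<bullet> (V *v \<xi>) = - ((\<sigma> z *v \<xi>) \<bullet> C2 (\<sigma> z *v \<xi>)) - q2 \<bullet> ?N z \<xi>" for \<xi>
    unfolding V_def \<psi>_def
      test_poly_D2X_form[where s = s and A = "\<lambda>h. - C2 h" and P = "\<lambda>_. 0",
        OF \<Omega> z\<Omega> s[OF z\<Omega>] mC2 Z]
    by simp
  \<comment> \<open>The forms of the jets are evaluated at \<open>\<sigma> y *v \<xi>\<close> and
    \<open>\<sigma> z *v \<xi>\<close>. The gradient part is split into \<open>q1\<close> against a
    difference of first order terms, small by their Lipschitz bound, and \<open>q1 + q2\<close>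
    against a bounded term.\<close>
  have key: "\<xi> \<bullet> (B *v \<xi>) + c * (norm \<xi>)\<^sup>2 \<le> \<xi> \<bullet> (V *v \<xi>) + \<omega> e * (norm \<xi>)\<^sup>2" for \<xi>
  proof -
    let ?n = "(norm \<xi>)\<^sup>2"
    have t1: "c * ?n \<le> \<theta> * ((\<sigma> y *v \<xi>) \<bullet> P (\<sigma> y *v \<xi>) + P y \<bullet> ?N y \<xi>)"
      using mult_left_mono[OF ell[OF y\<Omega>, of \<xi>], of \<theta>] \<theta> by (simp add: c_def mult.assoc)
    have t2: "d * (norm (\<sigma> y *v \<xi>))\<^sup>2 \<le> d * L\<^sup>2 * ?n"
    proof -
      have "(norm (\<sigma> y *v \<xi>))\<^sup>2 \<le> (L * norm \<xi>)\<^sup>2" by (intro power_mono L2[OF yb]) auto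
      then have "d * (norm (\<sigma> y *v \<xi>))\<^sup>2 \<le> d * (L * norm \<xi>)\<^sup>2" using d(1) by (intro mult_left_mono) auto
      then show ?thesis by (simp add: power_mult_distrib mult.assoc)
    qed
    have t3: "k * (norm (\<sigma> y *v \<xi> - \<sigma> z *v \<xi>))\<^sup>2 \<le> d * L\<^sup>2 * ?n"
    proof -
      have "(norm (\<sigma> y *v \<xi> - \<sigma> z *v \<xi>))\<^sup>2 \<le> (L * norm (y - z) * norm \<xi>)\<^sup>2" by (intro power_mono L1[OF yb zb]) auto
      then have "k * (norm (\<sigma> y *v \<xi> - \<sigma> z *v \<xi>))\<^sup>2 \<le> k * (L * norm (y - z) * norm \<xi>)\<^sup>2" using k by (intro mult_left_mono) auto
      also have "\<dots> = (k * (norm (y - z))\<^sup>2) * (L\<^sup>2 * ?n)" by (simp add: power_mult_distrib)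
      also have "\<dots> \<le> d * (L\<^sup>2 * ?n)" by (rule mult_right_mono[OF q(3)]) simp
      finally show ?thesis by simp
    qed
    have t4: "q1 \<bullet> (?N y \<xi> - ?N z \<xi>) \<le> d * L * ?n"
    proof -
      have "q1 \<bullet> (?N y \<xi> - ?N z \<xi>) \<le> norm q1 * norm (?N y \<xi> - ?N z \<xi>)" by (rule norm_cauchy_schwarz)
      also have "\<dots> \<le> norm q1 * (L * norm (y - z) * ?n)" by (intro mult_left_mono L3[OF yb zb]) auto
      also have "\<dots> = (norm q1 * norm (y - z)) * (L * ?n)" by simp
      also have "\<dots> \<le> d * (L * ?n)" by (rule mult_right_mono[OF q(2)]) (simp add: L)
      finally show ?thesis by simp
    qed
    have t5: "(q1 + q2) \<bullet> ?N z \<xi> \<le> d * L * ?n"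
    proof -
      have "(q1 + q2) \<bullet> ?N z \<xi> \<le> norm (q1 + q2) * norm (?N z \<xi>)" by (rule norm_cauchy_schwarz)
      also have "\<dots> \<le> d * (L * ?n)" using d(1) by (intro mult_mono q(1) L4[OF zb]) auto
      finally show ?thesis by simp
    qed
    have "\<xi> \<bullet> (B *v \<xi>) + c * ?n - \<xi> \<bullet> (V *v \<xi>) \<le>
      ((\<sigma> y *v \<xi>) \<bullet> C1 (\<sigma> y *v \<xi>) + (\<sigma> z *v \<xi>) \<bullet> C2 (\<sigma> z *v \<xi>)) + (q1 \<bullet> (?N y \<xi> - ?N z \<xi>) + (q1 + q2) \<bullet> ?N z \<xi>)"
      unfolding fB fV using t1 by (simp add: inner_diff_right inner_add_left)
    also have "\<dots> \<le> (d * L\<^sup>2 * ?n + d * L\<^sup>2 * ?n) + (d * L * ?n + d * L * ?n)"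
      using form[of "\<sigma> y *v \<xi>" "\<sigma> z *v \<xi>"] t2 t3 t4 t5 by linarith
    also have "\<dots> = d * ((2 * L\<^sup>2 + 2 * L) * ?n)" by (simp add: algebra_simps)
    also have "\<dots> \<le> e * ((2 * L\<^sup>2 + 2 * L) * ?n)"
      using L by (intro mult_right_mono[OF d(2)]) auto
    also have "\<dots> = \<omega> e * ?n" by (simp add: \<omega>_def)
    finally show ?thesis by simp
  qed
  have \<omega>0: "0 \<le> \<omega> e" using L e(3) by (simp add: \<omega>_def)
  have V_ge: "c / 2 * (norm \<xi>)\<^sup>2 \<le> \<xi> \<bullet> (V *v \<xi>)" for \<xi>
  proof -
    have "\<omega> e * (norm \<xi>)\<^sup>2 \<le> c / 2 * (norm \<xi>)\<^sup>2" using e(2) by (intro mult_right_mono) auto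
    with key[of \<xi>] B0[of \<xi>] show ?thesis by simp
  qed
  have "pos_def V"
    unfolding pos_def_def
  proof (intro conjI symV allI impI)
    fix \<xi> :: "real^'m" assume "\<xi> \<noteq> 0"
    then have "0 < c / 2 * (norm \<xi>)\<^sup>2" using c by simp
    with V_ge[of \<xi>] show "0 < \<xi> \<bullet> (V *v \<xi>)" by linarith
  qed
  then have pV: "pos_def (D2X \<sigma> \<psi> z)" by (simp add: V_def)
  have touch_vc: "\<forall>x\<in>closure \<Omega>. v z - \<psi> z \<le> v x - \<psi> x"
    using touch_v by blast
  have detV: "det V \<le> f z"
    using super[unfolded MA_supersolution_def, rule_format, OF conjI[OF \<psi>2 conjI[OF z\<Omega> conjI[OF touch_vc pV]]]]
    by (simp add: V_def)
  \<comment> \<open>\<open>V\<close> has no upper bound, so the error is absorbed multiplicatively: \<open>V + \<omega> I \<le> t V\<close>\<close>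
  define t where "t = 1 + 2 * \<omega> e / c"
  have t: "t > 0" using \<omega>0 c by (simp add: t_def add_pos_nonneg)
  have formBc: "\<xi> \<bullet> ((B + c *\<^sub>R mat 1) *v \<xi>) = \<xi> \<bullet> (B *v \<xi>) + c * (norm \<xi>)\<^sup>2" for \<xi>
    unfolding power2_norm_eq_inner
    by (simp add: matrix_vector_mult_add_rdistrib inner_add_right scaleR_matrix_vector_assoc[symmetric])
  have "det (B + c *\<^sub>R mat 1) \<le> det (t *\<^sub>R V)"
  proof (rule det_mono_pos_def)
    have "transpose (B + c *\<^sub>R mat 1) = B + c *\<^sub>R mat 1"
      using symB by (auto simp: sym_mat_def transpose_def mat_def vec_eq_iff)
    then show "pos_def (B + c *\<^sub>R mat 1)"
      unfolding pos_def_def sym_mat_def formBc using B0 c by (auto intro: add_nonneg_pos)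
    show "sym_mat (t *\<^sub>R V)"
      using symV by (simp add: sym_mat_def transpose_def vec_eq_iff)
    fix \<xi> :: "real^'m"
    have "\<omega> e * (norm \<xi>)\<^sup>2 = 2 * \<omega> e / c * (c / 2 * (norm \<xi>)\<^sup>2)" using c by simp
    also have "\<dots> \<le> 2 * \<omega> e / c * (\<xi> \<bullet> (V *v \<xi>))"
      using \<omega>0 c by (intro mult_left_mono V_ge) auto
    finally have "\<xi> \<bullet> (B *v \<xi>) + c * (norm \<xi>)\<^sup>2 \<le> t * (\<xi> \<bullet> (V *v \<xi>))"
      using key[of \<xi>] by (simp add: t_def distrib_right)
    then show "\<xi> \<bullet> ((B + c *\<^sub>R mat 1) *v \<xi>) \<le> \<xi> \<bullet> ((t *\<^sub>R V) *v \<xi>)"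
      unfolding formBc by (simp add: scaleR_matrix_vector_assoc[symmetric])
  qed
  moreover have "det B + c ^ CARD('m) \<le> det (B + c *\<^sub>R mat 1)"
    using c by (intro det_add_scalar_ge symB B0) auto
  ultimately have "f y + c ^ CARD('m) \<le> t ^ CARD('m) * det V"
    using detB by (simp add: det_scaleR)
  also have "\<dots> \<le> t ^ CARD('m) * (f a + e)"
    using \<delta>(2)[OF z(1)] z(2) d(3) detV t by (intro mult_left_mono) (auto simp: dist_real_def)
  finally have "f y + c ^ CARD('m) \<le> t ^ CARD('m) * (f a + e)" .
  moreover have "f a - e < f y"
    using \<delta>(2)[OF y(1)] y(2) d(3) by (auto simp: dist_real_def)
  ultimately show False
    using e(1) by (simp add: F_def t_def)
qed

theorem corollary3p1:
  fixes \<Omega> :: "(real^'n) set"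
    and \<sigma> :: "real^'n \<Rightarrow> real^'m^'n"
    and u v f :: "real^'n \<Rightarrow> real"
  assumes "open \<Omega>" and "bounded \<Omega>" and "\<Omega> \<noteq> {}"
    and "CARD('m) \<le> CARD('n)"
    and "\<And>j. C2_on \<Omega> (closure \<Omega>) (vfield \<sigma> j)"
    and "carnot_type \<Omega> \<sigma> \<or>
         (\<exists>\<eta>>0. \<forall>x\<in>closure \<Omega>.
            sym_le (\<eta> *\<^sub>R mat 1) (transpose (\<sigma> x) ** \<sigma> x + Q_mat \<Omega> \<sigma> x x))"
    and "usc_on (closure \<Omega>) u" and "bounded (u ` closure \<Omega>)" and "X_convex \<Omega> \<sigma> u"
    and "lsc_on (closure \<Omega>) v" and "bounded (v ` closure \<Omega>)"
    and "continuous_on (closure \<Omega>) f" and "\<And>x. x \<in> closure \<Omega> \<Longrightarrow> 0 \<le> f x"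
    and "MA_subsolution \<Omega> \<sigma> f u" and "MA_supersolution \<Omega> \<sigma> f v"
  shows "\<exists>z\<in>frontier \<Omega>. (\<forall>y\<in>frontier \<Omega>. u y - v y \<le> u z - v z) \<and>
           (SUP x\<in>\<Omega>. u x - v x) \<le> u z - v z"
proof -
  note opn = assms(1) and bdd = assms(2) and ne = assms(3) and C2X = assms(5) and alt = assms(6)
  have cc: "compact (closure \<Omega>)" using bdd by simp
  have cne: "closure \<Omega> \<noteq> {}" using ne by simp
  have fsub: "frontier \<Omega> \<subseteq> closure \<Omega>" by (auto simp: frontier_def)
  have fc: "compact (frontier \<Omega>)" using bdd by (rule compact_frontier_bounded)
  have fne: "frontier \<Omega> \<noteq> {}"
    using ne bdd not_bounded_UNIV by (intro frontier_not_empty) auto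
  note vusc = usc_on_uminus_lsc[OF assms(10)]
  have uv: "usc_on (closure \<Omega>) (\<lambda>x. u x + - v x)"
    by (rule usc_on_add[OF assms(7) vusc])
  obtain z where z: "z \<in> frontier \<Omega>" "\<And>y. y \<in> frontier \<Omega> \<Longrightarrow> u y + - v y \<le> u z + - v z"
    using usc_on_attains_max[OF fc fne usc_on_compose[OF uv continuous_on_id, of "frontier \<Omega>"]] fsub by blast
  have "u x - v x \<le> u z - v z" if x: "x \<in> \<Omega>" for x
  proof (rule ccontr)
    assume "\<not> u x - v x \<le> u z - v z"
    then have gap: "0 < (u x - v x) - (u z - v z)" by simp
    obtain s where s: "\<And>j. C1_on \<Omega> (closure \<Omega>) (s j)"
      "\<And>j x. x \<in> \<Omega> \<Longrightarrow> (vfield \<sigma> j has_derivative blinfun_apply (s j x)) (at x)"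
      "\<And>j. C1_on \<Omega> (closure \<Omega>) (vfield \<sigma> j)"
      by (rule C2_on_obtain_derivative[where X = "vfield \<sigma>", OF C2X]) blast
    obtain P \<eta> where P: "bounded_linear P" "\<And>v w. P v \<bullet> w = v \<bullet> P w" and \<eta>: "\<eta> > 0"
      and ell: "\<And>x \<xi>. x \<in> \<Omega> \<Longrightarrow> \<eta> * (norm \<xi>)\<^sup>2 \<le>
        (\<sigma> x *v \<xi>) \<bullet> P (\<sigma> x *v \<xi>) + P x \<bullet> X_sym_deriv \<sigma> s x \<xi>"
      by (rule X_elliptic_quadratic_exists[where s = s, OF opn s(2) alt]) blast+
    have cP: "continuous_on (closure \<Omega>) (\<lambda>x. x \<bullet> P x)"
      by (intro continuous_intros linear_continuous_on P)
    then obtain W where W: "\<And>x. x \<in> closure \<Omega> \<Longrightarrow> \<bar>x \<bullet> P x\<bar> \<le> W"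
      using compact_imp_bounded[OF compact_continuous_image[OF _ cc]] by (fastforce simp: bounded_iff)
    define g where "g = (u x - v x) - (u z - v z)"
    \<comment> \<open>The perturbation changes the difference between the values at any two points
      by at most \<open>\<theta> * \<bar>W\<bar>\<close>, which is less than the gap
      \<open>g\<close>. Hence a maximum point of the perturbed difference cannot lie on the
      boundary.\<close>
    define \<theta> where "\<theta> = g / (\<bar>W\<bar> + 1)"
    have \<theta>: "\<theta> > 0" using gap by (simp add: \<theta>_def g_def)
    have \<theta>W: "\<theta> * \<bar>W\<bar> < g"
      using gap by (simp add: \<theta>_def g_def[symmetric] divide_less_eq)
    define u1 where "u1 y = u y + \<theta> * (y \<bullet> P y) / 2" for y
    have u1: "usc_on (closure \<Omega>) u1"
      unfolding u1_def by (intro usc_on_add assms(7) usc_on_continuous continuous_intros cP) auto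
    obtain a where a: "a \<in> closure \<Omega>" "\<And>y. y \<in> closure \<Omega> \<Longrightarrow> u1 y + - v y \<le> u1 a + - v a"
      and approx: "\<And>e. e > 0 \<Longrightarrow> opposite_jets (closure \<Omega>) u1 (\<lambda>x. - v x) a e"
      by (rule doubling_limit[OF cc cne u1 vusc]) blast
    have xc: "x \<in> closure \<Omega>" using x closure_subset by blast
    have "a \<in> \<Omega>"
    proof (rule ccontr)
      assume "a \<notin> \<Omega>"
      then have af: "a \<in> frontier \<Omega>"
        using a(1) opn by (simp add: frontier_def interior_open)
      have "\<bar>\<theta> * (a \<bullet> P a)\<bar> \<le> \<theta> * \<bar>W\<bar>" "\<bar>\<theta> * (x \<bullet> P x)\<bar> \<le> \<theta> * \<bar>W\<bar>"
        using \<theta> W[OF a(1)] W[OF xc] by (auto simp: abs_mult intro!: mult_left_mono)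
      with a(2)[OF xc] z(2)[OF af] \<theta>W show False
        by (simp add: u1_def g_def abs_le_iff)
    qed
    from no_interior_contact[OF opn this s(3,1,2) P \<eta> ell assms(9,12,14,15) \<theta> approx[unfolded u1_def]]
    show False .
  qed
  then have "(SUP x\<in>\<Omega>. u x - v x) \<le> u z - v z"
    using ne by (intro cSUP_least) auto
  with z show ?thesis by (intro bexI[of _ z]) auto
qed

end
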